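(* Let $\mathrm{L}$ and $\mathbf{D}$ be a spline-admissible pair of order $r>d/2$ on $\mathbb{R}^d$, with generalized B-splines $\varphi_j$ ($j\in\mathbb{Z}$). Then the spaces $$V_j=\Big\{\sum_{\bm{k}\in\mathbb{Z}^d}c[\bm{k}]\,\varphi_j(\cdot-\mathbf{D}^j\bm{k}) : c\in\ell_2(\mathbb{Z}^d)\Big\},\qquad j\in\mathbb{Z},$$ form a non-stationary multiresolution analysis of $L_2(\mathbb{R}^d)$ (with dilation matrix $\mathbf{D}$).
   Context: Conventions: $\widehat f(\bm{\omega})=\int_{\mathbb{R}^d}f(\bm{x})e^{-i\bm{x}\cdot\bm{\omega}}\,d\bm{x}$, $g^\vee$ is the inverse Fourier transform, $z^*$ denotes the complex conjugate. A Fourier multiplier operator $\mathrm{L}$ with measurable symbol $\widehat L$ acts by $\mathrm{L}f=(\widehat L\,\widehat f)^\vee$. It is admissible if $\widehat L=f/g$ with $f,g$ continuous functions on $\mathbb{R}^d$ such that the set of zeros of $fg$ has Lebesgue measure zero and the zero sets of $f$ and $g$ are disjoint. An operator $\mathrm{L}$ and an integer $d\times d$ matrix $\mathbf{D}$ are a spline-admissible pair of order $r>d/2$ if: (1) $\mathrm{L}$ is an admissible Fourier multiplier operator; (2) $\mathbf{D}=a\mathbf{R}$ with $\mathbf{R}$ orthogonal and $a>1$; (3) there is $C_{\mathrm{L}}>0$ with $C_{\mathrm{L}}(1+|\widehat L(\bm{\omega})|^2)\ge|\bm{\omega}|^{2r}$ for almost every $\bm{\omega}$; (4) for every $j\in\mathbb{Z}$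 there is a periodic function $\widehat L_{\mathrm{d},j}(\bm{\omega})=\sum_{\bm{k}\in\mathbb{Z}^d}p_j[\bm{k}]e^{i\bm{\omega}\cdot\mathbf{D}^j\bm{k}}$ with $p_j\in\ell_1(\mathbb{Z}^d)$ such that $\widehat\varphi_j:=\widehat L_{\mathrm{d},j}\widehat L^{-1}$ satisfies, for some real constants $A_j,B_j$ and almost every $\bm{\omega}$, $$0<A_j\le\sum_{\bm{k}\in\mathbb{Z}^d}|\widehat\varphi_j(\bm{\omega}+2\pi(\mathbf{D}^T)^{-j}\bm{k})|^2\le B_j<\infty.$$ The functions $\varphi_j:=(\widehat\varphi_j)^\vee\in L_2(\mathbb{R}^d)$ are called generalized B-splines for $\mathrm{L}$. A sequence $\{V_j\}_{j\in\mathbb{Z}}$ of closed linear subspaces of $L_2(\mathbb{R}^d)$ forms a non-stationary multiresolution analysis with dilation matrix $\mathbf{A}$ (an expansive integer matrix, i.e. all eigenvalues larger than 1 in absolute value) if: (1) $V_{j+1}\subseteq V_j$ for all $j$; (2) $\bigcup_{j}V_j$ is dense in $L_2(\mathbb{R}^d)$ and $\bigcap_jV_j$ is at most one-dimensional; (3) $f\in V_j$ if and only if $f(\cdot-\mathbf{A}^j\bm{k})\in V_j$, for all $j\in\mathbb{Z}$, $\bm{k}\in\mathbb{Z}^d$; (4) for each $j$ there is $\varphi_j\in V_j$ such that $\{\varphi_j(\cdot-\mathbf{A}^j\bm{k}):\bm{k}\in\mathbb{Z}^d\}$ is a Riesz basis of $V_j$, i.e. there are $0<A_j\le B_j<\infty$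 with $A_j\|c\|_{\ell_2}^2\le\|\sum_{\bm{k}}c[\bm{k}]\varphi_j(\cdot-\mathbf{A}^j\bm{k})\|_{L_2}^2\le B_j\|c\|_{\ell_2}^2$. *)

theory Defs
  imports "HOL-Analysis.Analysis"
begin

text \<open>
  Elements of $L_2(R^d)$ are represented by functions, not by classes modulo null sets. All
  sets of functions used as subspaces below are closed under almost-everywhere equality, because
  membership only depends on convergence in the $L_2$ seminorm.
\<close>

definition L2_space :: "(real ^ 'n \<Rightarrow> complex) set" where
  "L2_space = {f. f \<in> borel_measurable lebesgue \<and> integrable lebesgue (\<lambda>x. (cmod (f x))\<^sup>2)}"

definition L2_norm :: "(real ^ 'n \<Rightarrow> complex) \<Rightarrow> real" where
  "L2_norm f = sqrt (integral\<^sup>L lebesgue (\<lambda>x. (cmod (f x))\<^sup>2))"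

text \<open>
  Membership in the space is part of convergence, since the Bochner integral of a
  non-integrable function is 0.
\<close>

definition L2_tendsto ::
    "('i \<Rightarrow> real ^ 'n \<Rightarrow> complex) \<Rightarrow> (real ^ 'n \<Rightarrow> complex) \<Rightarrow> 'i filter \<Rightarrow> bool" where
  "L2_tendsto s f \<F> \<longleftrightarrow>
     (\<forall>i. s i \<in> L2_space) \<and> f \<in> L2_space \<and>
     ((\<lambda>i. L2_norm (\<lambda>x. s i x - f x)) \<longlongrightarrow> 0) \<F>"

definition L2_has_sum ::
    "('k \<Rightarrow> real ^ 'n \<Rightarrow> complex) \<Rightarrow> (real ^ 'n \<Rightarrow> complex) \<Rightarrow> bool" where
  "L2_has_sum u f \<longleftrightarrow> L2_tendsto (\<lambda>K x. \<Sum>k\<in>K. u k x) f (finite_subsets_at_top UNIV)"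

definition L2_closed_subspace :: "(real ^ 'n \<Rightarrow> complex) set \<Rightarrow> bool" where
  "L2_closed_subspace V \<longleftrightarrow>
     V \<subseteq> L2_space \<and>
     (\<lambda>x. 0) \<in> V \<and>
     (\<forall>f\<in>V. \<forall>g\<in>V. (\<lambda>x. f x + g x) \<in> V) \<and>
     (\<forall>c. \<forall>f\<in>V. (\<lambda>x. c * f x) \<in> V) \<and>
     (\<forall>(s :: nat \<Rightarrow> _) f. (\<forall>n. s n \<in> V) \<longrightarrow> L2_tendsto s f sequentially \<longrightarrow> f \<in> V)"

definition ell2 :: "('k \<Rightarrow> complex) set" where
  "ell2 = {c. (\<lambda>k. (cmod (c k))\<^sup>2) summable_on UNIV}"

definition ell2_norm :: "('k \<Rightarrow> complex) \<Rightarrow> real" where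
  "ell2_norm c = sqrt (\<Sum>\<^sub>\<infinity>k. (cmod (c k))\<^sup>2)"

text \<open>
  The second conjunct says that the family spans; the third one that synthesis is defined on all
  of $\ell_2$, with values in \<open>V\<close>, and satisfies the two Riesz bounds.
\<close>

definition riesz_basis ::
    "(real ^ 'n \<Rightarrow> complex) set \<Rightarrow> ('k \<Rightarrow> real ^ 'n \<Rightarrow> complex) \<Rightarrow> bool" where
  "riesz_basis V e \<longleftrightarrow>
     (\<forall>k. e k \<in> V) \<and>
     (\<forall>f\<in>V. \<exists>c\<in>ell2. L2_has_sum (\<lambda>k x. c k * e k x) f) \<and>
     (\<exists>A B. 0 < A \<and> A \<le> B \<and>
        (\<forall>c\<in>ell2. \<exists>f\<in>V. L2_has_sum (\<lambda>k x. c k * e k x) f \<and>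
           A * (ell2_norm c)\<^sup>2 \<le> (L2_norm f)\<^sup>2 \<and> (L2_norm f)\<^sup>2 \<le> B * (ell2_norm c)\<^sup>2))"

definition fourier_integral :: "(real ^ 'n \<Rightarrow> complex) \<Rightarrow> real ^ 'n \<Rightarrow> complex" where
  "fourier_integral f \<omega> =
     integral\<^sup>L lebesgue (\<lambda>x. f x * exp (- (\<i> * complex_of_real (x \<bullet> \<omega>))))"

text \<open>
  \<open>fourier_L2 f F\<close>: the function \<open>F\<close> is (a representative of) the Fourier transform of \<open>f\<close>, i.e.
  the continuous extension to $L_2$ of the integral transform on $L_1 \cap L_2$. Equivalently,
  \<open>f\<close> is (a representative of) the inverse Fourier transform of \<open>F\<close>.
\<close>

definition fourier_L2 :: "(real ^ 'n \<Rightarrow> complex) \<Rightarrow> (real ^ 'n \<Rightarrow> complex) \<Rightarrow> bool" where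
  "fourier_L2 f F \<longleftrightarrow>
     (\<exists>s :: nat \<Rightarrow> real ^ 'n \<Rightarrow> complex.
        (\<forall>n. integrable lebesgue (s n)) \<and>
        L2_tendsto s f sequentially \<and>
        L2_tendsto (\<lambda>n. fourier_integral (s n)) F sequentially)"

text \<open>
  The multiplier acts by \<open>L f = (Lhat \<cdot> fhat)\<^sup>\<or>\<close> whenever both \<open>fhat\<close> and the product are square
  integrable. Nothing is required of \<open>L\<close> on other functions, so operators with a larger domain
  are covered.
\<close>

definition fourier_multiplier ::
    "((real ^ 'n \<Rightarrow> complex) \<Rightarrow> real ^ 'n \<Rightarrow> complex) \<Rightarrow> (real ^ 'n \<Rightarrow> complex) \<Rightarrow> bool" where
  "fourier_multiplier L Lhat \<longleftrightarrow>
     Lhat \<in> borel_measurable lebesgue \<and>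
     (\<forall>f F. fourier_L2 f F \<longrightarrow> (\<lambda>\<omega>. Lhat \<omega> * F \<omega>) \<in> L2_space \<longrightarrow>
        fourier_L2 (L f) (\<lambda>\<omega>. Lhat \<omega> * F \<omega>))"

definition admissible_multiplier ::
    "((real ^ 'n \<Rightarrow> complex) \<Rightarrow> real ^ 'n \<Rightarrow> complex) \<Rightarrow> (real ^ 'n \<Rightarrow> complex) \<Rightarrow> bool" where
  "admissible_multiplier L Lhat \<longleftrightarrow>
     fourier_multiplier L Lhat \<and>
     (\<exists>f g. continuous_on UNIV f \<and> continuous_on UNIV g \<and>
        (AE \<omega> in lebesgue. Lhat \<omega> = f \<omega> / g \<omega>) \<and>
        {\<omega>. f \<omega> * g \<omega> = 0} \<in> null_sets lebesgue \<and>
        {\<omega>. f \<omega> = 0} \<inter> {\<omega>. g \<omega> = 0} = {})"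

definition int_matrix :: "real ^ 'n ^ 'n \<Rightarrow> bool" where
  "int_matrix A \<longleftrightarrow> (\<forall>i j. A $ i $ j \<in> \<int>)"

text \<open>On vectors, \<open>*\<close> and hence \<open>^\<close> are componentwise, so matrix powers are defined from \<open>**\<close>.\<close>

definition matrix_powi :: "real ^ 'n ^ 'n \<Rightarrow> int \<Rightarrow> real ^ 'n ^ 'n" where
  "matrix_powi A j =
     (if j \<ge> 0 then (((**) A) ^^ nat j) (mat 1) else (((**) (matrix_inv A)) ^^ nat (- j)) (mat 1))"

definition real_vec :: "int ^ 'n \<Rightarrow> real ^ 'n" where
  "real_vec k = (\<chi> i. real_of_int (k $ i))"

definition lattice_point :: "real ^ 'n ^ 'n \<Rightarrow> int \<Rightarrow> int ^ 'n \<Rightarrow> real ^ 'n" where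
  "lattice_point A j k = matrix_powi A j *v real_vec k"

definition is_eigenvalue :: "real ^ 'n ^ 'n \<Rightarrow> complex \<Rightarrow> bool" where
  "is_eigenvalue A z \<longleftrightarrow>
     (\<exists>v :: complex ^ 'n. v \<noteq> 0 \<and> (\<chi> i j. complex_of_real (A $ i $ j)) *v v = z *s v)"

definition expansive :: "real ^ 'n ^ 'n \<Rightarrow> bool" where
  "expansive A \<longleftrightarrow> (\<forall>z. is_eigenvalue A z \<longrightarrow> cmod z > 1)"

definition localization_symbol ::
    "real ^ 'n ^ 'n \<Rightarrow> int \<Rightarrow> (int ^ 'n \<Rightarrow> complex) \<Rightarrow> real ^ 'n \<Rightarrow> complex" where
  "localization_symbol D j p \<omega> =
     (\<Sum>\<^sub>\<infinity>k. p k * exp (\<i> * complex_of_real (\<omega> \<bullet> lattice_point D j k)))"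

definition bspline_symbol ::
    "(real ^ 'n \<Rightarrow> complex) \<Rightarrow> real ^ 'n ^ 'n \<Rightarrow> int \<Rightarrow> (int ^ 'n \<Rightarrow> complex) \<Rightarrow> real ^ 'n \<Rightarrow> complex"
  where
  "bspline_symbol Lhat D j p \<omega> = localization_symbol D j p \<omega> * inverse (Lhat \<omega>)"

definition localizing_sequence ::
    "(real ^ 'n \<Rightarrow> complex) \<Rightarrow> real ^ 'n ^ 'n \<Rightarrow> int \<Rightarrow> (int ^ 'n \<Rightarrow> complex) \<Rightarrow> bool" where
  "localizing_sequence Lhat D j p \<longleftrightarrow>
     (\<lambda>k. cmod (p k)) summable_on UNIV \<and>
     (\<exists>A B. 0 < A \<and>
        (AE \<omega> in lebesgue.
           let u = (\<lambda>k. (cmod (bspline_symbol Lhat D j p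
                        (\<omega> + (2 * pi) *\<^sub>R lattice_point (transpose D) (- j) k)))\<^sup>2)
           in u summable_on UNIV \<and> A \<le> (\<Sum>\<^sub>\<infinity>k. u k) \<and> (\<Sum>\<^sub>\<infinity>k. u k) \<le> B))"

definition spline_admissible_pair ::
    "((real ^ 'n \<Rightarrow> complex) \<Rightarrow> real ^ 'n \<Rightarrow> complex) \<Rightarrow> (real ^ 'n \<Rightarrow> complex) \<Rightarrow>
     real ^ 'n ^ 'n \<Rightarrow> real \<Rightarrow> bool" where
  "spline_admissible_pair L Lhat D r \<longleftrightarrow>
     r > real CARD('n) / 2 \<and>
     int_matrix D \<and>
     admissible_multiplier L Lhat \<and>
     (\<exists>a R. a > 1 \<and> orthogonal_matrix R \<and> D = a *\<^sub>R R) \<and>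
     (\<exists>C>0. AE \<omega> in lebesgue. C * (1 + (cmod (Lhat \<omega>))\<^sup>2) \<ge> norm \<omega> powr (2 * r)) \<and>
     (\<forall>j. \<exists>p. localizing_sequence Lhat D j p)"

text \<open>
  A generalized B-spline depends on the choice of the localizing sequence, and is determined by
  it up to a null set.
\<close>

definition generalized_bspline ::
    "(real ^ 'n \<Rightarrow> complex) \<Rightarrow> real ^ 'n ^ 'n \<Rightarrow> int \<Rightarrow> (real ^ 'n \<Rightarrow> complex) \<Rightarrow> bool" where
  "generalized_bspline Lhat D j \<phi> \<longleftrightarrow>
     (\<exists>p. localizing_sequence Lhat D j p \<and> fourier_L2 \<phi> (bspline_symbol Lhat D j p))"

definition spline_space ::
    "real ^ 'n ^ 'n \<Rightarrow> int \<Rightarrow> (real ^ 'n \<Rightarrow> complex) \<Rightarrow> (real ^ 'n \<Rightarrow> complex) set" where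
  "spline_space D j \<phi> =
     {f. \<exists>c\<in>ell2. L2_has_sum (\<lambda>k x. c k * \<phi> (x - lattice_point D j k)) f}"

definition nonstationary_MRA ::
    "real ^ 'n ^ 'n \<Rightarrow> (int \<Rightarrow> (real ^ 'n \<Rightarrow> complex) set) \<Rightarrow> bool" where
  "nonstationary_MRA A V \<longleftrightarrow>
     int_matrix A \<and> expansive A \<and>
     (\<forall>j. L2_closed_subspace (V j)) \<and>
     (\<forall>j. V (j + 1) \<subseteq> V j) \<and>
     (\<forall>f\<in>L2_space. \<forall>\<epsilon>>0. \<exists>g\<in>(\<Union>j. V j). L2_norm (\<lambda>x. f x - g x) < \<epsilon>) \<and>
     (\<exists>g\<in>L2_space. \<forall>f\<in>(\<Inter>j. V j). \<exists>c. AE x in lebesgue. f x = c * g x) \<and>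
     (\<forall>j k f. f \<in> V j \<longleftrightarrow> (\<lambda>x. f (x - lattice_point A j k)) \<in> V j) \<and>
     (\<forall>j. \<exists>\<phi>\<in>V j. riesz_basis (V j) (\<lambda>k x. \<phi> (x - lattice_point A j k)))"

end

theory Submission
  imports Defs "HOL-Probability.Characteristic_Functions"
begin

text \<open>
  On the Fourier side the spline space at level \<open>j\<close> does not depend on the B-spline: since
  \<open>L\<^sub>d\<^sub>,\<^sub>j\<close> is periodic and nonzero almost everywhere, \<open>f\<close> belongs to it iff \<open>fhat \<cdot> Lhat\<close> is
  periodic almost everywhere with respect to the lattice \<open>2\<pi> (D\<^sup>T)\<^sup>-\<^sup>j Z\<^sup>d\<close>. That the quotient of
  \<open>fhat\<close> by the symbol of the B-spline then has \<open>\<ell>\<^sub>2\<close> Fourier coefficients, and the Riesz bounds, follow by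
  unfolding integrals over the lattice and completeness of the trigonometric system.

  The period lattices increase with \<open>j\<close>, so the spaces decrease. As \<open>j\<close> tends to infinity the lattices
  become dense, so on the intersection \<open>fhat \<cdot> Lhat\<close> is constant. As \<open>j\<close> tends to minus infinity their
  cells exhaust the space: a bounded multiple of a fixed B-spline symbol, made periodic by
  reduction to the cell, is then close to the original one, and these multiples are dense.

  Plancherel's theorem is obtained from the span of modulated and translated Gaussians, which the Fourier
  transform permutes; both this span and the trigonometric polynomials are dense by the
  Stone-Weierstrass theorem on the torus.
\<close>

section \<open>The space of square integrable functions\<close>

text \<open>\<open>fourier_L2\<close> accepts every sequence of integrable functions that converges
  on both sides, so uniqueness of the transform needs the norm identity for all integrable
  \<open>s\<close> with \<open>s\<close> and its transform square integrable, not just on the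
  Gaussian span. Duality provides it: the multiplication formula moves the transform onto a Gaussian
  test function, where norms are known. The transform is unnormalized, hence the factor
  \<open>gauss_const\<close>, which is (2 pi)^(n/2). Lattice arguments are carried out for Z^n. The
  substitution \<open>dual_map j\<close>, that is 2 pi times the (-j)-th power of the transpose of
  \<open>D\<close>, maps Z^n onto the period lattice of level \<open>j\<close> and turns the phases
  of the translates into \<open>trig_char (- k)\<close>. The periodicity relation gives the
  remaining axioms: it survives almost everywhere convergence of a subsequence, which gives
  closedness, and translations by lattice points multiply F by a periodic phase. On the intersection
  F is a constant divided by Lhat, which is why any two elements are proportional.\<close>

lemma L2_space_iff:
  "f \<in> L2_space \<longleftrightarrow> f \<in> borel_measurable lebesgue \<and> (\<integral>\<^sup>+x. ennreal ((cmod (f x))\<^sup>2) \<partial>lebesgue) < \<infinity>"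
  unfolding L2_space_def by (auto simp: integrable_iff_bounded)

lemma L2_measurable: "f \<in> L2_space \<Longrightarrow> f \<in> borel_measurable lebesgue"
  by (simp add: L2_space_def)

lemma L2_integrable: "f \<in> L2_space \<Longrightarrow> integrable lebesgue (\<lambda>x. (cmod (f x))\<^sup>2)"
  by (simp add: L2_space_def)

lemma L2_norm_nonneg [simp]: "0 \<le> L2_norm f"
  by (simp add: L2_norm_def)

lemma L2_norm_sq: "(L2_norm f)\<^sup>2 = integral\<^sup>L lebesgue (\<lambda>x. (cmod (f x))\<^sup>2)"
  by (simp add: L2_norm_def)

lemma L2_norm_sq_ennreal:
  "f \<in> L2_space \<Longrightarrow> ennreal ((L2_norm f)\<^sup>2) = (\<integral>\<^sup>+x. ennreal ((cmod (f x))\<^sup>2) \<partial>lebesgue)"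
  by (subst nn_integral_eq_integral) (auto simp: L2_norm_sq L2_integrable)

lemma L2_norm_zero [simp]: "L2_norm (\<lambda>x. 0) = 0"
  by (simp add: L2_norm_def)

lemma L2_zero: "(\<lambda>x. 0) \<in> L2_space"
  by (simp add: L2_space_def)

lemma L2_AE_cong:
  assumes "f \<in> L2_space" "g \<in> borel_measurable lebesgue" "AE x in lebesgue. f x = g x"
  shows "g \<in> L2_space" "L2_norm g = L2_norm f"
proof -
  have [measurable]: "f \<in> borel_measurable lebesgue" "g \<in> borel_measurable lebesgue"
    using assms by (auto simp: L2_measurable)
  have "integrable lebesgue (\<lambda>x. (cmod (g x))\<^sup>2)"
    using L2_integrable[OF assms(1)]
    by (rule integrable_cong_AE_imp) (use assms(3) in auto)
  then show "g \<in> L2_space" using assms by (simp add: L2_space_def)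
  show "L2_norm g = L2_norm f" unfolding L2_norm_def
    by (rule arg_cong[where f=sqrt], rule integral_cong_AE) (use assms(3) in auto)
qed

lemma L2_norm_cong_AE:
  assumes "f \<in> borel_measurable lebesgue" "g \<in> borel_measurable lebesgue"
    "AE x in lebesgue. cmod (f x) = cmod (g x)"
  shows "L2_norm f = L2_norm g"
  unfolding L2_norm_def
  by (rule arg_cong[where f=sqrt], rule integral_cong_AE) (use assms in auto)

lemma L2_mono:
  fixes f g :: "real ^ 'n \<Rightarrow> complex"
  assumes "g \<in> L2_space" "f \<in> borel_measurable lebesgue"
    "AE x in lebesgue. cmod (f x) \<le> C * cmod (g x)" "C \<ge> 0"
  shows "f \<in> L2_space" "L2_norm f \<le> C * L2_norm g"
proof -
  have ae: "AE x in lebesgue. (cmod (f x))\<^sup>2 \<le> C\<^sup>2 * (cmod (g x))\<^sup>2"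
    using assms(3) by eventually_elim (metis norm_ge_zero power_mono power_mult_distrib)
  have ig: "integrable lebesgue (\<lambda>x. C\<^sup>2 * (cmod (g x))\<^sup>2)"
    using L2_integrable[OF assms(1)] by simp
  have "integrable lebesgue (\<lambda>x. (cmod (f x))\<^sup>2)"
    by (rule Bochner_Integration.integrable_bound[OF ig]) (use ae assms in auto)
  then show f: "f \<in> L2_space" using assms by (simp add: L2_space_def)
  have "(L2_norm f)\<^sup>2 \<le> integral\<^sup>L lebesgue (\<lambda>x. C\<^sup>2 * (cmod (g x))\<^sup>2)"
    unfolding L2_norm_sq by (rule integral_mono_AE[OF L2_integrable[OF f] ig ae])
  also have "\<dots> = (C * L2_norm g)\<^sup>2" by (simp add: L2_norm_sq power_mult_distrib)
  finally show "L2_norm f \<le> C * L2_norm g"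
    by (rule power2_le_imp_le) (simp add: assms)
qed

lemma L2_mult_bounded:
  assumes "g \<in> L2_space" "h \<in> borel_measurable lebesgue" "\<And>x. cmod (h x) \<le> C"
  shows "(\<lambda>x. h x * g x) \<in> L2_space" "L2_norm (\<lambda>x. h x * g x) \<le> C * L2_norm g"
proof -
  have C: "0 \<le> C" using assms(3)[of 0] norm_ge_zero order_trans by blast
  have *: "AE x in lebesgue. cmod (h x * g x) \<le> C * cmod (g x)"
    using assms(3) by (intro AE_I2) (simp add: norm_mult mult_right_mono)
  have m: "(\<lambda>x. h x * g x) \<in> borel_measurable lebesgue"
    using assms(2) L2_measurable[OF assms(1)] by measurable
  show "(\<lambda>x. h x * g x) \<in> L2_space" "L2_norm (\<lambda>x. h x * g x) \<le> C * L2_norm g"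
    using L2_mono[OF assms(1) m * C] by auto
qed

lemma L2_scale: "f \<in> L2_space \<Longrightarrow> (\<lambda>x. c * f x) \<in> L2_space"
  using L2_mult_bounded(1)[of f "\<lambda>x. c" "cmod c"] by simp

lemma L2_add:
  assumes "f \<in> L2_space" "g \<in> L2_space"
  shows "(\<lambda>x. f x + g x) \<in> L2_space"
proof -
  have [measurable]: "f \<in> borel_measurable lebesgue" "g \<in> borel_measurable lebesgue"
    using assms by (auto simp: L2_measurable)
  have i: "integrable lebesgue (\<lambda>x. 2 * (cmod (f x))\<^sup>2 + 2 * (cmod (g x))\<^sup>2)"
    using L2_integrable[OF assms(1)] L2_integrable[OF assms(2)] by simp
  have "integrable lebesgue (\<lambda>x. (cmod (f x + g x))\<^sup>2)"
  proof (rule Bochner_Integration.integrable_bound[OF i])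
    show "(\<lambda>x. (cmod (f x + g x))\<^sup>2) \<in> borel_measurable lebesgue"
      by measurable
    have "(cmod (f x + g x))\<^sup>2 \<le> 2 * (cmod (f x))\<^sup>2 + 2 * (cmod (g x))\<^sup>2" for x
    proof -
      have "(cmod (f x + g x))\<^sup>2 \<le> (cmod (f x) + cmod (g x))\<^sup>2"
        by (intro power_mono norm_triangle_ineq) auto
      also have "\<dots> \<le> 2 * (cmod (f x))\<^sup>2 + 2 * (cmod (g x))\<^sup>2"
        using zero_le_power2[of "cmod (f x) - cmod (g x)"] by (simp add: power2_eq_square algebra_simps)
      finally show ?thesis .
    qed
    then show "AE x in lebesgue. norm ((cmod (f x + g x))\<^sup>2) \<le> norm (2 * (cmod (f x))\<^sup>2 + 2 * (cmod (g x))\<^sup>2)"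
      by auto
  qed
  then show ?thesis using assms by (auto simp: L2_space_def)
qed

lemma L2_diff: "f \<in> L2_space \<Longrightarrow> g \<in> L2_space \<Longrightarrow> (\<lambda>x. f x - g x) \<in> L2_space"
  using L2_add[of f "\<lambda>x. (-1) * g x"] L2_scale[of g "-1"] by simp

lemma L2_sum: "(\<And>i. i \<in> I \<Longrightarrow> f i \<in> L2_space) \<Longrightarrow> (\<lambda>x. \<Sum>i\<in>I. f i x) \<in> L2_space"
  by (induction I rule: infinite_finite_induct) (auto intro: L2_add L2_zero)

abbreviation L2_dist :: "(real ^ 'n \<Rightarrow> complex) \<Rightarrow> (real ^ 'n \<Rightarrow> complex) \<Rightarrow> real" where
  "L2_dist f g \<equiv> L2_norm (\<lambda>x. f x - g x)"

lemma L2_norm_minus_commute: "L2_dist f g = L2_dist g f"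
  by (simp add: L2_norm_def norm_minus_commute)

text \<open>The inequality is first taken for nonnegative integrals, because integrability of the
  product is itself a conclusion. No conjugate appears: the pairing is bilinear, as in the
  multiplication formula for Fourier integrals.\<close>

lemma L2_Cauchy_Schwarz:
  assumes f: "f \<in> L2_space" and g: "g \<in> L2_space"
  shows "integrable lebesgue (\<lambda>x. f x * g x)"
    "integral\<^sup>L lebesgue (\<lambda>x. cmod (f x * g x)) \<le> L2_norm f * L2_norm g"
    "cmod (integral\<^sup>L lebesgue (\<lambda>x. f x * g x)) \<le> L2_norm f * L2_norm g"
proof -
  have [measurable]: "f \<in> borel_measurable lebesgue" "g \<in> borel_measurable lebesgue"
    using f g by (auto simp: L2_measurable)
  have "(\<integral>\<^sup>+x. ennreal (cmod (f x * g x)) \<partial>lebesgue)\<^sup>2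
      \<le> (\<integral>\<^sup>+x. (ennreal (cmod (f x)))\<^sup>2 \<partial>lebesgue) * (\<integral>\<^sup>+x. (ennreal (cmod (g x)))\<^sup>2 \<partial>lebesgue)"
    using Cauchy_Schwarz_nn_integral[of "\<lambda>x. ennreal (cmod (f x))" lebesgue "\<lambda>x. ennreal (cmod (g x))"]
    by (simp add: norm_mult ennreal_mult)
  also have "\<dots> = ennreal ((L2_norm f * L2_norm g)\<^sup>2)"
    using f g by (simp add: ennreal_power L2_norm_sq_ennreal[symmetric] ennreal_mult power_mult_distrib)
  finally have *: "(\<integral>\<^sup>+x. ennreal (cmod (f x * g x)) \<partial>lebesgue)\<^sup>2 \<le> ennreal ((L2_norm f * L2_norm g)\<^sup>2)" .
  then have "(\<integral>\<^sup>+x. ennreal (cmod (f x * g x)) \<partial>lebesgue)\<^sup>2 < \<infinity>"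
    by (simp add: order.strict_trans1)
  then have "(\<integral>\<^sup>+x. ennreal (cmod (f x * g x)) \<partial>lebesgue) < \<infinity>"
    by (simp add: power_less_top_ennreal)
  then show i: "integrable lebesgue (\<lambda>x. f x * g x)"
    by (auto simp: integrable_iff_bounded)
  have "(\<integral>\<^sup>+x. ennreal (cmod (f x * g x)) \<partial>lebesgue) = ennreal (integral\<^sup>L lebesgue (\<lambda>x. cmod (f x * g x)))"
    using i by (intro nn_integral_eq_integral) auto
  with * have "ennreal ((integral\<^sup>L lebesgue (\<lambda>x. cmod (f x * g x)))\<^sup>2) \<le> ennreal ((L2_norm f * L2_norm g)\<^sup>2)"
    by (simp add: ennreal_power)
  then have "(integral\<^sup>L lebesgue (\<lambda>x. cmod (f x * g x)))\<^sup>2 \<le> (L2_norm f * L2_norm g)\<^sup>2"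
    by (subst (asm) ennreal_le_iff) auto
  then show 2: "integral\<^sup>L lebesgue (\<lambda>x. cmod (f x * g x)) \<le> L2_norm f * L2_norm g"
    by (rule power2_le_imp_le) simp
  then show "cmod (integral\<^sup>L lebesgue (\<lambda>x. f x * g x)) \<le> L2_norm f * L2_norm g"
    using integral_norm_bound[of lebesgue "\<lambda>x. f x * g x"] by linarith
qed

lemma L2_norm_triangle:
  assumes f: "f \<in> L2_space" and g: "g \<in> L2_space"
  shows "L2_norm (\<lambda>x. f x + g x) \<le> L2_norm f + L2_norm g"
proof (rule power2_le_imp_le)
  have [measurable]: "f \<in> borel_measurable lebesgue" "g \<in> borel_measurable lebesgue"
    using f g by (auto simp: L2_measurable)
  have i: "integrable lebesgue (\<lambda>x. cmod (f x * g x))" using L2_Cauchy_Schwarz(1)[OF f g] by auto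
  have "(L2_norm (\<lambda>x. f x + g x))\<^sup>2
     \<le> integral\<^sup>L lebesgue (\<lambda>x. (cmod (f x))\<^sup>2 + 2 * cmod (f x * g x) + (cmod (g x))\<^sup>2)"
    unfolding L2_norm_sq
  proof (rule integral_mono)
    fix x
    have "(cmod (f x + g x))\<^sup>2 \<le> (cmod (f x) + cmod (g x))\<^sup>2"
      by (intro power_mono norm_triangle_ineq) auto
    then show "(cmod (f x + g x))\<^sup>2 \<le> (cmod (f x))\<^sup>2 + 2 * cmod (f x * g x) + (cmod (g x))\<^sup>2"
      by (simp add: power2_eq_square algebra_simps norm_mult)
  qed (use i L2_integrable[OF f] L2_integrable[OF g] L2_integrable[OF L2_add[OF f g]] in auto)
  also have "\<dots> = (L2_norm f)\<^sup>2 + 2 * integral\<^sup>L lebesgue (\<lambda>x. cmod (f x * g x)) + (L2_norm g)\<^sup>2"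
    using i f g by (simp add: L2_norm_sq L2_integrable)
  also have "\<dots> \<le> (L2_norm f + L2_norm g)\<^sup>2"
    using L2_Cauchy_Schwarz(2)[OF f g] by (simp add: power2_eq_square algebra_simps)
  finally show "(L2_norm (\<lambda>x. f x + g x))\<^sup>2 \<le> (L2_norm f + L2_norm g)\<^sup>2" .
qed auto

lemma L2_norm_triangle3:
  assumes "f \<in> L2_space" "g \<in> L2_space" "h \<in> L2_space"
  shows "L2_dist f h \<le> L2_dist f g + L2_dist g h"
  using L2_norm_triangle[OF L2_diff[OF assms(1,2)] L2_diff[OF assms(2,3)]] by simp

lemma L2_norm_diff_ge:
  assumes "f \<in> L2_space" "g \<in> L2_space"
  shows "\<bar>L2_norm f - L2_norm g\<bar> \<le> L2_dist f g"
  using L2_norm_triangle[OF L2_diff[OF assms] assms(2)] 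
    L2_norm_triangle[OF L2_diff[OF assms(2,1)] assms(1)] L2_norm_minus_commute[of f g] by simp

lemma L2_norm_eq_0:
  assumes "f \<in> L2_space" "L2_norm f = 0"
  shows "AE x in lebesgue. f x = 0"
proof -
  have "integral\<^sup>L lebesgue (\<lambda>x. (cmod (f x))\<^sup>2) = 0"
    using assms(2) L2_norm_sq[of f] by simp
  then show ?thesis
    using integral_nonneg_eq_0_iff_AE[OF L2_integrable[OF assms(1)]] by simp
qed

text \<open>The majorant is a complex function \<open>w\<close>, so that its square integrability is
  simply membership in \<open>L2_space\<close>; dominated convergence is applied to the squared
  moduli.\<close>

lemma L2_dominated:
  fixes s :: "nat \<Rightarrow> real ^ 'n \<Rightarrow> complex"
  assumes s: "\<And>n. s n \<in> borel_measurable lebesgue" and w: "w \<in> L2_space"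
    and lim: "AE x in lebesgue. (\<lambda>n. s n x) \<longlonglongrightarrow> 0"
    and bd: "\<And>n. AE x in lebesgue. cmod (s n x) \<le> cmod (w x)"
  shows "\<And>n. s n \<in> L2_space" "(\<lambda>n. L2_norm (s n)) \<longlonglongrightarrow> 0"
proof -
  show "s n \<in> L2_space" for n
    using L2_mono(1)[OF w s, where C=1] bd by auto
  have [measurable]: "s n \<in> borel_measurable lebesgue" for n by (rule s)
  have "(\<lambda>n. integral\<^sup>L lebesgue (\<lambda>x. (cmod (s n x))\<^sup>2)) \<longlonglongrightarrow> integral\<^sup>L lebesgue (\<lambda>x::real^'n. 0::real)"
  proof (rule integral_dominated_convergence)
    show "integrable lebesgue (\<lambda>x. (cmod (w x))\<^sup>2)" using w by (rule L2_integrable)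
    show "AE x in lebesgue. (\<lambda>n. (cmod (s n x))\<^sup>2) \<longlonglongrightarrow> 0"
      using lim
    proof eventually_elim
      case (elim x)
      show ?case using tendsto_power[OF tendsto_norm[OF elim], of 2] by simp
    qed
    show "AE x in lebesgue. norm ((cmod (s n x))\<^sup>2) \<le> (cmod (w x))\<^sup>2" for n
      using bd[of n] by eventually_elim (auto intro: power_mono)
  qed measurable
  then have "(\<lambda>n. sqrt (integral\<^sup>L lebesgue (\<lambda>x. (cmod (s n x))\<^sup>2))) \<longlonglongrightarrow> sqrt 0"
    by (intro tendsto_real_sqrt) simp
  then show "(\<lambda>n. L2_norm (s n)) \<longlonglongrightarrow> 0" by (simp add: L2_norm_def)
qed

lemma L2_dominated_small:
  fixes s :: "nat \<Rightarrow> real ^ 'n \<Rightarrow> complex"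
  assumes "\<And>n. s n \<in> borel_measurable lebesgue" "w \<in> L2_space"
    "AE x in lebesgue. (\<lambda>n. s n x) \<longlonglongrightarrow> 0" "\<And>n. AE x in lebesgue. cmod (s n x) \<le> cmod (w x)" "e > 0"
  obtains n where "s n \<in> L2_space" "L2_norm (s n) < e"
  using eventually_happens'[OF sequentially_bot order_tendstoD(2)[OF L2_dominated(2)[OF assms(1-4)] assms(5)]]
    L2_dominated(1)[OF assms(1-4)] by blast

text \<open>The squared moduli converge to 0 in L1, and L1 convergence yields an almost everywhere
  convergent subsequence.\<close>

lemma L2_AE_subseq:
  fixes s :: "nat \<Rightarrow> real ^ 'n \<Rightarrow> complex"
  assumes "\<And>n. s n \<in> L2_space" "(\<lambda>n. L2_norm (s n)) \<longlonglongrightarrow> 0"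
  shows "\<exists>r::nat\<Rightarrow>nat. strict_mono r \<and> (AE x in lebesgue. (\<lambda>n. s (r n) x) \<longlonglongrightarrow> 0)"
proof -
  have "(\<lambda>n. (L2_norm (s n))\<^sup>2) \<longlonglongrightarrow> 0"
    using tendsto_power[OF assms(2), of 2] by simp
  then have "(\<lambda>n. integral\<^sup>L lebesgue (\<lambda>x. norm ((cmod (s n x))\<^sup>2))) \<longlonglongrightarrow> 0"
    by (simp add: L2_norm_sq)
  then obtain r :: "nat \<Rightarrow> nat" where r: "strict_mono r"
      "AE x in lebesgue. (\<lambda>n. (cmod (s (r n) x))\<^sup>2) \<longlonglongrightarrow> 0"
    using tendsto_L1_AE_subseq[of lebesgue "\<lambda>n x. (cmod (s n x))\<^sup>2"] assms(1) L2_integrable by blast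
  from r(2) have "AE x in lebesgue. (\<lambda>n. s (r n) x) \<longlonglongrightarrow> 0"
  proof eventually_elim
    case (elim x)
    from tendsto_real_sqrt[OF elim] show ?case by (simp add: tendsto_norm_zero_iff)
  qed
  with r(1) show ?thesis by blast
qed

section \<open>Convergence in the L2 seminorm and completeness\<close>

lemma L2_tendsto_norm:
  assumes "L2_tendsto s f F"
  shows "((\<lambda>i. L2_norm (s i)) \<longlongrightarrow> L2_norm f) F"
proof (rule LIM_zero_cancel, rule Lim_null_comparison)
  show "((\<lambda>i. L2_dist (s i) f) \<longlongrightarrow> 0) F"
    using assms by (simp add: L2_tendsto_def)
  show "\<forall>\<^sub>F i in F. norm (L2_norm (s i) - L2_norm f) \<le> L2_dist (s i) f"
    using assms by (intro always_eventually allI) (simp add: L2_tendsto_def L2_norm_diff_ge)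
qed

lemma L2_tendsto_add:
  assumes "L2_tendsto s f F" "L2_tendsto t g F"
  shows "L2_tendsto (\<lambda>i x. s i x + t i x) (\<lambda>x. f x + g x) F"
  unfolding L2_tendsto_def
proof (intro conjI allI)
  have [simp]: "s i \<in> L2_space" "t i \<in> L2_space" "f \<in> L2_space" "g \<in> L2_space" for i
    using assms by (auto simp: L2_tendsto_def)
  show "(\<lambda>x. s i x + t i x) \<in> L2_space" "(\<lambda>x. f x + g x) \<in> L2_space" for i
    by (auto intro: L2_add)
  show "((\<lambda>i. L2_norm (\<lambda>x. s i x + t i x - (f x + g x))) \<longlongrightarrow> 0) F"
  proof (rule Lim_null_comparison)
    show "((\<lambda>i. L2_dist (s i) f + L2_dist (t i) g) \<longlongrightarrow> 0) F"
      using assms tendsto_add[of "\<lambda>i. L2_dist (s i) f" 0 F "\<lambda>i. L2_dist (t i) g" 0]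
      by (simp add: L2_tendsto_def)
    have "L2_norm (\<lambda>x. s i x + t i x - (f x + g x)) \<le> L2_dist (s i) f + L2_dist (t i) g" for i
      using L2_norm_triangle[OF L2_diff[of "s i" f] L2_diff[of "t i" g]] by (simp add: algebra_simps)
    then show "\<forall>\<^sub>F i in F. norm (L2_norm (\<lambda>x. s i x + t i x - (f x + g x)))
       \<le> L2_dist (s i) f + L2_dist (t i) g"
      by auto
  qed
qed

lemma L2_tendsto_mult:
  assumes "L2_tendsto s f F" "h \<in> borel_measurable lebesgue" "\<And>x. cmod (h x) \<le> C"
  shows "L2_tendsto (\<lambda>i x. h x * s i x) (\<lambda>x. h x * f x) F"
  unfolding L2_tendsto_def
proof (intro conjI allI)
  have 1: "s i \<in> L2_space" "f \<in> L2_space" for i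
    using assms by (auto simp: L2_tendsto_def)
  show "(\<lambda>x. h x * s i x) \<in> L2_space" "(\<lambda>x. h x * f x) \<in> L2_space" for i
    using L2_mult_bounded(1)[OF _ assms(2,3)] 1 by auto
  show "((\<lambda>i. L2_norm (\<lambda>x. h x * s i x - h x * f x)) \<longlongrightarrow> 0) F"
  proof (rule Lim_null_comparison)
    show "((\<lambda>i. C * L2_dist (s i) f) \<longlongrightarrow> 0) F"
      using assms by (intro tendsto_mult_right_zero) (auto simp: L2_tendsto_def)
    show "\<forall>\<^sub>F i in F. norm (L2_norm (\<lambda>x. h x * s i x - h x * f x)) \<le> C * L2_dist (s i) f"
      using L2_mult_bounded(2)[OF L2_diff[OF 1] assms(2,3)] by (simp add: right_diff_distrib)
  qed
qed

lemma L2_tendsto_scale: "L2_tendsto s f F \<Longrightarrow> L2_tendsto (\<lambda>i x. c * s i x) (\<lambda>x. c * f x) F"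
  using L2_tendsto_mult[of s f F "\<lambda>x. c" "cmod c"] by simp

lemma L2_tendsto_diff:
  assumes "L2_tendsto s f F" "L2_tendsto t g F"
  shows "L2_tendsto (\<lambda>i x. s i x - t i x) (\<lambda>x. f x - g x) F"
  using L2_tendsto_add[OF assms(1) L2_tendsto_scale[OF assms(2), of "-1"]] by simp

lemma L2_tendsto_unique:
  assumes "L2_tendsto s f F" "L2_tendsto s g F" "F \<noteq> bot"
  shows "AE x in lebesgue. f x = g x"
proof -
  have fg: "f \<in> L2_space" "g \<in> L2_space" using assms by (auto simp: L2_tendsto_def)
  have "((\<lambda>i. L2_dist (s i) (s i)) \<longlongrightarrow> L2_dist f g) F"
    by (rule L2_tendsto_norm[OF L2_tendsto_diff[OF assms(1,2)]])
  then have "L2_dist f g = 0"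
    using assms(3) tendsto_unique[of F "\<lambda>i. 0::real"] by fastforce
  from L2_norm_eq_0[OF L2_diff[OF fg] this] show ?thesis by simp
qed

lemma L2_tendsto_AE_cong:
  assumes "L2_tendsto s f F" "AE x in lebesgue. f x = g x" "g \<in> borel_measurable lebesgue"
  shows "L2_tendsto s g F"
proof -
  have f: "f \<in> L2_space" and s: "\<And>i. s i \<in> L2_space" using assms by (auto simp: L2_tendsto_def)
  have g: "g \<in> L2_space" using L2_AE_cong(1)[OF f assms(3,2)] .
  have "L2_dist (s i) g = L2_dist (s i) f" for i
    by (rule L2_AE_cong(2)[OF L2_diff[OF s f]])
       (use assms(2) L2_measurable[OF L2_diff[OF s g]] in auto)
  then show ?thesis using assms g by (simp add: L2_tendsto_def)
qed

text \<open>Serves to replace density statements and nets over finite sets by sequences, for which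
  almost everywhere convergent subsequences are available.\<close>

lemma L2_tendsto_sequence:
  fixes f :: "real ^ 'n \<Rightarrow> complex"
  assumes f: "f \<in> L2_space" and A: "A \<subseteq> L2_space"
    and approx: "\<And>e. e > 0 \<Longrightarrow> \<exists>g\<in>A. L2_dist g f < e"
  obtains s :: "nat \<Rightarrow> real ^ 'n \<Rightarrow> complex" where "range s \<subseteq> A" "L2_tendsto s f sequentially"
proof -
  have "\<forall>n. \<exists>g. g \<in> A \<and> L2_dist g f < 1 / real (Suc n)"
    using approx[of "1 / real (Suc _)"] by (simp add: Bex_def)
  from choice[OF this] obtain s where s: "\<And>n. s n \<in> A" "\<And>n. L2_dist (s n) f < 1 / real (Suc n)"
    by blast
  have "(\<lambda>n. L2_dist (s n) f) \<longlonglongrightarrow> 0"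
  proof (rule Lim_null_comparison)
    show "(\<lambda>n. 1 / real (Suc n)) \<longlonglongrightarrow> 0" using LIMSEQ_Suc[OF lim_const_over_n[of 1]] by simp
    show "\<forall>\<^sub>F n in sequentially. norm (L2_dist (s n) f) \<le> 1 / real (Suc n)"
      using s(2) by (intro always_eventually allI) (simp add: less_imp_le)
  qed
  with s(1) f A show ?thesis by (intro that[of s]) (auto simp: L2_tendsto_def)
qed

text \<open>The core of the Riesz-Fischer argument: the telescoping series converges absolutely
  almost everywhere, since the sum of the moduli of its terms is square integrable, and that sum
  also dominates the distance from every \<open>s n\<close> to the limit.\<close>

lemma L2_Cauchy_fast:
  fixes s :: "nat \<Rightarrow> real ^ 'n \<Rightarrow> complex"
  assumes s: "\<And>n. s n \<in> L2_space"
    and fast: "\<And>n. L2_dist (s (Suc n)) (s n) \<le> (1/2)^n"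
  shows "\<exists>f. L2_tendsto s f sequentially"
proof -
  have [measurable]: "s n \<in> borel_measurable lebesgue" for n using s by (rule L2_measurable)
  define d where "d n x = s (Suc n) x - s n x" for n x
  have dL2: "d n \<in> L2_space" for n unfolding d_def by (intro L2_diff s)
  define S where "S N x = (\<Sum>n<N. cmod (d n x))" for N x
  \<comment> \<open>The bound \<open>2 - 2*(1/2)^N\<close> is the partial sum of the geometric
    series; the real function \<open>S N\<close> is cast to the complex numbers to make
    \<open>L2_norm\<close> applicable.\<close>
  have SL2: "(\<lambda>x. complex_of_real (S N x)) \<in> L2_space \<and> L2_norm (\<lambda>x. complex_of_real (S N x)) \<le> 2 - 2*(1/2)^N" for N
  proof (induction N)
    case 0 then show ?case by (simp add: S_def L2_zero)
  next
    case (Suc N)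
    have m: "(\<lambda>x. complex_of_real (cmod (d N x))) \<in> borel_measurable lebesgue" unfolding d_def by measurable
    have n: "(\<lambda>x. complex_of_real (cmod (d N x))) \<in> L2_space"
      "L2_norm (\<lambda>x. complex_of_real (cmod (d N x))) \<le> (1/2)^N"
      using L2_mono[OF dL2[of N] m, where C=1] fast[of N] unfolding d_def by simp_all
    have "L2_norm (\<lambda>x. complex_of_real (S N x) + complex_of_real (cmod (d N x))) \<le> 2 - 2*(1/2)^N + (1/2)^N"
      using L2_norm_triangle[OF conjunct1[OF Suc] n(1)] Suc n(2) by linarith
    moreover have "(\<lambda>x. complex_of_real (S N x) + complex_of_real (cmod (d N x))) \<in> L2_space"
      by (rule L2_add) (use Suc n in auto)
    ultimately show ?case by (simp add: S_def)
  qed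
  have Sint: "(\<integral>\<^sup>+x. ennreal ((S N x)\<^sup>2) \<partial>lebesgue) \<le> 4" for N
  proof -
    have "(\<integral>\<^sup>+x. ennreal ((S N x)\<^sup>2) \<partial>lebesgue) = ennreal ((L2_norm (\<lambda>x. complex_of_real (S N x)))\<^sup>2)"
      using L2_norm_sq_ennreal[OF conjunct1[OF SL2[of N]]] by simp
    also have "\<dots> \<le> ennreal (2^2)"
    proof (rule ennreal_leI, rule power_mono)
      show "L2_norm (\<lambda>x. complex_of_real (S N x)) \<le> 2"
        using SL2[of N] zero_le_power[of "1/2::real" N] by linarith
    qed simp
    finally show ?thesis by simp
  qed
  have [measurable]: "S N \<in> borel_measurable lebesgue" for N unfolding S_def d_def by measurable
  have Smono: "S N x \<le> S (Suc N) x" for N x by (simp add: S_def)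
  have S0: "0 \<le> S N x" for N x by (simp add: S_def sum_nonneg)
  have inc: "incseq (\<lambda>N x. ennreal ((S N x)\<^sup>2))"
    by (intro incseq_SucI le_funI ennreal_leI power_mono Smono S0)
  have "(\<integral>\<^sup>+x. (SUP N. ennreal ((S N x)\<^sup>2)) \<partial>lebesgue) = (SUP N. \<integral>\<^sup>+x. ennreal ((S N x)\<^sup>2) \<partial>lebesgue)"
    by (rule nn_integral_monotone_convergence_SUP[OF inc]) measurable
  also have "\<dots> \<le> 4" by (rule SUP_least) (rule Sint)
  finally have tot: "(\<integral>\<^sup>+x. (SUP N. ennreal ((S N x)\<^sup>2)) \<partial>lebesgue) \<le> 4" .
  have lt: "(\<integral>\<^sup>+x. (SUP N. ennreal ((S N x)\<^sup>2)) \<partial>lebesgue) < \<infinity>"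
    by (rule le_less_trans[OF tot]) simp
  then have totfin: "(\<integral>\<^sup>+x. (SUP N. ennreal ((S N x)\<^sup>2)) \<partial>lebesgue) \<noteq> \<infinity>"
    by simp
  have "AE x in lebesgue. (SUP N. ennreal ((S N x)\<^sup>2)) \<noteq> \<infinity>"
    by (rule nn_integral_PInf_AE[OF _ totfin]) measurable
  then have summ: "AE x in lebesgue. summable (\<lambda>n. cmod (d n x)) \<and> ennreal ((suminf (\<lambda>n. cmod (d n x)))\<^sup>2) \<le> (SUP N. ennreal ((S N x)\<^sup>2))"
  proof eventually_elim
    case (elim x)
    then obtain B where B: "(SUP N. ennreal ((S N x)\<^sup>2)) = ennreal B" "0 \<le> B"
      by (cases "(SUP N. ennreal ((S N x)\<^sup>2))") auto
    have le: "S N x \<le> sqrt B" for N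
    proof -
      have "ennreal ((S N x)\<^sup>2) \<le> ennreal B" unfolding B(1)[symmetric] by (rule SUP_upper) simp
      then have "(S N x)\<^sup>2 \<le> B" using B(2) by (simp add: ennreal_le_iff)
      then show ?thesis by (rule real_le_rsqrt)
    qed
    have 1: "summable (\<lambda>n. cmod (d n x))"
      by (rule summableI_nonneg_bounded[where x="sqrt B"]) (use le in \<open>auto simp: S_def\<close>)
    have "suminf (\<lambda>n. cmod (d n x)) \<le> sqrt B"
      by (rule suminf_le_const[OF 1]) (use le in \<open>auto simp: S_def\<close>)
    then have "(suminf (\<lambda>n. cmod (d n x)))\<^sup>2 \<le> (sqrt B)\<^sup>2"
      by (rule power_mono) (simp add: suminf_nonneg[OF 1])
    with B 1 show ?case by (simp add: ennreal_le_iff)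
  qed
  define w where "w x = complex_of_real (suminf (\<lambda>n. cmod (d n x)))" for x
  have [measurable]: "d n \<in> borel_measurable lebesgue" for n unfolding d_def by measurable
  have wm: "w \<in> borel_measurable lebesgue" unfolding w_def by measurable
  have wL2: "w \<in> L2_space"
    unfolding L2_space_iff
  proof (intro conjI wm)
    have "(\<integral>\<^sup>+x. ennreal ((cmod (w x))\<^sup>2) \<partial>lebesgue) \<le> (\<integral>\<^sup>+x. (SUP N. ennreal ((S N x)\<^sup>2)) \<partial>lebesgue)"
      by (rule nn_integral_mono_AE) (use summ in \<open>auto simp: w_def\<close>)
    then show "(\<integral>\<^sup>+x. ennreal ((cmod (w x))\<^sup>2) \<partial>lebesgue) < \<infinity>"
      using lt by (rule le_less_trans)
  qed
  \<comment> \<open>The series may diverge on a null set, where \<open>suminf\<close> has an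
    unspecified value. Elsewhere \<open>s N - f\<close> is minus a tail of the series, hence at most
    \<open>w\<close> in modulus.\<close>
  define f where "f x = s 0 x + suminf (\<lambda>n. d n x)" for x
  have fm: "f \<in> borel_measurable lebesgue" unfolding f_def by measurable
  have tele: "s N x = s 0 x + (\<Sum>n<N. d n x)" for N x
    by (induction N) (auto simp: d_def)
  have ae: "AE x in lebesgue. (\<lambda>n. s n x - f x) \<longlonglongrightarrow> 0 \<and> (\<forall>n. cmod (s n x - f x) \<le> cmod (w x))"
    using summ
  proof eventually_elim
    case (elim x)
    then have sa: "summable (\<lambda>n. cmod (d n x))" by simp
    then have sd: "summable (\<lambda>n. d n x)" by (rule summable_norm_cancel)
    have e: "s N x - f x = - (suminf (\<lambda>n. d (n + N) x))" for N
      unfolding f_def using suminf_split_initial_segment[OF sd, of N] tele[of N x] by simp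
    have "cmod (s N x - f x) \<le> cmod (w x)" for N
    proof -
      have "cmod (s N x - f x) \<le> suminf (\<lambda>n. cmod (d (n + N) x))"
        unfolding e norm_minus_cancel by (rule summable_norm) (rule summable_ignore_initial_segment[OF sa])
      also have "\<dots> \<le> suminf (\<lambda>n. cmod (d n x))"
        using suminf_split_initial_segment[OF sa, of N] sum_nonneg[of "{..<N}" "\<lambda>n. cmod (d n x)"] by simp
      also have "\<dots> \<le> cmod (w x)" by (simp add: w_def)
      finally show ?thesis .
    qed
    moreover have "(\<lambda>n. s n x - f x) \<longlonglongrightarrow> 0"
    proof -
      have "(\<lambda>N. s 0 x + (\<Sum>n<N. d n x)) \<longlonglongrightarrow> f x"
        unfolding f_def by (intro tendsto_add tendsto_const summable_LIMSEQ sd)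
      then show ?thesis unfolding tele[symmetric] by (rule LIM_zero)
    qed
    ultimately show ?case by blast
  qed
  have dom: "(\<lambda>x. s n x - f x) \<in> L2_space" "(\<lambda>n. L2_dist (s n) f) \<longlonglongrightarrow> 0" for n
  proof -
    have m: "(\<lambda>x. s n x - f x) \<in> borel_measurable lebesgue" for n using fm by measurable
    have l: "AE x in lebesgue. (\<lambda>n. s n x - f x) \<longlonglongrightarrow> 0" 
      "AE x in lebesgue. cmod (s n x - f x) \<le> cmod (w x)" for n
      using ae by (eventually_elim, blast)+
    show "(\<lambda>x. s n x - f x) \<in> L2_space" "(\<lambda>n. L2_dist (s n) f) \<longlonglongrightarrow> 0"
      using L2_dominated[of "\<lambda>n x. s n x - f x", OF m wL2 l] by blast+
  qed
  have "f \<in> L2_space" using L2_diff[OF s[of 0] dom(1)[of 0]] by simp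
  with s dom(2) show ?thesis by (auto simp: L2_tendsto_def)
qed

lemma L2_complete:
  fixes s :: "nat \<Rightarrow> real ^ 'n \<Rightarrow> complex"
  assumes s: "\<And>n. s n \<in> L2_space"
    and cauchy: "\<And>e. e > 0 \<Longrightarrow> \<exists>N. \<forall>m\<ge>N. \<forall>n\<ge>N. L2_dist (s m) (s n) < e"
  shows "\<exists>f. L2_tendsto s f sequentially"
proof -
  have "\<exists>M. \<forall>n. \<forall>p\<ge>M n. \<forall>q\<ge>M n. L2_dist (s p) (s q) < (1/2)^n"
    by (intro choice allI cauchy) simp
  then obtain M where M: "\<And>n p q. p \<ge> M n \<Longrightarrow> q \<ge> M n \<Longrightarrow> L2_dist (s p) (s q) < (1/2)^n" by blast
  \<comment> \<open>Adding up the \<open>M i\<close> and adding \<open>n\<close> makes both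
    \<open>r n\<close> and \<open>r (Suc n)\<close> at least \<open>M n\<close>, and
    \<open>r n\<close> at least \<open>n\<close>, without a recursive choice of indices.\<close>
  define r where "r n = (\<Sum>i\<le>n. M i) + n" for n
  have "M n \<le> (\<Sum>i\<le>n. M i)" for n by (rule member_le_sum) auto
  then have rM: "r n \<ge> M n" "r (Suc n) \<ge> M n" "r n \<ge> n" for n
    unfolding r_def by (metis trans_le_add1, metis add_Suc_right le_SucI sum.atMost_Suc trans_le_add1, simp)
  have "\<exists>f. L2_tendsto (\<lambda>n. s (r n)) f sequentially"
    by (rule L2_Cauchy_fast[OF s less_imp_le[OF M[OF rM(2) rM(1)]]])
  then obtain f where f: "f \<in> L2_space" "(\<lambda>n. L2_dist (s (r n)) f) \<longlonglongrightarrow> 0"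
    by (auto simp: L2_tendsto_def)
  have "(\<lambda>n. L2_dist (s n) f) \<longlonglongrightarrow> 0"
  proof (rule LIMSEQ_I)
    fix e :: real assume "e > 0"
    then obtain N where N: "\<And>m n. m \<ge> N \<Longrightarrow> n \<ge> N \<Longrightarrow> L2_dist (s m) (s n) < e/2"
      using cauchy[of "e/2"] by auto
    obtain K where K: "\<And>n. n \<ge> K \<Longrightarrow> L2_dist (s (r n)) f < e/2"
      using LIMSEQ_D[OF f(2), of "e/2"] \<open>e > 0\<close> by auto
    have "L2_dist (s n) f < e" if n: "n \<ge> N" for n
    proof -
      have "L2_dist (s n) f \<le> L2_dist (s n) (s (r (max N K))) + L2_dist (s (r (max N K))) f"
        by (rule L2_norm_triangle3) (auto simp: s f)
      also have "\<dots> < e/2 + e/2"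
        by (intro add_strict_mono N K n) (use rM(3)[of "max N K"] in auto)
      finally show ?thesis by simp
    qed
    then show "\<exists>N. \<forall>n\<ge>N. norm (L2_dist (s n) f - 0) < e" by auto
  qed
  with f s show ?thesis by (auto simp: L2_tendsto_def)
qed

section \<open>Unordered sums with square summable coefficients\<close>

lemma ell2_has_sum:
  "c \<in> ell2 \<Longrightarrow> ((\<lambda>k. (cmod (c k))\<^sup>2) has_sum (ell2_norm c)\<^sup>2) UNIV"
  by (simp add: ell2_def ell2_norm_def infsum_nonneg)

text \<open>Norms and coefficient sums both converge along the net of finite subsets, so bounds
  valid for every finite subset survive in the limit.\<close>

lemma L2_has_sum_bounds:
  fixes u :: "'k \<Rightarrow> real ^ 'n \<Rightarrow> complex"
  assumes bd: "\<And>K. finite K \<Longrightarrow> A * (\<Sum>k\<in>K. (cmod (c k))\<^sup>2) \<le> (L2_norm (\<lambda>x. \<Sum>k\<in>K. c k * u k x))\<^sup>2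
       \<and> (L2_norm (\<lambda>x. \<Sum>k\<in>K. c k * u k x))\<^sup>2 \<le> B * (\<Sum>k\<in>K. (cmod (c k))\<^sup>2)"
    and c: "c \<in> ell2" and f: "L2_has_sum (\<lambda>k x. c k * u k x) f"
  shows "A * (ell2_norm c)\<^sup>2 \<le> (L2_norm f)\<^sup>2" "(L2_norm f)\<^sup>2 \<le> B * (ell2_norm c)\<^sup>2"
proof -
  have 1: "((\<lambda>K. (L2_norm (\<lambda>x. \<Sum>k\<in>K. c k * u k x))\<^sup>2) \<longlongrightarrow> (L2_norm f)\<^sup>2) (finite_subsets_at_top UNIV)"
    by (intro tendsto_power L2_tendsto_norm) (use f in \<open>simp add: L2_has_sum_def\<close>)
  have 2: "((\<lambda>K. \<Sum>k\<in>K. (cmod (c k))\<^sup>2) \<longlongrightarrow> (ell2_norm c)\<^sup>2) (finite_subsets_at_top UNIV)"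
    using ell2_has_sum[OF c] by (simp add: has_sum_def)
  show "A * (ell2_norm c)\<^sup>2 \<le> (L2_norm f)\<^sup>2"
    by (rule tendsto_le[OF _ 1 tendsto_mult_left[OF 2]])
       (auto intro!: eventually_finite_subsets_at_top_weakI simp: bd)
  show "(L2_norm f)\<^sup>2 \<le> B * (ell2_norm c)\<^sup>2"
    by (rule tendsto_le[OF _ tendsto_mult_left[OF 2] 1])
       (auto intro!: eventually_finite_subsets_at_top_weakI simp: bd)
qed

text \<open>The partial sums form a Cauchy net, but completeness is proved for sequences. A nested
  sequence of finite sets that captures the coefficient mass up to \<open>1 / (n + 1)\<close> gives
  a limit, and the whole net is compared with it.\<close>

lemma L2_has_sum_exists:
  fixes u :: "'k \<Rightarrow> real ^ 'n \<Rightarrow> complex"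
  assumes u: "\<And>k. u k \<in> L2_space" and B: "0 \<le> B"
    and bd: "\<And>K. finite K \<Longrightarrow> (L2_norm (\<lambda>x. \<Sum>k\<in>K. c k * u k x))\<^sup>2 \<le> B * (\<Sum>k\<in>K. (cmod (c k))\<^sup>2)"
    and c: "c \<in> ell2"
  shows "\<exists>f. L2_has_sum (\<lambda>k x. c k * u k x) f"
proof -
  define S where "S K = (\<lambda>x. \<Sum>k\<in>K. c k * u k x)" for K
  define q where "q k = (cmod (c k))\<^sup>2" for k
  have SL2: "S K \<in> L2_space" for K unfolding S_def by (intro L2_sum L2_scale u)
  have q0: "q k \<ge> 0" for k by (simp add: q_def)
  have qs: "(q has_sum (ell2_norm c)\<^sup>2) UNIV" using ell2_has_sum[OF c] by (simp add: q_def[abs_def])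
  have "\<exists>K. finite K \<and> (ell2_norm c)\<^sup>2 - 1 / (real n + 1) < sum q K" for n
  proof -
    have "\<forall>\<^sub>F K in finite_subsets_at_top UNIV. (ell2_norm c)\<^sup>2 - 1 / (real n + 1) < sum q K"
      using qs[unfolded has_sum_def] by (rule order_tendstoD(1)) simp
    then show ?thesis by (auto simp: eventually_finite_subsets_at_top)
  qed
  then obtain K0 where K0: "finite (K0 n)" "(ell2_norm c)\<^sup>2 - 1 / (real n + 1) < sum q (K0 n)" for n
    using choice[of "\<lambda>n K. finite K \<and> (ell2_norm c)\<^sup>2 - 1 / (real n + 1) < sum q K"] by blast
  \<comment> \<open>Unions make the sets nested, so that the difference of two partial sums is a
    partial sum over a set difference, to which \<open>bd\<close> applies.\<close>
  define K where "K n = (\<Union>i\<le>n. K0 i)" for n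
  have Kfin: "finite (K n)" for n unfolding K_def by (intro finite_UN_I finite_atMost K0(1))
  have Kmono: "K m \<subseteq> K n" if "m \<le> n" for m n unfolding K_def using that by (intro UN_mono) auto
  have KK: "(ell2_norm c)\<^sup>2 - 1 / (real n + 1) < sum q (K n)" for n
  proof -
    have "sum q (K0 n) \<le> sum q (K n)"
      by (rule sum_mono2[OF Kfin]) (auto simp: K_def q0)
    with K0(2)[of n] show ?thesis by linarith
  qed
  have close: "L2_dist (S L) (S (K n)) \<le> sqrt (B / (real n + 1))" if "finite L" "K n \<subseteq> L" for L n
  proof -
    have "S L x - S (K n) x = (\<Sum>k\<in>L - K n. c k * u k x)" for x
      unfolding S_def using sum.subset_diff[OF that(2,1), of "\<lambda>k. c k * u k x"] by simp
    then have "(L2_dist (S L) (S (K n)))\<^sup>2 \<le> B * sum q (L - K n)"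
      using bd[of "L - K n"] that by (simp add: q_def)
    also have "\<dots> \<le> B * (1 / (real n + 1))"
    proof (rule mult_left_mono[OF _ B])
      have "sum q L \<le> (ell2_norm c)\<^sup>2"
        using finite_sum_le_infsum[OF has_sum_imp_summable[OF qs] that(1)] infsumI[OF qs] q0 by simp
      then show "sum q (L - K n) \<le> 1 / (real n + 1)"
        using KK[of n] sum.subset_diff[OF that(2,1), of q] by linarith
    qed
    finally show ?thesis by (intro real_le_rsqrt) simp
  qed
  have small: "(\<lambda>n. sqrt (B / (real n + 1))) \<longlonglongrightarrow> 0"
  proof -
    have "(\<lambda>n. B / (real (Suc n))) \<longlonglongrightarrow> 0" using LIMSEQ_Suc[OF lim_const_over_n[of B]] by simp
    then have "(\<lambda>n. sqrt (B / (real (Suc n)))) \<longlonglongrightarrow> sqrt 0" by (rule tendsto_real_sqrt)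
    then show ?thesis by (simp add: add.commute)
  qed
  have "\<exists>f. L2_tendsto (\<lambda>n. S (K n)) f sequentially"
  proof (rule L2_complete[OF SL2])
    fix e :: real assume "e > 0"
    then have "\<forall>\<^sub>F n in sequentially. sqrt (B / (real n + 1)) < e/2"
      by (intro order_tendstoD(2)[OF small]) simp
    then obtain N where N: "sqrt (B / (real N + 1)) < e/2"
      using eventually_happens'[OF sequentially_bot] by blast
    have "L2_dist (S (K m)) (S (K n)) < e" if "m \<ge> N" "n \<ge> N" for m n
    proof -
      have "L2_dist (S (K m)) (S (K n)) \<le> L2_dist (S (K m)) (S (K N)) + L2_dist (S (K N)) (S (K n))"
        by (rule L2_norm_triangle3) (rule SL2)+
      moreover have "L2_dist (S (K m)) (S (K N)) < e/2" "L2_dist (S (K n)) (S (K N)) < e/2"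
        using close[OF Kfin Kmono[OF that(1)]] close[OF Kfin Kmono[OF that(2)]] N by linarith+
      ultimately show ?thesis using L2_norm_minus_commute[of "S (K N)" "S (K n)"] by linarith
    qed
    then show "\<exists>N. \<forall>m\<ge>N. \<forall>n\<ge>N. L2_dist (S (K m)) (S (K n)) < e" by (intro exI[of _ N] allI impI)
  qed
  then obtain f where f: "f \<in> L2_space" "(\<lambda>n. L2_dist (S (K n)) f) \<longlonglongrightarrow> 0"
    by (auto simp: L2_tendsto_def)
  have "((\<lambda>K. L2_dist (S K) f) \<longlongrightarrow> 0) (finite_subsets_at_top UNIV)"
  proof (rule tendstoI)
    fix e :: real assume e: "e > 0"
    have "(\<lambda>n. sqrt (B / (real n + 1)) + L2_dist (S (K n)) f) \<longlonglongrightarrow> 0"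
      using tendsto_add[OF small f(2)] by simp
    then have "\<forall>\<^sub>F n in sequentially. sqrt (B / (real n + 1)) + L2_dist (S (K n)) f < e"
      using e by (rule order_tendstoD(2))
    then obtain N where N: "sqrt (B / (real N + 1)) + L2_dist (S (K N)) f < e"
      using eventually_happens'[OF sequentially_bot] by blast
    have "L2_dist (S L) f < e" if "finite L" "K N \<subseteq> L" for L
      using L2_norm_triangle3[OF SL2 SL2 f(1), of L "K N"] close[OF that] N by linarith
    then show "\<forall>\<^sub>F L in finite_subsets_at_top UNIV. dist (L2_dist (S L) f) 0 < e"
      unfolding eventually_finite_subsets_at_top using Kfin by (intro exI[of _ "K N"]) auto
  qed
  then have "L2_has_sum (\<lambda>k x. c k * u k x) f"
    unfolding L2_has_sum_def L2_tendsto_def using SL2 f(1) by (simp add: S_def)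
  then show ?thesis by blast
qed

section \<open>Continuous and trigonometric approximation\<close>

lemma L2_indicator:
  assumes "S \<in> lmeasurable"
  shows "(\<lambda>x. complex_of_real (C * indicator S x)) \<in> L2_space"
proof -
  have "integrable lebesgue (\<lambda>x. C\<^sup>2 * indicator S x :: real)"
    using assms by (auto simp: fmeasurable_def)
  moreover have "(cmod (complex_of_real (C * indicator S x)))\<^sup>2 = C\<^sup>2 * indicator S x" for x
    by (simp add: indicator_def)
  moreover have "(\<lambda>x. complex_of_real (C * indicator S x)) \<in> borel_measurable lebesgue"
  proof -
    have [measurable]: "S \<in> sets lebesgue" using assms by (simp add: fmeasurable_def)
    show ?thesis by measurable
  qed
  ultimately show ?thesis by (simp add: L2_space_def)
qed

lemma L2_approx_bounded:
  fixes f :: "real ^ 'n \<Rightarrow> complex"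
  assumes f: "f \<in> L2_space" and e: "e > 0"
  obtains M where "M > 0" "(\<lambda>x. if cmod (f x) \<le> M then f x else 0) \<in> L2_space"
    "L2_norm (\<lambda>x. f x - (if cmod (f x) \<le> M then f x else 0)) < e"
proof -
  have [measurable]: "f \<in> borel_measurable lebesgue" using f by (rule L2_measurable)
  define s where "s n x = f x - (if cmod (f x) \<le> real (Suc n) then f x else 0)" for n x
  have m: "s n \<in> borel_measurable lebesgue" for n unfolding s_def by measurable
  have lim: "(\<lambda>n. s n x) \<longlonglongrightarrow> 0" for x
  proof (rule tendsto_eventually)
    obtain N where "cmod (f x) \<le> real N" using real_arch_simple by blast
    then have "s n x = 0" if "n \<ge> N" for n using that by (simp add: s_def)
    then show "\<forall>\<^sub>F n in sequentially. s n x = 0" by (auto simp: eventually_sequentially)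
  qed
  have bd: "cmod (s n x) \<le> cmod (f x)" for n x by (simp add: s_def)
  obtain n where n: "s n \<in> L2_space" "L2_norm (s n) < e"
    by (rule L2_dominated_small[OF m f AE_I2[OF lim] AE_I2[OF bd] e])
  have "(\<lambda>x. f x - s n x) \<in> L2_space" by (rule L2_diff[OF f n(1)])
  then have "(\<lambda>x. if cmod (f x) \<le> real (Suc n) then f x else 0) \<in> L2_space"
    by (simp add: s_def)
  with n show ?thesis by (intro that[of "real (Suc n)"]) (auto simp: s_def[abs_def])
qed

text \<open>Measurable functions are almost everywhere limits of continuous ones. Clipping the
  values with \<tau> and multiplying by the cutoffs \<open>ct n\<close> keeps continuity, bounds
  them by \<open>M\<close> and makes them vanish off the box, so dominated convergence
  applies.\<close>

lemma L2_approx_continuous: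
  fixes f :: "real ^ 'n \<Rightarrow> complex"
  assumes f: "f \<in> L2_space" and supp: "\<And>x. x \<notin> box a b \<Longrightarrow> f x = 0" and e: "e > 0"
  obtains g where "continuous_on UNIV g" "\<And>x. x \<notin> box a b \<Longrightarrow> g x = 0"
    "g \<in> L2_space" "L2_dist f g < e"
proof -
  obtain M where M: "M > 0" "(\<lambda>x. if cmod (f x) \<le> M then f x else 0) \<in> L2_space"
    "L2_norm (\<lambda>x. f x - (if cmod (f x) \<le> M then f x else 0)) < e/2"
    using L2_approx_bounded[OF f, of "e/2"] e by auto
  define f1 where "f1 x = (if cmod (f x) \<le> M then f x else 0)" for x
  have f1: "f1 \<in> L2_space" "L2_dist f f1 < e/2" using M by (simp_all add: f1_def[abs_def])
  have [measurable]: "f1 \<in> borel_measurable lebesgue" using f1(1) by (rule L2_measurable)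
  have f1M: "cmod (f1 x) \<le> M" for x using M by (simp add: f1_def)
  have f1s: "x \<notin> box a b \<Longrightarrow> f1 x = 0" for x using supp by (simp add: f1_def)
  have "f1 measurable_on UNIV" by (subst measurable_on_iff_borel_measurable) auto
  then obtain N g where Ng: "negligible N" "\<And>n. continuous_on UNIV (g n)"
      "\<And>x. x \<notin> N \<Longrightarrow> (\<lambda>n. g n x) \<longlonglongrightarrow> f1 x"
    unfolding measurable_on_def by auto
  \<comment> \<open>The radial retraction of the plane onto the disc of radius \<open>M\<close>:
    continuous, bounded by \<open>M\<close>, and the identity on the values of
    \<open>f1\<close>.\<close>
  define \<tau> where "\<tau> z = complex_of_real (M / max M (cmod z)) * z" for z
  have \<tau>c: "continuous_on UNIV \<tau>" unfolding \<tau>_def using M(1) by (intro continuous_intros) auto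
  have \<tau>b: "cmod (\<tau> z) \<le> M" for z
  proof -
    have "cmod (\<tau> z) = M / max M (cmod z) * cmod z" unfolding \<tau>_def norm_mult norm_of_real using M by simp
    also have "\<dots> \<le> M" using M by (simp add: divide_le_eq mult.commute)
    finally show ?thesis .
  qed
  have \<tau>i: "cmod z \<le> M \<Longrightarrow> \<tau> z = z" for z using M by (simp add: \<tau>_def max_def)
  define ct where "ct n x = min 1 (real n * infdist x (- box a b))" for n x
  have ctc: "continuous_on UNIV (ct n)" for n unfolding ct_def by (intro continuous_intros)
  have ctb: "0 \<le> ct n x" "ct n x \<le> 1" for n x by (auto simp: ct_def infdist_nonneg)
  have ct0: "x \<notin> box a b \<Longrightarrow> ct n x = 0" for n x by (simp add: ct_def)
  have ctlim: "(\<lambda>n. ct n x) \<longlonglongrightarrow> 1" if x: "x \<in> box a b" for x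
  proof (rule tendsto_eventually)
    \<comment> \<open>\<open>infdist\<close> to the empty set is 0, so the complement of the box
      must be shown to be nonempty before a positive distance can be concluded.\<close>
    have ne: "- box a b \<noteq> {}"
    proof
      assume "- box a b = {}"
      then have "box a b = UNIV" by blast
      then show False using bounded_box[of a b] not_bounded_UNIV[where ?'a="real^'n"] by simp
    qed
    have "infdist x (- box a b) > 0"
      using infdist_pos_not_in_closed[OF _ ne, of x] x by (simp add: closed_Compl open_box)
    then obtain N where N: "1 < real N * infdist x (- box a b)" using reals_Archimedean3 by blast
    have "ct n x = 1" if "n \<ge> N" for n
    proof -
      have "real N * infdist x (- box a b) \<le> real n * infdist x (- box a b)"
        using that by (intro mult_right_mono) (auto simp: infdist_nonneg)
      then show ?thesis using N by (simp add: ct_def)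
    qed
    then show "\<forall>\<^sub>F n in sequentially. ct n x = 1" by (auto simp: eventually_sequentially)
  qed
  define h where "h n x = complex_of_real (ct n x) * \<tau> (g n x)" for n x
  have hc: "continuous_on UNIV (h n)" for n
    unfolding h_def by (intro continuous_intros ctc continuous_on_compose2[OF \<tau>c] Ng(2)) auto
  have h0: "x \<notin> box a b \<Longrightarrow> h n x = 0" for n x by (simp add: h_def ct0)
  have hb: "cmod (h n x) \<le> M" for n x
  proof -
    have "cmod (h n x) = ct n x * cmod (\<tau> (g n x))" using ctb by (simp add: h_def norm_mult)
    also have "\<dots> \<le> 1 * M" by (intro mult_mono ctb \<tau>b) auto
    finally show ?thesis by simp
  qed
  have [measurable]: "h n \<in> borel_measurable lebesgue" for n
    using borel_measurable_continuous_onI[OF hc] by (simp add: measurable_completion)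
  have hlim: "(\<lambda>n. f1 x - h n x) \<longlonglongrightarrow> 0" if x: "x \<notin> N" for x
  proof (cases "x \<in> box a b")
    case True
    have "isCont \<tau> (f1 x)" using \<tau>c by (simp add: continuous_on_eq_continuous_at)
    then have "(\<lambda>n. \<tau> (g n x)) \<longlonglongrightarrow> \<tau> (f1 x)" using Ng(3)[OF x] by (rule isCont_tendsto_compose)
    then have "(\<lambda>n. f1 x - complex_of_real (ct n x) * \<tau> (g n x)) \<longlonglongrightarrow> f1 x - complex_of_real 1 * \<tau> (f1 x)"
      by (intro tendsto_intros ctlim True)
    then show ?thesis using \<tau>i[OF f1M] by (simp add: h_def)
  qed (simp add: h0 f1s)
  have ae: "AE x in lebesgue. (\<lambda>n. f1 x - h n x) \<longlonglongrightarrow> 0"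
    using Ng(1) hlim by (intro AE_I'[of N]) (auto simp: negligible_iff_null_sets)
  define w where "w x = complex_of_real (2 * M * indicator (box a b) x)" for x
  have w: "w \<in> L2_space" unfolding w_def by (rule L2_indicator) simp
  have bd: "cmod (f1 x - h n x) \<le> cmod (w x)" for n x
  proof (cases "x \<in> box a b")
    case True
    have "cmod (f1 x - h n x) \<le> M + M" using norm_triangle_ineq4[of "f1 x" "h n x"] f1M[of x] hb[of n x] by linarith
    then show ?thesis using True M(1) by (simp add: w_def)
  qed (simp add: h0 f1s w_def)
  have m: "(\<lambda>x. f1 x - h n x) \<in> borel_measurable lebesgue" for n by measurable
  have "e/2 > 0" using e by simp
  then obtain n where n: "(\<lambda>x. f1 x - h n x) \<in> L2_space" "L2_dist f1 (h n) < e/2"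
    by (rule L2_dominated_small[OF m w ae AE_I2[OF bd]])
  have hL2: "h n \<in> L2_space" using L2_diff[OF f1(1) n(1)] by simp
  have "L2_dist f (h n) < e"
    using L2_norm_triangle3[OF f f1(1) hL2] n(2) f1(2) by linarith
  then show ?thesis using that[OF hc h0 hL2] by blast
qed

section \<open>Characters of the torus and trigonometric polynomials\<close>

lemma real_vec_simps [simp]:
  "real_vec 0 = 0" "real_vec (k + l) = real_vec k + real_vec l" "real_vec (- k) = - real_vec k"
  "real_vec (k - l) = real_vec k - real_vec l"
  by (simp_all add: real_vec_def vec_eq_iff)

lemma real_vec_inject [simp]: "real_vec k = real_vec l \<longleftrightarrow> k = l"
  by (simp add: real_vec_def vec_eq_iff)

lemma real_vec_axis: "real_vec (axis i c) = axis i (real_of_int c)"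
  by (simp add: real_vec_def vec_eq_iff axis_def)

lemma real_vec_inner_Ints: "real_vec k \<bullet> real_vec l \<in> \<int>"
  by (auto simp: real_vec_def inner_vec_def intro!: Ints_sum)

definition trig_char :: "int ^ 'n \<Rightarrow> real ^ 'n \<Rightarrow> complex" where
  "trig_char k x = cis (2 * pi * (real_vec k \<bullet> x))"

lemma norm_trig_char [simp]: "cmod (trig_char k x) = 1"
  by (simp add: trig_char_def)

lemma trig_char_0 [simp]: "trig_char 0 x = 1"
  by (simp add: trig_char_def)

lemma trig_char_add: "trig_char (k + l) x = trig_char k x * trig_char l x"
  by (simp add: trig_char_def cis_mult inner_add_left distrib_left)

lemma trig_char_shift: "trig_char k (x + y) = trig_char k x * trig_char k y"
  by (simp add: trig_char_def cis_mult inner_add_right distrib_left)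

lemma cnj_trig_char: "cnj (trig_char k x) = trig_char (- k) x"
  by (simp add: trig_char_def cis_cnj)

lemma trig_char_real_vec [simp]: "trig_char k (real_vec m) = 1"
  using real_vec_inner_Ints[of k m] by (auto simp: trig_char_def elim!: Ints_cases)

lemma trig_char_periodic: "trig_char k (x + real_vec m) = trig_char k x"
  by (simp add: trig_char_shift)

lemma continuous_on_trig_char [continuous_intros]: "continuous_on S (trig_char k)"
proof -
  have "trig_char k = (\<lambda>x. cis (2 * pi * (real_vec k \<bullet> x)))" by (rule ext) (rule trig_char_def)
  then show ?thesis by (auto intro!: continuous_intros)
qed

lemma trig_char_measurable [measurable]: "trig_char k \<in> borel_measurable borel"
  by (rule borel_measurable_continuous_onI) (rule continuous_on_trig_char)

text \<open>A closure under addition, rather than finite sums with coefficient families: products,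
  continuity and periodicity then follow by rule induction. \<open>trig_poly_finite_sum\<close>
  recovers the coefficients.\<close>

inductive_set trig_poly :: "(real ^ 'n \<Rightarrow> complex) set" where
  char: "(\<lambda>x. c * trig_char k x) \<in> trig_poly"
| add: "p \<in> trig_poly \<Longrightarrow> q \<in> trig_poly \<Longrightarrow> (\<lambda>x. p x + q x) \<in> trig_poly"

lemma trig_poly_const: "(\<lambda>x. c) \<in> trig_poly"
  using trig_poly.char[of c 0] by simp

lemma trig_poly_char_mult: "p \<in> trig_poly \<Longrightarrow> (\<lambda>x. c * trig_char k x * p x) \<in> trig_poly"
proof (induction rule: trig_poly.induct)
  case (char d l)
  have "(\<lambda>x. c * trig_char k x * (d * trig_char l x)) = (\<lambda>x. (c * d) * trig_char (k + l) x)"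
    by (simp add: trig_char_add mult_ac)
  then show ?case by (simp add: trig_poly.char)
qed (simp add: distrib_left trig_poly.add)

lemma trig_poly_mult: "p \<in> trig_poly \<Longrightarrow> q \<in> trig_poly \<Longrightarrow> (\<lambda>x. p x * q x) \<in> trig_poly"
  by (induction rule: trig_poly.induct) (simp_all add: trig_poly_char_mult distrib_right trig_poly.add)

lemma trig_poly_sum: "(\<And>i. i \<in> I \<Longrightarrow> p i \<in> trig_poly) \<Longrightarrow> (\<lambda>x. \<Sum>i\<in>I. p i x) \<in> trig_poly"
  by (induction I rule: infinite_finite_induct) (simp_all add: trig_poly_const trig_poly.add)

lemma trig_poly_finite_sum:
  "p \<in> trig_poly \<Longrightarrow> \<exists>K c. finite K \<and> p = (\<lambda>x. \<Sum>k\<in>K. c k * trig_char k x)"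
proof (induction rule: trig_poly.induct)
  case (char c k)
  show ?case by (rule exI[of _ "{k}"], rule exI[of _ "\<lambda>_. c"]) simp
next
  case (add p q)
  then obtain K c L d where K: "finite K" "p = (\<lambda>x. \<Sum>k\<in>K. c k * trig_char k x)"
    and L: "finite L" "q = (\<lambda>x. \<Sum>k\<in>L. d k * trig_char k x)" by blast
  have 1: "(\<Sum>k\<in>K. c k * trig_char k x) = (\<Sum>k\<in>K\<union>L. (if k \<in> K then c k else 0) * trig_char k x)" for x
    using K(1) L(1) by (intro sum.mono_neutral_cong_left) auto
  have 2: "(\<Sum>k\<in>L. d k * trig_char k x) = (\<Sum>k\<in>K\<union>L. (if k \<in> L then d k else 0) * trig_char k x)" for x
    using K(1) L(1) by (intro sum.mono_neutral_cong_left) auto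
  have "(\<lambda>x. p x + q x) = (\<lambda>x. \<Sum>k\<in>K\<union>L. ((if k \<in> K then c k else 0) + (if k \<in> L then d k else 0)) * trig_char k x)"
    unfolding K(2) L(2) 1 2 by (simp only: sum.distrib[symmetric] distrib_right)
  moreover have "finite (K \<union> L)" using K L by simp
  ultimately show ?case
    by (intro exI[of _ "K \<union> L"] exI[of _ "\<lambda>k. (if k \<in> K then c k else 0) + (if k \<in> L then d k else 0)"] conjI)
qed

lemma continuous_on_trig_poly: "p \<in> trig_poly \<Longrightarrow> continuous_on S p"
  by (induction rule: trig_poly.induct) (auto intro!: continuous_intros)

lemma trig_poly_periodic: "p \<in> trig_poly \<Longrightarrow> p (x + real_vec m) = p x"
  by (induction rule: trig_poly.induct) (auto simp: trig_char_periodic)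

lemma trig_poly_cos_sin:
  fixes i :: "'n::finite"
  shows "(\<lambda>x. complex_of_real (cos (2 * pi * x $ i))) \<in> trig_poly"
  "(\<lambda>x. complex_of_real (sin (2 * pi * x $ i))) \<in> trig_poly"
proof -
  have ch: "trig_char (axis i 1) x = cis (2 * pi * x $ i)" "trig_char (- axis i 1) x = cis (- (2 * pi * x $ i))" for x :: "real ^ 'n"
    by (simp_all add: trig_char_def real_vec_axis inner_axis')
  have "(\<lambda>x. complex_of_real (cos (2 * pi * x $ i)))
      = (\<lambda>x. (1/2) * trig_char (axis i 1) x + (1/2) * trig_char (- axis i 1) x)"
    by (rule ext) (simp add: ch complex_eq_iff)
  then show "(\<lambda>x. complex_of_real (cos (2 * pi * x $ i))) \<in> trig_poly"
    by (simp only: trig_poly.intros)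
  have "(\<lambda>x. complex_of_real (sin (2 * pi * x $ i)))
      = (\<lambda>x. (- \<i>/2) * trig_char (axis i 1) x + (\<i>/2) * trig_char (- axis i 1) x)"
    by (rule ext) (simp add: ch complex_eq_iff)
  then show "(\<lambda>x. complex_of_real (sin (2 * pi * x $ i))) \<in> trig_poly"
    by (simp only: trig_poly.intros)
qed

text \<open>The bridge from polynomial approximation on a compact set in C^n to trigonometric
  approximation: a real linear functional of the vector of \<open>cis\<close> values is a real
  combination of cosines and sines of the coordinates, and polynomials arise from such functionals
  and constants by sums and products.\<close>

lemma trig_poly_polynomial:
  fixes P :: "complex ^ 'n \<Rightarrow> real"
  assumes "real_polynomial_function P"
  shows "(\<lambda>x. complex_of_real (P (\<chi> i. cis (2 * pi * x $ i)))) \<in> trig_poly"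
  using assms
proof (induction rule: real_polynomial_function.induct)
  case (linear f)
  then interpret f: bounded_linear f .
  have dec: "z = (\<Sum>i\<in>UNIV. Re (z $ i) *\<^sub>R axis i 1 + Im (z $ i) *\<^sub>R axis i \<i>)" for z :: "complex ^ 'n"
  proof (subst vec_eq_iff, rule allI)
    fix j
    have "(Re (z $ i) *\<^sub>R axis i 1 + Im (z $ i) *\<^sub>R axis i \<i>) $ j = (if i = j then z $ j else 0)" for i
      by (simp add: axis_def complex_eq_iff)
    then show "z $ j = (\<Sum>i\<in>UNIV. Re (z $ i) *\<^sub>R axis i 1 + Im (z $ i) *\<^sub>R axis i \<i>) $ j"
      by (simp only: sum_component) simp
  qed
  have fz: "f z = (\<Sum>i\<in>UNIV. Re (z $ i) * f (axis i 1) + Im (z $ i) * f (axis i \<i>))" for z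
    using arg_cong[OF dec[of z], of f] by (simp only: f.sum f.add f.scaleR real_scaleR_def)
  have eq: "(\<lambda>x. complex_of_real (f (\<chi> i. cis (2 * pi * x $ i)))) = (\<lambda>x. \<Sum>i\<in>UNIV.
      complex_of_real (cos (2 * pi * x $ i)) * complex_of_real (f (axis i 1))
     + complex_of_real (sin (2 * pi * x $ i)) * complex_of_real (f (axis i \<i>)))"
    by (rule ext, subst fz) simp
  show ?case unfolding eq
    by (intro trig_poly_sum trig_poly.add trig_poly_mult trig_poly_cos_sin trig_poly_const)
qed (simp_all add: trig_poly_const trig_poly.add trig_poly_mult)

text \<open>A function vanishing off the open cube descends to the torus, realized as the image of
  the closed cube under \<open>q\<close> in C^n. The Stone-Weierstrass theorem is applied to the
  descended function and pulled back along \<open>q\<close>.\<close>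

lemma trig_poly_dense_continuous:
  fixes h :: "real ^ 'n \<Rightarrow> complex"
  assumes h: "continuous_on UNIV h" and h0: "\<And>x. x \<notin> box 0 1 \<Longrightarrow> h x = 0" and e: "e > 0"
  shows "\<exists>p\<in>trig_poly. \<forall>x\<in>cbox 0 1. cmod (h x - p x) < e"
proof -
  define q :: "real ^ 'n \<Rightarrow> complex ^ 'n" where "q x = (\<chi> i. cis (2 * pi * x $ i))" for x
  have qc: "continuous_on UNIV q" unfolding q_def by (intro continuous_intros)
  \<comment> \<open>Two distinct points of the closed cube with the same image differ in some
    coordinate by a nonzero integer, so that coordinate is 0 in one point and 1 in the other; both
    lie outside the open cube, where \<open>h\<close> vanishes.\<close>
  have wd: "h x = h y" if x: "x \<in> cbox 0 1" and y: "y \<in> cbox 0 1" and q: "q x = q y" for x y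
  proof (cases "x = y")
    case False
    then obtain i where i: "x $ i \<noteq> y $ i" by (auto simp: vec_eq_iff)
    have "cis (2 * pi * x $ i) = cis (2 * pi * y $ i)" using q by (simp add: q_def vec_eq_iff)
    then have "cos (2 * pi * x $ i) = cos (2 * pi * y $ i) \<and> sin (2 * pi * x $ i) = sin (2 * pi * y $ i)"
      by (simp add: complex_eq_iff)
    then obtain n :: int where "2 * pi * x $ i = 2 * pi * y $ i + 2 * pi * n"
      using sin_cos_eq_iff[of "2 * pi * x $ i" "2 * pi * y $ i"] by auto
    then have "2 * pi * (x $ i) = 2 * pi * (y $ i + n)" by (simp add: algebra_simps)
    then have n: "x $ i = y $ i + real_of_int n" by simp
    have b: "0 \<le> x $ i" "x $ i \<le> 1" "0 \<le> y $ i" "y $ i \<le> 1" using x y by (auto simp: mem_box_cart)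
    have "n \<noteq> 0" using n i by auto
    then have "n \<ge> 1 \<or> n \<le> -1" by linarith
    then have "(x $ i = 1 \<and> y $ i = 0) \<or> (x $ i = 0 \<and> y $ i = 1)"
    proof
      assume "n \<ge> 1" then have "real_of_int n \<ge> 1" by simp
      with n b show ?thesis by linarith
    next
      assume "n \<le> -1" then have "real_of_int n \<le> -1" by linarith
      with n b show ?thesis by linarith
    qed
    then have "x \<notin> box 0 1" "y \<notin> box 0 1" by (auto simp: mem_box_cart intro!: exI[of _ i])
    then show ?thesis by (simp add: h0)
  qed simp
  define F where "F z = h (SOME x. x \<in> cbox 0 1 \<and> q x = z)" for z
  have F: "F (q x) = h x" if "x \<in> cbox 0 1" for x
  proof -
    have "(SOME y. y \<in> cbox 0 1 \<and> q y = q x) \<in> cbox 0 1 \<and> q (SOME y. y \<in> cbox 0 1 \<and> q y = q x) = q x"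
      by (rule someI[of _ x]) (use that in simp)
    then show ?thesis unfolding F_def by (intro wd) (use that in auto)
  qed
  define S where "S = q ` cbox 0 1"
  have S: "compact S" unfolding S_def
    by (intro compact_continuous_image compact_cbox continuous_on_subset[OF qc]) auto
  \<comment> \<open>\<open>F\<close> is defined by choosing preimages, so its continuity is read off
    its graph, the continuous image of the compact cube under the pair of \<open>q\<close> and
    \<open>h\<close>.\<close>
  have "continuous_on S F"
  proof (rule continuous_from_closed_graph)
    show "compact (h ` cbox 0 1)"
      by (intro compact_continuous_image compact_cbox continuous_on_subset[OF h]) auto
    show "F \<in> S \<rightarrow> h ` cbox 0 1" by (auto simp: S_def F)
    have "(\<lambda>x. (x, F x)) ` S = (\<lambda>x. (q x, h x)) ` cbox 0 1"
      unfolding S_def image_image by (rule image_cong) (simp_all add: F)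
    moreover have "compact ((\<lambda>x. (q x, h x)) ` cbox 0 1)"
      by (rule compact_continuous_image[OF _ compact_cbox])
         (intro continuous_on_Pair continuous_on_subset[OF qc] continuous_on_subset[OF h] subset_UNIV)
    ultimately show "closed ((\<lambda>x. (x, F x)) ` S)" by (simp add: compact_imp_closed)
  qed
  from Stone_Weierstrass_polynomial_function[OF S this e]
  obtain g where g: "polynomial_function g" "\<And>z. z \<in> S \<Longrightarrow> norm (F z - g z) < e" by auto
  have "real_polynomial_function (\<lambda>z. Re (g z))" "real_polynomial_function (\<lambda>z. Im (g z))"
    using g(1) bounded_linear_Re bounded_linear_Im unfolding polynomial_function_def by (auto simp: o_def)
  then have "(\<lambda>x. complex_of_real (Re (g (q x))) + \<i> * complex_of_real (Im (g (q x)))) \<in> trig_poly"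
    unfolding q_def by (intro trig_poly.add trig_poly_mult trig_poly_const trig_poly_polynomial)
  then have 1: "(\<lambda>x. g (q x)) \<in> trig_poly" by (simp flip: complex_eq)
  have "cmod (h x - g (q x)) < e" if "x \<in> cbox 0 1" for x
    using g(2)[of "q x"] F[OF that] that by (simp add: S_def)
  then show ?thesis by (intro bexI[OF _ 1] ballI)
qed

section \<open>Gaussians and Plancherel's theorem\<close>

text \<open>Fubini's theorem and compositions with Borel maps are applied to Borel functions,
  whereas the definitions speak of \<open>lebesgue\<close>; this passes from one to the
  other.\<close>

lemma lebesgue_borel_representative:
  fixes f :: "'a::euclidean_space \<Rightarrow> complex"
  assumes "f \<in> borel_measurable lebesgue"
  obtains g where "g \<in> borel_measurable borel" "AE x in lebesgue. f x = g x"
proof -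
  have [measurable]: "f \<in> borel_measurable lebesgue" by fact
  have "(\<lambda>x. Re (f x)) \<in> borel_measurable (completion lborel)" by measurable
  from completion_ex_borel_measurable_real[OF this] obtain u where
    u: "u \<in> borel_measurable lborel" "AE x in lborel. Re (f x) = u x" by blast
  have "(\<lambda>x. Im (f x)) \<in> borel_measurable (completion lborel)" by measurable
  from completion_ex_borel_measurable_real[OF this] obtain v where
    v: "v \<in> borel_measurable lborel" "AE x in lborel. Im (f x) = v x" by blast
  have [measurable]: "u \<in> borel_measurable borel" "v \<in> borel_measurable borel"
    using u(1) v(1) by simp_all
  show ?thesis
  proof (rule that[of "\<lambda>x. Complex (u x) (v x)"])
    have "(\<lambda>x. complex_of_real (u x) + \<i> * complex_of_real (v x)) \<in> borel_measurable borel" by measurable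
    then show "(\<lambda>x. Complex (u x) (v x)) \<in> borel_measurable borel" by (simp add: Complex_eq)
    have "AE x in lborel. f x = Complex (u x) (v x)"
      using u(2) v(2) by eventually_elim (simp add: complex_eq_iff)
    then show "AE x in lebesgue. f x = Complex (u x) (v x)" by (rule AE_completion)
  qed
qed

text \<open>\<open>lborel\<close> is the image of the product measure indexed by
  \<open>Basis\<close>. The basis vectors are renamed as coordinate indices, after which the product
  formulas for integrals apply.\<close>

lemma integral_prod_vec:
  fixes f :: "'n::finite \<Rightarrow> real \<Rightarrow> complex"
  assumes f: "\<And>i. integrable lborel (f i)"
  shows "integrable lebesgue (\<lambda>x. \<Prod>i\<in>UNIV. f i (x $ i))"
    "integral\<^sup>L lebesgue (\<lambda>x. \<Prod>i\<in>UNIV. f i (x $ i)) = (\<Prod>i\<in>UNIV. integral\<^sup>L lborel (f i))"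
proof -
  interpret product_sigma_finite "\<lambda>_::real^'n. lborel :: real measure" ..
  define ix where "ix b = (THE i. b = axis i (1::real))" for b :: "real^'n"
  have ix: "ix (axis i 1) = i" for i unfolding ix_def by (rule the_equality) (auto simp: axis_eq_axis)
  have B: "(Basis :: (real^'n) set) = range (\<lambda>i. axis i 1)" by (auto simp: Basis_vec_def)
  have inj: "inj (\<lambda>i::'n. axis i (1::real))" by (auto simp: inj_def axis_eq_axis)
  have reB: "prod h (Basis :: (real^'n) set) = (\<Prod>i\<in>UNIV. h (axis i 1))" for h :: "real^'n \<Rightarrow> complex"
    unfolding B by (subst prod.reindex[OF inj]) (simp add: o_def)
  have comp: "(\<Sum>b\<in>Basis. y b *\<^sub>R b) $ i = y (axis i 1)" for y :: "real^'n \<Rightarrow> real" and i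
    unfolding cart_eq_inner_axis by (rule inner_sum_left_Basis) (auto simp: B)
  have eq: "(\<Prod>i\<in>UNIV. f i ((\<Sum>b\<in>Basis. y b *\<^sub>R b) $ i)) = (\<Prod>b\<in>(Basis :: (real^'n) set). f (ix b) (y b))" for y
    unfolding comp reB ix ..
  have fm[measurable]: "f i \<in> borel_measurable borel" for i using f[of i] by auto
  have P[measurable]: "(\<lambda>x::real^'n. \<Prod>i\<in>UNIV. f i (x $ i)) \<in> borel_measurable borel" by measurable
  have T[measurable]: "(\<lambda>y. \<Sum>b\<in>(Basis :: (real^'n) set). y b *\<^sub>R b) \<in> Pi\<^sub>M Basis (\<lambda>_. lborel) \<rightarrow>\<^sub>M borel" by measurable
  have i1: "integrable (Pi\<^sub>M (Basis :: (real^'n) set) (\<lambda>_. lborel)) (\<lambda>y. \<Prod>b\<in>Basis. f (ix b) (y b))"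
    by (rule product_integrable_prod) (auto simp: f)
  have i2: "integral\<^sup>L (Pi\<^sub>M (Basis :: (real^'n) set) (\<lambda>_. lborel)) (\<lambda>y. \<Prod>b\<in>Basis. f (ix b) (y b))
     = (\<Prod>b\<in>(Basis :: (real^'n) set). integral\<^sup>L lborel (f (ix b)))"
    by (rule product_integral_prod) (auto simp: f)
  have "integrable lborel (\<lambda>x::real^'n. \<Prod>i\<in>UNIV. f i (x $ i))"
    unfolding lborel_eq[where 'a="real^'n"] integrable_distr_eq[OF T P] eq by (rule i1)
  then show "integrable lebesgue (\<lambda>x::real^'n. \<Prod>i\<in>UNIV. f i (x $ i))"
    by (simp add: integrable_completion)
  have "integral\<^sup>L lborel (\<lambda>x::real^'n. \<Prod>i\<in>UNIV. f i (x $ i)) = (\<Prod>i\<in>UNIV. integral\<^sup>L lborel (f i))"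
    unfolding lborel_eq[where 'a="real^'n"] integral_distr[OF T P] eq
    by (subst i2) (simp only: reB ix)
  then show "integral\<^sup>L lebesgue (\<lambda>x::real^'n. \<Prod>i\<in>UNIV. f i (x $ i)) = (\<Prod>i\<in>UNIV. integral\<^sup>L lborel (f i))"
    by (simp add: integral_completion)
qed

text \<open>The characteristic function of the standard normal distribution is
  \<open>exp (- s^2 / 2)\<close>; removing the normalization \<open>1 / sqrt (2 * pi)\<close> and
  translating by \<open>a\<close> gives the formula.\<close>

lemma gaussian_fourier_real:
  "has_bochner_integral lborel (\<lambda>x. complex_of_real (exp (- (x - a)\<^sup>2 / 2)) * cis (s * x))
     (complex_of_real (sqrt (2 * pi) * exp (- s\<^sup>2 / 2)) * cis (s * a))"
proof -
  define G where "G x = complex_of_real (exp (- x\<^sup>2 / 2)) * cis (s * x)" for x :: real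
  have n: "complex_of_real (std_normal_density x) * cis (s * x) = complex_of_real (1 / sqrt (2 * pi)) * G x" for x
    by (simp add: G_def std_normal_density_def)
  have int: "integrable lborel (\<lambda>x. complex_of_real (std_normal_density x) * cis (s * x))"
  proof (rule Bochner_Integration.integrable_bound)
    show "integrable lborel std_normal_density" by (rule integrable_normal_density) simp
    show "(\<lambda>x. complex_of_real (std_normal_density x) * cis (s * x)) \<in> borel_measurable lborel"
      by (intro measurable) (auto intro!: borel_measurable_continuous_onI continuous_intros)
    show "AE x in lborel. norm (complex_of_real (std_normal_density x) * cis (s * x)) \<le> norm (std_normal_density x)"
      by (simp add: norm_mult)
  qed
  have "integral\<^sup>L lborel (\<lambda>x. complex_of_real (std_normal_density x) * cis (s * x)) = char std_normal_distribution s"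
    unfolding char_def
    by (subst integral_density)
       (auto simp: cis_conv_exp scaleR_conv_of_real intro!: borel_measurable_continuous_onI continuous_intros)
  also have "\<dots> = complex_of_real (exp (- (s^2) / 2))" by (simp only: char_std_normal_distribution)
  finally have "has_bochner_integral lborel (\<lambda>x. complex_of_real (1 / sqrt (2 * pi)) * G x) (complex_of_real (exp (- (s^2) / 2)))"
    using int by (simp only: n has_bochner_integral_iff)
  then have "has_bochner_integral lborel (\<lambda>x. complex_of_real (sqrt (2 * pi)) * (complex_of_real (1 / sqrt (2 * pi)) * G x))
      (complex_of_real (sqrt (2 * pi)) * complex_of_real (exp (- (s^2) / 2)))"
    by (rule has_bochner_integral_mult_right) 
  then have "has_bochner_integral lborel G (complex_of_real (sqrt (2 * pi) * exp (- (s^2) / 2)))"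
    by (simp add: mult.assoc[symmetric] of_real_mult[symmetric] del: of_real_mult)
  then have "has_bochner_integral lborel (\<lambda>x. G (- a + 1 * x)) (complex_of_real (sqrt (2 * pi) * exp (- (s^2) / 2)))"
    using lborel_has_bochner_integral_real_affine_iff[of 1 G _ "- a"] by simp
  then have "has_bochner_integral lborel (\<lambda>x. G (- a + 1 * x) * cis (s * a)) (complex_of_real (sqrt (2 * pi) * exp (- (s^2) / 2)) * cis (s * a))"
    by (rule has_bochner_integral_mult_left) 
  moreover have "G (- a + 1 * x) * cis (s * a) = complex_of_real (exp (- (x - a)\<^sup>2 / 2)) * cis (s * x)" for x
    by (simp add: G_def cis_mult mult.assoc algebra_simps)
  ultimately show ?thesis by simp
qed

text \<open>Centre \<open>a\<close> and frequency \<open>b\<close> are both kept as parameters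
  because the Fourier transform exchanges them, up to a sign and a constant factor; this makes the
  span invariant.\<close>

definition gauss :: "real ^ 'n \<Rightarrow> real ^ 'n \<Rightarrow> real ^ 'n \<Rightarrow> complex" where
  "gauss a b x = complex_of_real (exp (- (norm (x - a))\<^sup>2 / 2)) * cis (b \<bullet> x)"

lemma cis_sum: "finite I \<Longrightarrow> cis (sum f I) = (\<Prod>i\<in>I. cis (f i))"
  by (induction I rule: finite_induct) (auto simp: cis_mult[symmetric])

lemma gauss_prod:
  "gauss a b x = (\<Prod>i\<in>UNIV. complex_of_real (exp (- (x $ i - a $ i)\<^sup>2 / 2)) * cis (b $ i * x $ i))"
proof -
  have N: "(norm (x - a))\<^sup>2 = (\<Sum>i\<in>UNIV. (x $ i - a $ i)\<^sup>2)"
    unfolding power2_norm_eq_inner inner_vec_def by (simp add: power2_eq_square)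
  have "- (norm (x - a))\<^sup>2 / 2 = (\<Sum>i\<in>UNIV. - (x $ i - a $ i)\<^sup>2 / 2)"
    unfolding N by (simp only: sum_negf[symmetric] sum_divide_distrib)
  then have "exp (- (norm (x - a))\<^sup>2 / 2) = (\<Prod>i\<in>UNIV. exp (- (x $ i - a $ i)\<^sup>2 / 2))"
    by (simp only: exp_sum finite)
  moreover have "cis (b \<bullet> x) = (\<Prod>i\<in>UNIV. cis (b $ i * x $ i))"
    unfolding inner_vec_def by (subst cis_sum) auto
  ultimately show ?thesis unfolding gauss_def by (simp add: prod.distrib)
qed

text \<open>The factor by which the unnormalized Fourier transform multiplies L2 norms. The type
  argument carries the dimension.\<close>

definition gauss_const :: "'n::finite itself \<Rightarrow> real" where
  "gauss_const _ = sqrt (2 * pi) ^ CARD('n)"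

lemma gauss_integral:
  fixes a b :: "real ^ 'n"
  shows "integrable lebesgue (gauss a b)"
    "integral\<^sup>L lebesgue (gauss a b)
       = complex_of_real (gauss_const TYPE('n) * exp (- (norm b)\<^sup>2 / 2)) * cis (b \<bullet> a)"
proof -
  have hb: "has_bochner_integral lborel (\<lambda>x. complex_of_real (exp (- (x - a $ i)\<^sup>2 / 2)) * cis (b $ i * x))
     (complex_of_real (sqrt (2 * pi) * exp (- (b $ i)\<^sup>2 / 2)) * cis (b $ i * a $ i))" for i
    by (rule gaussian_fourier_real)
  have g: "gauss a b = (\<lambda>x. \<Prod>i\<in>UNIV. complex_of_real (exp (- (x $ i - a $ i)\<^sup>2 / 2)) * cis (b $ i * x $ i))"
    by (rule ext) (rule gauss_prod)
  note I = integral_prod_vec[of "\<lambda>i t. complex_of_real (exp (- (t - a $ i)\<^sup>2 / 2)) * cis (b $ i * t)",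
      OF integrable.intros[OF hb]]
  show "integrable lebesgue (gauss a b)" unfolding g by (rule I(1))
  have "integral\<^sup>L lebesgue (gauss a b)
     = (\<Prod>i\<in>UNIV. complex_of_real (sqrt (2 * pi) * exp (- (b $ i)\<^sup>2 / 2)) * cis (b $ i * a $ i))"
    unfolding g I(2) has_bochner_integral_integral_eq[OF hb] ..
  also have "\<dots> = complex_of_real (sqrt (2 * pi) ^ CARD('n) * (\<Prod>i\<in>UNIV. exp (- (b $ i)\<^sup>2 / 2))) * (\<Prod>i\<in>UNIV. cis (b $ i * a $ i))"
    by (simp add: prod.distrib)
  also have "(\<Prod>i\<in>UNIV. exp (- (b $ i)\<^sup>2 / 2)) = exp (\<Sum>i\<in>UNIV. - (b $ i)\<^sup>2 / 2)"
    by (simp only: exp_sum finite)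
  also have "(\<Sum>i\<in>UNIV. - (b $ i)\<^sup>2 / 2) = - (\<Sum>i\<in>UNIV. (b $ i)\<^sup>2) / 2"
    by (simp only: sum_negf[symmetric] sum_divide_distrib)
  also have "(\<Sum>i\<in>UNIV. (b $ i)\<^sup>2) = (norm b)\<^sup>2"
    unfolding power2_norm_eq_inner inner_vec_def by (simp add: power2_eq_square)
  also have "(\<Prod>i\<in>UNIV. cis (b $ i * a $ i)) = cis (b \<bullet> a)"
    unfolding inner_vec_def by (subst cis_sum) auto
  finally show "integral\<^sup>L lebesgue (gauss a b)
       = complex_of_real (gauss_const TYPE('n) * exp (- (norm b)\<^sup>2 / 2)) * cis (b \<bullet> a)"
    by (simp add: gauss_const_def)
qed

lemma fourier_integral_cis: "fourier_integral f \<omega> = integral\<^sup>L lebesgue (\<lambda>x. f x * cis (- (x \<bullet> \<omega>)))"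
  by (simp add: fourier_integral_def cis_conv_exp)

text \<open>Multiplying by the exponential only lowers the frequency by \<omega>, so the transform
  at \<omega> is the total integral of another Gaussian.\<close>

lemma fourier_gauss:
  fixes a b :: "real ^ 'n"
  shows "fourier_integral (gauss a b) \<omega> = complex_of_real (gauss_const TYPE('n)) * cis (a \<bullet> b) * gauss b (- a) \<omega>"
proof -
  have "gauss a b x * cis (- (x \<bullet> \<omega>)) = gauss a (b - \<omega>) x" for x
    by (simp add: gauss_def mult.assoc cis_mult inner_diff_left inner_commute[of x \<omega>])
  then have "fourier_integral (gauss a b) \<omega> = integral\<^sup>L lebesgue (gauss a (b - \<omega>))"
    by (simp add: fourier_integral_cis)
  also have "\<dots> = complex_of_real (gauss_const TYPE('n)) * cis (a \<bullet> b) * gauss b (- a) \<omega>"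
    unfolding gauss_integral
    by (simp add: gauss_def mult.assoc cis_mult inner_diff_left inner_commute[of a b] inner_commute[of a \<omega>] norm_minus_commute[of \<omega> b])
  finally show ?thesis .
qed

lemma cnj_gauss: "cnj (gauss a b x) = gauss a (- b) x"
  by (simp add: gauss_def cis_cnj)

lemma norm_gauss_le: "cmod (gauss a b x) \<le> 1"
  by (simp add: gauss_def norm_mult)

lemma gauss_L2: "gauss a b \<in> L2_space"
proof -
  have [measurable]: "gauss a b \<in> borel_measurable lebesgue" using gauss_integral(1)[of a b] by auto
  have "integrable lebesgue (\<lambda>x. (cmod (gauss a b x))\<^sup>2)"
  proof (rule Bochner_Integration.integrable_bound[OF gauss_integral(1)[of a b]])
    show "(\<lambda>x. (cmod (gauss a b x))\<^sup>2) \<in> borel_measurable lebesgue" by measurable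
    show "AE x in lebesgue. norm ((cmod (gauss a b x))\<^sup>2) \<le> norm (gauss a b x)"
      by (intro AE_I2) (simp add: power2_eq_square mult_left_le norm_gauss_le)
  qed
  then show ?thesis by (simp add: L2_space_def)
qed

inductive_set gauss_span :: "(real ^ 'n \<Rightarrow> complex) set" where
  gauss: "(\<lambda>x. c * gauss a b x) \<in> gauss_span"
| add: "f \<in> gauss_span \<Longrightarrow> g \<in> gauss_span \<Longrightarrow> (\<lambda>x. f x + g x) \<in> gauss_span"

lemma gauss_span_integrable: "f \<in> gauss_span \<Longrightarrow> integrable lebesgue f"
  by (induction rule: gauss_span.induct) (auto simp: gauss_integral)

lemma gauss_span_L2: "f \<in> gauss_span \<Longrightarrow> f \<in> L2_space"
  by (induction rule: gauss_span.induct) (auto intro: L2_add L2_scale gauss_L2)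

lemma gauss_span_cnj: "f \<in> gauss_span \<Longrightarrow> (\<lambda>x. cnj (f x)) \<in> gauss_span"
  by (induction rule: gauss_span.induct) (simp_all add: cnj_gauss gauss_span.intros)

lemma gauss_span_scale: "f \<in> gauss_span \<Longrightarrow> (\<lambda>x. c * f x) \<in> gauss_span"
proof (induction rule: gauss_span.induct)
  case (gauss d a b)
  then show ?case using gauss_span.gauss[of "c * d" a b] by (simp add: mult.assoc)
qed (simp add: distrib_left gauss_span.add)

lemma fourier_integrable:
  assumes "integrable lebesgue f"
  shows "integrable lebesgue (\<lambda>x. f x * cis (- (x \<bullet> \<omega>)))"
proof (rule Bochner_Integration.integrable_bound[OF assms])
  have [measurable]: "f \<in> borel_measurable lebesgue" using assms by auto
  have "(\<lambda>x. cis (- (x \<bullet> \<omega>))) \<in> borel_measurable borel"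
    by (auto intro!: borel_measurable_continuous_onI continuous_intros)
  then have [measurable]: "(\<lambda>x. cis (- (x \<bullet> \<omega>))) \<in> borel_measurable lebesgue"
    by (simp add: measurable_completion)
  show "(\<lambda>x. f x * cis (- (x \<bullet> \<omega>))) \<in> borel_measurable lebesgue" by measurable
qed (simp add: norm_mult)

lemma fourier_integral_add:
  "integrable lebesgue f \<Longrightarrow> integrable lebesgue g \<Longrightarrow>
     fourier_integral (\<lambda>x. f x + g x) \<omega> = fourier_integral f \<omega> + fourier_integral g \<omega>"
  by (simp add: fourier_integral_cis distrib_right fourier_integrable)

lemma fourier_integral_scale: "fourier_integral (\<lambda>x. c * f x) \<omega> = c * fourier_integral f \<omega>"
  by (simp add: fourier_integral_cis mult.assoc)

lemma gauss_span_fourier: "f \<in> gauss_span \<Longrightarrow> fourier_integral f \<in> gauss_span"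
proof (induction rule: gauss_span.induct)
  case (gauss c a b)
  have "fourier_integral (\<lambda>x. c * gauss a b x)
    = (\<lambda>\<omega>. (c * (complex_of_real (gauss_const TYPE('a)) * cis (a \<bullet> b))) * gauss b (- a) \<omega>)"
    by (rule ext) (simp add: fourier_integral_scale fourier_gauss mult.assoc)
  then show ?case by (simp only: gauss_span.gauss)
next
  case (add f g)
  have "fourier_integral (\<lambda>x. f x + g x) = (\<lambda>\<omega>. fourier_integral f \<omega> + fourier_integral g \<omega>)"
    by (rule ext, rule fourier_integral_add) (use add gauss_span_integrable in auto)
  with add show ?case by (simp only: gauss_span.add)
qed

text \<open>Conjugating before the second transform expresses inversion without an inverse
  transform. Two applications of \<open>fourier_gauss\<close> leave the phases
  \<open>cis (- (a \<bullet> b))\<close> and \<open>cis (a \<bullet> b)\<close>, which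
  cancel.\<close>

lemma gauss_span_inversion:
  fixes f :: "real ^ 'n \<Rightarrow> complex"
  shows "f \<in> gauss_span \<Longrightarrow>
   fourier_integral (\<lambda>\<omega>. cnj (fourier_integral f \<omega>)) x = complex_of_real ((gauss_const TYPE('n))\<^sup>2) * cnj (f x)"
proof (induction rule: gauss_span.induct)
  case (gauss c a b)
  have "(\<lambda>\<omega>. cnj (fourier_integral (\<lambda>x. c * gauss a b x) \<omega>))
     = (\<lambda>\<omega>. cnj c * complex_of_real (gauss_const TYPE('n)) * cis (- (a \<bullet> b)) * gauss b a \<omega>)"
    by (rule ext) (simp add: fourier_integral_scale fourier_gauss cnj_gauss cis_cnj)
  then have "fourier_integral (\<lambda>\<omega>. cnj (fourier_integral (\<lambda>x. c * gauss a b x) \<omega>)) x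
     = cnj c * complex_of_real (gauss_const TYPE('n)) * cis (- (a \<bullet> b)) * fourier_integral (gauss b a) x"
    by (simp only: fourier_integral_scale)
  also have "\<dots> = complex_of_real ((gauss_const TYPE('n))\<^sup>2) * cnj c * gauss a (- b) x * (cis (- (a \<bullet> b)) * cis (a \<bullet> b))"
    by (simp add: fourier_gauss power2_eq_square inner_commute)
  also have "cis (- (a \<bullet> b)) * cis (a \<bullet> b) = 1" by (simp add: cis_mult)
  finally show ?case by (simp add: cnj_gauss)
next
  case (add f g)
  have 1: "fourier_integral (\<lambda>x. f x + g x) = (\<lambda>\<omega>. fourier_integral f \<omega> + fourier_integral g \<omega>)"
    by (rule ext, rule fourier_integral_add) (use add gauss_span_integrable in auto)
  have "fourier_integral (\<lambda>\<omega>. cnj (fourier_integral f \<omega>) + cnj (fourier_integral g \<omega>)) x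
    = fourier_integral (\<lambda>\<omega>. cnj (fourier_integral f \<omega>)) x + fourier_integral (\<lambda>\<omega>. cnj (fourier_integral g \<omega>)) x"
    by (rule fourier_integral_add) (use add in \<open>auto intro!: gauss_span_integrable gauss_span_cnj gauss_span_fourier\<close>)
  with add show ?case unfolding 1 by (simp add: distrib_left)
qed

text \<open>Both sides are the same double integral over the product of \<open>lborel\<close> with
  itself, taken in the two orders.\<close>

lemma fourier_multiplication_formula:
  fixes f g :: "real ^ 'n \<Rightarrow> complex"
  assumes f: "integrable lebesgue f" and g: "integrable lebesgue g"
  shows "integral\<^sup>L lebesgue (\<lambda>x. fourier_integral f x * g x) = integral\<^sup>L lebesgue (\<lambda>x. f x * fourier_integral g x)"
proof -
  \<comment> \<open>Fubini is applied on the Borel product, hence each factor is replaced by a Borel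
    representative, which leaves its Fourier integral unchanged at every point.\<close>
  have rep: "\<exists>f'. f' \<in> borel_measurable borel \<and> integrable lborel f' \<and> (AE x in lebesgue. f x = f' x) \<and>
      fourier_integral f = (\<lambda>\<omega>. integral\<^sup>L lborel (\<lambda>x. f' x * cis (- (x \<bullet> \<omega>))))"
    if f: "integrable lebesgue f" for f :: "real ^ 'n \<Rightarrow> complex"
  proof -
    have fm[measurable]: "f \<in> borel_measurable lebesgue" using f by auto
    obtain f' where f': "f' \<in> borel_measurable borel" "AE x in lebesgue. f x = f' x"
      using lebesgue_borel_representative[OF fm] by blast
    have [measurable]: "f' \<in> borel_measurable borel" "f' \<in> borel_measurable lebesgue"
      using f'(1) by (simp_all add: measurable_completion)
    have "integrable lebesgue f'"
      by (rule integrable_cong_AE_imp[OF f _]) (use f'(2) in \<open>auto\<close>)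
    then have i: "integrable lborel f'" by (simp add: integrable_completion)
    have "fourier_integral f \<omega> = integral\<^sup>L lborel (\<lambda>x. f' x * cis (- (x \<bullet> \<omega>)))" for \<omega>
    proof -
      have c[measurable]: "(\<lambda>x. cis (- (x \<bullet> \<omega>))) \<in> borel_measurable borel"
        by (auto intro!: borel_measurable_continuous_onI continuous_intros)
      then have [measurable]: "(\<lambda>x. cis (- (x \<bullet> \<omega>))) \<in> borel_measurable lebesgue"
        by (simp add: measurable_completion)
      have "fourier_integral f \<omega> = integral\<^sup>L lebesgue (\<lambda>x. f' x * cis (- (x \<bullet> \<omega>)))"
        unfolding fourier_integral_cis by (rule integral_cong_AE) (use f'(2) in auto)
      also have "\<dots> = integral\<^sup>L lborel (\<lambda>x. f' x * cis (- (x \<bullet> \<omega>)))"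
        by (rule integral_completion) measurable
      finally show ?thesis .
    qed
    with f' i show ?thesis by blast
  qed
  obtain f' where f': "f' \<in> borel_measurable borel" "integrable lborel f'" "AE x in lebesgue. f x = f' x"
      "fourier_integral f = (\<lambda>\<omega>. integral\<^sup>L lborel (\<lambda>x. f' x * cis (- (x \<bullet> \<omega>))))" using rep[OF f] by blast
  obtain g' where g': "g' \<in> borel_measurable borel" "integrable lborel g'" "AE x in lebesgue. g x = g' x"
      "fourier_integral g = (\<lambda>\<omega>. integral\<^sup>L lborel (\<lambda>x. g' x * cis (- (x \<bullet> \<omega>))))" using rep[OF g] by blast
  have [measurable]: "f' \<in> borel_measurable borel" "g' \<in> borel_measurable borel" by fact+
  have [measurable]: "f' \<in> borel_measurable lebesgue" "g' \<in> borel_measurable lebesgue"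
     "f \<in> borel_measurable lebesgue" "g \<in> borel_measurable lebesgue"
    using f g by (auto simp: measurable_completion)
  have c[measurable]: "(\<lambda>p. cis (- (fst p \<bullet> snd p))) \<in> borel_measurable (borel \<Otimes>\<^sub>M (borel :: (real^'n) measure))"
    unfolding borel_prod by (auto intro!: borel_measurable_continuous_onI continuous_intros)
  have c2: "(\<lambda>p. cis (- (fst p \<bullet> snd p))) \<in> borel_measurable (lborel \<Otimes>\<^sub>M (lborel :: (real^'n) measure))"
    using c by (simp cong: measurable_cong_sets)
  have m2: "(\<lambda>p. f' (fst p) * cis (- (fst p \<bullet> snd p)) * g' (snd p)) \<in> borel_measurable (lborel \<Otimes>\<^sub>M lborel)"
    using c2 by measurable
  have "integrable (lborel \<Otimes>\<^sub>M lborel) (\<lambda>p. f' (fst p) * cis (- (fst p \<bullet> snd p)) * g' (snd p))"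
  \<comment> \<open>The exponential has modulus 1, so absolute integrability reduces to that of the
    product of \<open>f'\<close> and \<open>g'\<close>.\<close>
  proof (rule lborel_pair.Fubini_integrable[OF m2])
    show "integrable lborel (\<lambda>x. \<integral>y. cmod (f' (fst (x, y)) * cis (- (fst (x, y) \<bullet> snd (x, y))) * g' (snd (x, y))) \<partial>lborel)"
      using f'(2) by (simp add: norm_mult)
    have "integrable lborel (\<lambda>y. f' x * cis (- (x \<bullet> y)) * g' y)" for x
    proof (rule Bochner_Integration.integrable_bound)
      show "integrable lborel (\<lambda>y. f' x * g' y)" using g'(2) by simp
      have [measurable]: "(\<lambda>y. cis (- (x \<bullet> y))) \<in> borel_measurable borel"
        by (auto intro!: borel_measurable_continuous_onI continuous_intros)
      show "(\<lambda>y. f' x * cis (- (x \<bullet> y)) * g' y) \<in> borel_measurable lborel" by measurable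
    qed (simp add: norm_mult)
    then show "AE x in lborel. integrable lborel (\<lambda>y. f' (fst (x, y)) * cis (- (fst (x, y) \<bullet> snd (x, y))) * g' (snd (x, y)))"
      by simp
  qed
  then have fub: "integrable (lborel \<Otimes>\<^sub>M lborel) (case_prod (\<lambda>x y. f' x * cis (- (x \<bullet> y)) * g' y))"
    by (simp add: case_prod_unfold)
  have m: "fourier_integral f \<in> borel_measurable borel" "fourier_integral g \<in> borel_measurable borel"
  proof -
    have c0: "(\<lambda>p. cis (- (snd p \<bullet> fst p))) \<in> borel_measurable (borel \<Otimes>\<^sub>M (borel :: (real^'n) measure))"
      unfolding borel_prod by (auto intro!: borel_measurable_continuous_onI continuous_intros)
    then have c': "(\<lambda>p. cis (- (snd p \<bullet> fst p))) \<in> borel_measurable (borel \<Otimes>\<^sub>M (lborel :: (real^'n) measure))"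
      by (simp cong: measurable_cong_sets)
    have "case_prod (\<lambda>\<omega> x. f' x * cis (- (x \<bullet> \<omega>))) \<in> borel_measurable (borel \<Otimes>\<^sub>M lborel)"
      "case_prod (\<lambda>\<omega> x. g' x * cis (- (x \<bullet> \<omega>))) \<in> borel_measurable (borel \<Otimes>\<^sub>M lborel)"
      using c' unfolding case_prod_unfold by measurable
    then show "fourier_integral f \<in> borel_measurable borel" "fourier_integral g \<in> borel_measurable borel"
      unfolding f'(4) g'(4) by (auto intro: lborel.borel_measurable_lebesgue_integral)
  qed
  then have [measurable]: "fourier_integral f \<in> borel_measurable borel" "fourier_integral g \<in> borel_measurable borel"
    "fourier_integral f \<in> borel_measurable lebesgue" "fourier_integral g \<in> borel_measurable lebesgue"
    by (auto simp: measurable_completion)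
  have "integral\<^sup>L lebesgue (\<lambda>x. fourier_integral f x * g x) = integral\<^sup>L lebesgue (\<lambda>x. fourier_integral f x * g' x)"
    by (rule integral_cong_AE) (use g'(3) in auto)
  also have "\<dots> = integral\<^sup>L lborel (\<lambda>x. fourier_integral f x * g' x)"
    by (rule integral_completion) measurable
  also have "\<dots> = (\<integral>y. (\<integral>x. f' x * cis (- (x \<bullet> y)) * g' y \<partial>lborel) \<partial>lborel)"
    unfolding f'(4) by simp
  also have "\<dots> = (\<integral>x. (\<integral>y. f' x * cis (- (x \<bullet> y)) * g' y \<partial>lborel) \<partial>lborel)"
    by (rule lborel_pair.Fubini_integral[OF fub])
  also have "\<dots> = integral\<^sup>L lborel (\<lambda>x. f' x * fourier_integral g x)"
    unfolding g'(4) by (simp add: mult.assoc inner_commute mult.commute[of "cis _" "g' _"])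
  also have "\<dots> = integral\<^sup>L lebesgue (\<lambda>x. f' x * fourier_integral g x)"
    by (rule integral_completion[symmetric]) measurable
  also have "\<dots> = integral\<^sup>L lebesgue (\<lambda>x. f x * fourier_integral g x)"
    by (rule integral_cong_AE) (use f'(3) in auto)
  finally show ?thesis .
qed

section \<open>Translations, and density of the Gaussian span\<close>

lemma lebesgue_translation:
  fixes t :: "'a::euclidean_space"
  shows "(\<lambda>x. x + t) \<in> lebesgue \<rightarrow>\<^sub>M lebesgue" "distr lebesgue lebesgue (\<lambda>x. x + t) = lebesgue"
proof -
  have T: "(\<lambda>x. t + (\<Sum>j\<in>Basis. (1 * (x \<bullet> j)) *\<^sub>R j)) = (\<lambda>x::'a. x + t)"
    by (simp add: euclidean_representation add.commute)
  show m: "(\<lambda>x. x + t) \<in> lebesgue \<rightarrow>\<^sub>M lebesgue"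
    using lebesgue_affine_measurable[of "\<lambda>_. 1" t] unfolding T by simp
  have "lebesgue = density (distr lebesgue lebesgue (\<lambda>x. x + t)) (\<lambda>_. (\<Prod>j\<in>(Basis::'a set). \<bar>1::real\<bar>))"
    using lebesgue_affine_euclidean[of "\<lambda>_. 1" t] unfolding T by simp
  then show "distr lebesgue lebesgue (\<lambda>x. x + t) = lebesgue" by (simp add: density_1)
qed

lemma lebesgue_shift_measurable:
  "f \<in> borel_measurable lebesgue \<Longrightarrow> (\<lambda>x. f (x + t)) \<in> borel_measurable lebesgue"
  using measurable_compose[OF lebesgue_translation(1)] .

lemma nn_integral_lebesgue_shift:
  assumes "f \<in> borel_measurable lebesgue"
  shows "(\<integral>\<^sup>+x. f (x + t) \<partial>lebesgue) = (\<integral>\<^sup>+x. f x \<partial>lebesgue)"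
  using nn_integral_distr[OF lebesgue_translation(1)[of t], of f] assms
  unfolding lebesgue_translation(2) by simp

lemma integral_lebesgue_shift:
  fixes f :: "'a::euclidean_space \<Rightarrow> 'b::{banach, second_countable_topology}"
  assumes "f \<in> borel_measurable lebesgue"
  shows "integral\<^sup>L lebesgue (\<lambda>x. f (x + t)) = integral\<^sup>L lebesgue f"
  using integral_distr[OF lebesgue_translation(1)[of t], of f] assms
  unfolding lebesgue_translation(2) by simp

lemma integrable_lebesgue_shift:
  fixes f :: "'a::euclidean_space \<Rightarrow> 'b::{banach, second_countable_topology}"
  assumes "integrable lebesgue f"
  shows "integrable lebesgue (\<lambda>x. f (x + t))"
proof -
  have "integrable (distr lebesgue lebesgue (\<lambda>x. x + t)) f" unfolding lebesgue_translation(2) by (rule assms)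
  then show ?thesis using integrable_distr[OF lebesgue_translation(1)] by blast
qed

lemma AE_lebesgue_shift:
  fixes t :: "'a::euclidean_space"
  assumes "AE x in lebesgue. P x"
  shows "AE x in lebesgue. P (x + t)"
proof -
  have "AE x in distr lebesgue lebesgue (\<lambda>x. x + t). P x" unfolding lebesgue_translation(2) by (rule assms)
  then show ?thesis by (rule AE_distrD[OF lebesgue_translation(1)])
qed

lemma L2_shift:
  assumes "f \<in> L2_space"
  shows "(\<lambda>x. f (x + t)) \<in> L2_space" "L2_norm (\<lambda>x. f (x + t)) = L2_norm f"
proof -
  have fm: "f \<in> borel_measurable lebesgue" using assms by (rule L2_measurable)
  show "(\<lambda>x. f (x + t)) \<in> L2_space"
    using integrable_lebesgue_shift[OF L2_integrable[OF assms]] lebesgue_shift_measurable[OF fm]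
    by (simp add: L2_space_def)
  have m: "(\<lambda>x. (cmod (f x))\<^sup>2) \<in> borel_measurable lebesgue" using fm by measurable
  show "L2_norm (\<lambda>x. f (x + t)) = L2_norm f"
    unfolding L2_norm_def using integral_lebesgue_shift[OF m, of t] by simp
qed

lemma L2_tendsto_shift:
  assumes "L2_tendsto s f F"
  shows "L2_tendsto (\<lambda>i x. s i (x + t)) (\<lambda>x. f (x + t)) F"
proof -
  have 1: "s i \<in> L2_space" "f \<in> L2_space" for i using assms by (auto simp: L2_tendsto_def)
  have "L2_norm (\<lambda>x. s i (x + t) - f (x + t)) = L2_dist (s i) f" for i
    using L2_shift(2)[OF L2_diff[OF 1], of i t] by simp
  with assms show ?thesis by (simp add: L2_tendsto_def L2_shift 1)
qed

lemma trig_poly_reduce: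
  fixes x :: "real ^ 'n"
  shows "\<exists>m. x + real_vec m \<in> cbox 0 1"
proof
  show "x + real_vec (\<chi> i. - \<lfloor>x $ i\<rfloor>) \<in> cbox 0 1"
    unfolding mem_box_cart real_vec_def by (auto; linarith)
qed

text \<open>A character times a centred Gaussian is a Gaussian with another frequency. The affine
  substitution lets the unit torus stand for large cubes.\<close>

lemma gauss_span_trig_poly:
  assumes "p \<in> trig_poly"
  shows "(\<lambda>x. p (s *\<^sub>R x + t) * gauss 0 0 x) \<in> gauss_span"
  using assms
proof (induction rule: trig_poly.induct)
  case (char c k)
  have "c * trig_char k (s *\<^sub>R x + t) * gauss 0 0 x
     = (c * trig_char k t) * gauss 0 ((2 * pi * s) *\<^sub>R real_vec k) x" for x
    by (simp add: gauss_def trig_char_shift) (simp add: trig_char_def mult_ac)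
  then show ?case by (simp only: gauss_span.gauss)
qed (simp add: distrib_right gauss_span.add)

abbreviation cube :: "real \<Rightarrow> (real ^ 'n) set" where
  "cube N \<equiv> box (- (N *\<^sub>R 1)) (N *\<^sub>R 1)"

lemma L2_approx_compact_support:
  fixes f :: "real ^ 'n \<Rightarrow> complex"
  assumes f: "f \<in> L2_space" and e: "e > 0"
  obtains N g where "N > 0" "continuous_on UNIV g" "\<And>x. x \<notin> cube N \<Longrightarrow> g x = 0"
    "g \<in> L2_space" "L2_dist f g < e"
proof -
  have [measurable]: "f \<in> borel_measurable lebesgue" using f by (rule L2_measurable)
  define B where "B n = (cube (real (Suc n)) :: (real ^ 'n) set)" for n
  have [measurable]: "B n \<in> sets lebesgue" for n by (simp add: B_def)
  define s where "s n x = f x - indicator (B n) x * f x" for n x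
  have m: "s n \<in> borel_measurable lebesgue" for n unfolding s_def by measurable
  have lim: "(\<lambda>n. s n x) \<longlonglongrightarrow> 0" for x
  proof (rule tendsto_eventually)
    obtain N where N: "norm x < real N" using reals_Archimedean2 by blast
    have "s n x = 0" if "n \<ge> N" for n
    proof -
      have "- real (Suc n) < x $ i \<and> x $ i < real (Suc n)" for i
        using component_le_norm_cart[of x i] N that by auto
      then have "x \<in> B n" unfolding B_def mem_box_cart by simp
      then show ?thesis by (simp add: s_def)
    qed
    then show "\<forall>\<^sub>F n in sequentially. s n x = 0" by (auto simp: eventually_sequentially)
  qed
  have bd: "cmod (s n x) \<le> cmod (f x)" for n x by (simp add: s_def indicator_def)
  have "e/2 > 0" using e by simp
  then obtain n where n: "s n \<in> L2_space" "L2_norm (s n) < e/2"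
    by (rule L2_dominated_small[OF m f AE_I2[OF lim] AE_I2[OF bd]])
  define f1 where "f1 x = indicator (B n) x * f x" for x
  have f1: "f1 \<in> L2_space" using L2_diff[OF f n(1)] by (simp add: s_def f1_def[abs_def])
  have f10: "x \<notin> cube (real (Suc n)) \<Longrightarrow> f1 x = 0" for x
    by (simp add: f1_def B_def)
  obtain g where g: "continuous_on UNIV g" "\<And>x. x \<notin> cube (real (Suc n)) \<Longrightarrow> g x = 0"
    "g \<in> L2_space" "L2_dist f1 g < e/2"
    using L2_approx_continuous[OF f1 f10, where e="e/2"] e by auto
  have "L2_dist f g < e"
    using L2_norm_triangle3[OF f f1 g(3)] n g(4) unfolding s_def f1_def by linarith
  then show ?thesis using g by (intro that[of "real (Suc n)" g]) auto
qed

text \<open>Dividing a compactly supported continuous approximation by the centred Gaussian leaves a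
  function \<open>h\<close> that trigonometric polynomials of ever larger period approximate
  uniformly on the period cube. After multiplying back, the Gaussian controls the periodic copies of
  \<open>h\<close> outside that cube.\<close>

lemma gauss_span_dense:
  fixes f :: "real ^ 'n \<Rightarrow> complex"
  assumes f: "f \<in> L2_space" and e: "e > 0"
  obtains g where "g \<in> gauss_span" "L2_dist f g < e"
proof -
  obtain N h0 where N: "N > 0" and h0: "continuous_on UNIV h0"
    "\<And>x. x \<notin> cube N \<Longrightarrow> h0 x = 0" "h0 \<in> L2_space" "L2_dist f h0 < e/2"
    using L2_approx_compact_support[OF f, of "e/2"] e by auto
  define h where "h x = h0 x * complex_of_real (exp ((norm x)\<^sup>2 / 2))" for x
  have hc: "continuous_on UNIV h" unfolding h_def by (intro continuous_intros h0)  auto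
  have hs: "x \<notin> cube N \<Longrightarrow> h x = 0" for x by (simp add: h_def h0)
  have h0h: "h0 x = h x * gauss 0 0 x" for x
    by (simp add: h_def gauss_def mult.assoc of_real_mult[symmetric] exp_add[symmetric] del: of_real_mult)
  have "bounded (h ` cbox (- (N *\<^sub>R 1)) (N *\<^sub>R 1))"
    by (intro compact_imp_bounded compact_continuous_image compact_cbox continuous_on_subset[OF hc]) auto
  then obtain M where M: "M > 0" "\<And>x. x \<in> cbox (- (N *\<^sub>R 1)) (N *\<^sub>R 1) \<Longrightarrow> cmod (h x) \<le> M"
    unfolding bounded_pos by auto
  have hM: "cmod (h x) \<le> M" for x
    using M hs[of x] box_subset_cbox by (cases "x \<in> cube N") (auto simp: less_imp_le)
  \<comment> \<open>The cubes of half-width \<open>R n\<close> contain the support of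
    \<open>h\<close> and grow, so every point is eventually in the region where the approximation is
    good.\<close>
  define R where "R n = N + real n" for n
  have R: "R n > 0" "R n \<ge> N" for n using N by (auto simp: R_def)
  have "\<exists>p. p \<in> trig_poly \<and> (\<forall>\<theta>\<in>cbox 0 1. cmod (h ((2 * R n) *\<^sub>R \<theta> - R n *\<^sub>R 1) - p \<theta>) < 1 / real (Suc n))" for n
  proof -
    define hn where "hn \<theta> = h ((2 * R n) *\<^sub>R \<theta> - R n *\<^sub>R 1)" for \<theta>
    have c: "continuous_on UNIV hn" unfolding hn_def
      by (intro continuous_on_compose2[OF hc] continuous_intros) auto
    have z: "hn \<theta> = 0" if "\<theta> \<notin> box 0 1" for \<theta>
    proof -
      from that obtain i where i: "\<theta> $ i \<le> 0 \<or> 1 \<le> \<theta> $ i" by (auto simp: mem_box_cart not_less)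
      have "(2 * R n) * \<theta> $ i - R n \<le> - N \<or> N \<le> (2 * R n) * \<theta> $ i - R n"
        using i
      proof
        assume "\<theta> $ i \<le> 0"
        then have "(2 * R n) * \<theta> $ i \<le> 0" using R(1)[of n] by (simp add: mult_nonneg_nonpos)
        then show ?thesis using R(2)[of n] by linarith
      next
        assume "1 \<le> \<theta> $ i"
        then have "(2 * R n) * 1 \<le> (2 * R n) * \<theta> $ i" using R(1)[of n] by (intro mult_left_mono) auto
        then show ?thesis using R(2)[of n] by linarith
      qed
      then have "(2 * R n) *\<^sub>R \<theta> - R n *\<^sub>R 1 \<notin> cube N"
        unfolding mem_box_cart by (auto simp: not_less intro!: exI[of _ i])
      then show ?thesis unfolding hn_def by (rule hs)
    qed
    have "0 < 1 / real (Suc n)" by simp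
    from trig_poly_dense_continuous[OF c z this] show ?thesis unfolding hn_def Bex_def .
  qed
  then have "\<forall>n. \<exists>p. p \<in> trig_poly \<and> (\<forall>\<theta>\<in>cbox 0 1. cmod (h ((2 * R n) *\<^sub>R \<theta> - R n *\<^sub>R 1) - p \<theta>) < 1 / real (Suc n))" ..
  from choice[OF this] obtain p where p: "\<And>n. p n \<in> trig_poly"
     "\<And>n \<theta>. \<theta> \<in> cbox 0 1 \<Longrightarrow> cmod (h ((2 * R n) *\<^sub>R \<theta> - R n *\<^sub>R 1) - p n \<theta>) < 1 / real (Suc n)" by auto
  \<comment> \<open>Periodicity reduces any point to the unit cube, where \<open>p n\<close> differs
    from a value of \<open>h\<close> by less than 1; the resulting bound is uniform in
    \<open>n\<close>.\<close>
  have pb: "cmod (p n \<theta>) \<le> M + 1" for n \<theta>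
  proof -
    obtain m where m: "\<theta> + real_vec m \<in> cbox 0 1" using trig_poly_reduce by blast
    have "cmod (p n (\<theta> + real_vec m)) \<le> cmod (h ((2 * R n) *\<^sub>R (\<theta> + real_vec m) - R n *\<^sub>R 1)) + 1 / real (Suc n)"
      using p(2)[OF m, of n] norm_triangle_ineq4[of "h ((2 * R n) *\<^sub>R (\<theta> + real_vec m) - R n *\<^sub>R 1)"
        "h ((2 * R n) *\<^sub>R (\<theta> + real_vec m) - R n *\<^sub>R 1) - p n (\<theta> + real_vec m)"] by simp
    also have "\<dots> \<le> M + 1" by (intro add_mono hM) simp
    finally show ?thesis by (simp add: trig_poly_periodic[OF p(1)])
  qed
  \<comment> \<open>The argument is the inverse of the substitution from the unit cube to the cube
    of half-width \<open>R n\<close>.\<close>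
  define P where "P n x = p n ((1 / (2 * R n)) *\<^sub>R x + (1/2) *\<^sub>R 1)" for n x
  have Pspan: "(\<lambda>x. P n x * gauss 0 0 x) \<in> gauss_span" for n
    unfolding P_def by (rule gauss_span_trig_poly[OF p(1)])
  have PL2: "(\<lambda>x. P n x * gauss 0 0 x) \<in> L2_space" for n by (rule gauss_span_L2[OF Pspan])
  define s where "s n x = h0 x - P n x * gauss 0 0 x" for n x
  have sm: "s n \<in> borel_measurable lebesgue" for n
    unfolding s_def by (rule L2_measurable[OF L2_diff[OF h0(3) PL2]])
  have close: "cmod (h x - P n x) < 1 / real (Suc n)" if "norm x \<le> R n" for x n
  proof -
    define \<theta> where "\<theta> = (1 / (2 * R n)) *\<^sub>R x + (1/2) *\<^sub>R (1 :: real^'n)"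
    have "(2 * R n) *\<^sub>R \<theta> - R n *\<^sub>R 1 = x"
      using R(1)[of n] by (simp add: \<theta>_def scaleR_add_right)
    moreover have "\<theta> \<in> cbox 0 1"
    proof -
      have "0 \<le> x $ i / (2 * R n) + 1/2 \<and> x $ i / (2 * R n) + 1/2 \<le> 1" for i
        using component_le_norm_cart[of x i] that R(1)[of n] by (simp add: field_simps abs_le_iff)
      then show ?thesis unfolding mem_box_cart \<theta>_def by simp
    qed
    ultimately show ?thesis using p(2)[of \<theta> n] by (simp add: P_def \<theta>_def)
  qed
  have lim: "(\<lambda>n. s n x) \<longlonglongrightarrow> 0" for x
  proof (rule Lim_null_comparison)
    obtain K where K: "norm x < real K" using reals_Archimedean2 by blast
    have "cmod (s n x) \<le> 1 / real (Suc n)" if "n \<ge> K" for n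
    proof -
      have "s n x = (h x - P n x) * gauss 0 0 x" by (simp add: s_def h0h left_diff_distrib)
      then have "cmod (s n x) \<le> cmod (h x - P n x) * 1"
        unfolding norm_mult using norm_gauss_le by (metis mult_left_mono norm_ge_zero norm_mult)
      also have "\<dots> \<le> 1 / real (Suc n)"
        using close[of x n] K that N by (simp add: R_def less_imp_le)
      finally show ?thesis .
    qed
    then show "\<forall>\<^sub>F n in sequentially. norm (s n x) \<le> 1 / real (Suc n)" by (auto simp: eventually_sequentially)
    show "(\<lambda>n. 1 / real (Suc n)) \<longlonglongrightarrow> 0" using LIMSEQ_Suc[OF lim_const_over_n[of 1]] by simp
  qed
  \<comment> \<open>In modulus \<open>h\<close> is at most \<open>M\<close> and \<open>P n\<close>
    at most \<open>M + 1\<close>.\<close>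
  define w where "w x = complex_of_real (2 * M + 1) * gauss 0 0 x" for x :: "real^'n"
  have w: "w \<in> L2_space" unfolding w_def by (rule L2_scale[OF gauss_L2])
  have bd: "cmod (s n x) \<le> cmod (w x)" for n x
  proof -
    have "cmod (s n x) = cmod (h x - P n x) * cmod (gauss 0 0 x)"
      by (simp add: s_def h0h left_diff_distrib[symmetric] norm_mult)
    also have "\<dots> \<le> (2 * M + 1) * cmod (gauss 0 0 x)"
    proof (rule mult_right_mono)
      show "cmod (h x - P n x) \<le> 2 * M + 1"
        using norm_triangle_ineq4[of "h x" "P n x"] hM[of x] pb[of n] unfolding P_def by (smt (verit))
    qed simp
    also have "\<dots> = cmod (w x)" using M(1) by (simp add: w_def norm_mult del: of_real_add of_real_mult)
    finally show ?thesis .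
  qed
  have "e/2 > 0" using e by simp
  then obtain n where n: "L2_norm (s n) < e/2"
    by (rule L2_dominated_small[OF sm w AE_I2[OF lim] AE_I2[OF bd]])
  have "L2_norm (\<lambda>x. f x - P n x * gauss 0 0 x) < e"
    using L2_norm_triangle3[OF f h0(3) PL2[of n]] n h0(4) unfolding s_def by linarith
  then show ?thesis by (rule that[OF Pspan])
qed

section \<open>Plancherel's theorem for integrable functions\<close>

lemma gauss_const_pos: "gauss_const TYPE('n::finite) > 0"
  by (simp add: gauss_const_def)

lemma integral_mult_cnj:
  assumes "f \<in> L2_space"
  shows "integral\<^sup>L lebesgue (\<lambda>x. f x * cnj (f x)) = complex_of_real ((L2_norm f)\<^sup>2)"
proof -
  have "integral\<^sup>L lebesgue (\<lambda>x. f x * cnj (f x)) = integral\<^sup>L lebesgue (\<lambda>x. complex_of_real ((cmod (f x))\<^sup>2))"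
    by (rule Bochner_Integration.integral_cong) (simp_all only: complex_norm_square)
  also have "\<dots> = complex_of_real ((L2_norm f)\<^sup>2)"
    unfolding L2_norm_sq by (rule integral_complex_of_real)
  finally show ?thesis .
qed

lemma L2_norm_cnj [simp]: "L2_norm (\<lambda>x. cnj (f x)) = L2_norm f"
  by (simp add: L2_norm_def)

lemma L2_cnj: "f \<in> L2_space \<Longrightarrow> (\<lambda>x. cnj (f x)) \<in> L2_space"
proof -
  assume f: "f \<in> L2_space"
  have "(\<lambda>x. cnj (f x)) \<in> borel_measurable lebesgue"
    using L2_measurable[OF f] borel_measurable_continuous_onI[OF continuous_on_cnj[OF continuous_on_id]]
    by (rule measurable_compose)
  with f show ?thesis by (simp add: L2_space_def)
qed

text \<open>The multiplication formula is applied to \<open>f\<close> and the conjugate of its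
  transform; by the inversion formula, the transform of that conjugate is a multiple of the
  conjugate of \<open>f\<close>.\<close>

lemma fourier_gauss_span_norm:
  fixes f :: "real ^ 'n \<Rightarrow> complex"
  assumes f: "f \<in> gauss_span"
  shows "L2_norm (fourier_integral f) = gauss_const TYPE('n) * L2_norm f"
proof -
  let ?F = "fourier_integral f" and ?k = "gauss_const TYPE('n)"
  have F: "?F \<in> gauss_span" by (rule gauss_span_fourier[OF f])
  have "complex_of_real ((L2_norm ?F)\<^sup>2) = integral\<^sup>L lebesgue (\<lambda>x. ?F x * cnj (?F x))"
    by (rule integral_mult_cnj[symmetric, OF gauss_span_L2[OF F]])
  also have "\<dots> = integral\<^sup>L lebesgue (\<lambda>x. f x * fourier_integral (\<lambda>x. cnj (?F x)) x)"
    by (rule fourier_multiplication_formula)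
       (intro gauss_span_integrable gauss_span_cnj F f)+
  also have "\<dots> = integral\<^sup>L lebesgue (\<lambda>x. complex_of_real (?k\<^sup>2) * (f x * cnj (f x)))"
    by (simp add: gauss_span_inversion[OF f] mult_ac)
  also have "\<dots> = complex_of_real (?k\<^sup>2) * complex_of_real ((L2_norm f)\<^sup>2)"
    by (simp only: integral_mult_right_zero integral_mult_cnj[OF gauss_span_L2[OF f]])
  finally have "(L2_norm ?F)\<^sup>2 = (?k * L2_norm f)\<^sup>2"
    by (simp only: of_real_mult[symmetric] of_real_eq_iff power_mult_distrib)
  then show ?thesis
    by (rule power2_eq_imp_eq) (simp_all add: less_imp_le[OF gauss_const_pos])
qed

lemma fourier_gauss_span_norm_diff:
  fixes f g :: "real ^ 'n \<Rightarrow> complex"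
  assumes f: "f \<in> gauss_span" and g: "g \<in> gauss_span"
  shows "L2_dist (fourier_integral f) (fourier_integral g) = gauss_const TYPE('n) * L2_dist f g"
proof -
  have h: "(\<lambda>x. f x + (-1) * g x) \<in> gauss_span" by (intro gauss_span.add gauss_span_scale f g)
  have "fourier_integral (\<lambda>x. f x + (-1) * g x) = (\<lambda>\<omega>. fourier_integral f \<omega> + (-1) * fourier_integral g \<omega>)"
    by (rule ext, subst fourier_integral_add)
       (simp_all only: gauss_span_integrable[OF f] gauss_span_integrable[OF gauss_span_scale[OF g]] fourier_integral_scale)
  with fourier_gauss_span_norm[OF h] show ?thesis by simp
qed

lemma gauss_span_fourier_surj:
  fixes h :: "real ^ 'n \<Rightarrow> complex"
  assumes h: "h \<in> gauss_span"
  obtains g where "g \<in> gauss_span" "fourier_integral g = h"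
proof -
  let ?k = "gauss_const TYPE('n)"
  have k: "complex_of_real (?k\<^sup>2) \<noteq> 0" using gauss_const_pos[where 'n='n] by simp
  define u where "u x = cnj (h x)" for x
  have u: "u \<in> gauss_span" unfolding u_def by (rule gauss_span_cnj[OF h])
  \<comment> \<open>Conjugation replaces the inverse transform: by
    \<open>gauss_span_inversion\<close>, transforming the conjugate of the transform of
    \<open>u\<close> gives a multiple of the conjugate of \<open>u\<close>, that is of
    \<open>h\<close>.\<close>
  define g where "g x = inverse (complex_of_real (?k\<^sup>2)) * cnj (fourier_integral u x)" for x
  have g: "g \<in> gauss_span" unfolding g_def by (intro gauss_span_scale gauss_span_cnj gauss_span_fourier u)
  have "fourier_integral g \<omega> = h \<omega>" for \<omega>
    using gauss_span_inversion[OF u, of \<omega>] k unfolding g_def fourier_integral_scale by (simp add: u_def)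
  then show ?thesis using g by (intro that[of g]) auto
qed

text \<open>Letting \<open>e\<close> tend to 0 shows that the square of \<open>x\<close> is at most
  \<open>c * x\<close>. The hypothesis has the form in which the pairing estimate below delivers
  it.\<close>

lemma le_of_quadratic_eps:
  fixes x c :: real
  assumes "x \<ge> 0" "c \<ge> 0" and *: "\<And>e. e > 0 \<Longrightarrow> x\<^sup>2 \<le> x * e + c * (x + e)"
  shows "x \<le> c"
proof (rule ccontr)
  assume "\<not> x \<le> c"
  then have xc: "x > c" by simp
  then have pos: "x * (x - c) > 0" "x + c > 0" using assms by (auto intro: mult_pos_pos)
  \<comment> \<open>With this choice \<open>e * (x + c)\<close> is half of the positive number
    \<open>x * (x - c)\<close>, while the hypothesis makes it at least that number.\<close>
  define e where "e = x * (x - c) / (2 * (x + c))"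
  have "e > 0" using pos by (simp add: e_def)
  from *[OF this] have "x * (x - c) \<le> e * (x + c)" by (simp add: power2_eq_square algebra_simps)
  also have "e * (x + c) = x * (x - c) / 2" using pos(2) by (simp add: e_def divide_simps)
  finally show False using pos(1) by simp
qed

text \<open>The pairing is tested on Gaussian combinations converging to the conjugate of \<open>f\<close>.\<close>

lemma L2_norm_le_by_gauss_pairing:
  fixes f :: "real ^ 'n \<Rightarrow> complex"
  assumes f: "f \<in> L2_space" and c: "c \<ge> 0"
    and pair: "\<And>g. g \<in> gauss_span \<Longrightarrow> cmod (integral\<^sup>L lebesgue (\<lambda>x. f x * g x)) \<le> c * L2_norm g"
  shows "L2_norm f \<le> c"
proof (rule le_of_quadratic_eps[OF L2_norm_nonneg c])
  fix e :: real assume "e > 0"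
  then obtain g where g: "g \<in> gauss_span" "L2_norm (\<lambda>x. cnj (f x) - g x) < e"
    using gauss_span_dense[OF L2_cnj[OF f]] by metis
  have gL2: "g \<in> L2_space" by (rule gauss_span_L2[OF g(1)])
  note d = L2_diff[OF L2_cnj[OF f] gL2]
  have "complex_of_real ((L2_norm f)\<^sup>2) = integral\<^sup>L lebesgue (\<lambda>x. f x * (cnj (f x) - g x) + f x * g x)"
    using integral_mult_cnj[OF f] by (simp add: algebra_simps)
  also have "\<dots> = integral\<^sup>L lebesgue (\<lambda>x. f x * (cnj (f x) - g x)) + integral\<^sup>L lebesgue (\<lambda>x. f x * g x)"
    by (rule Bochner_Integration.integral_add) (rule L2_Cauchy_Schwarz(1)[OF f d] L2_Cauchy_Schwarz(1)[OF f gL2])+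
  finally have E: "complex_of_real ((L2_norm f)\<^sup>2) = integral\<^sup>L lebesgue (\<lambda>x. f x * (cnj (f x) - g x)) + integral\<^sup>L lebesgue (\<lambda>x. f x * g x)" .
  have "cmod (complex_of_real ((L2_norm f)\<^sup>2)) \<le> cmod (integral\<^sup>L lebesgue (\<lambda>x. f x * (cnj (f x) - g x))) + cmod (integral\<^sup>L lebesgue (\<lambda>x. f x * g x))"
    unfolding E by (rule norm_triangle_ineq)
  then have "(L2_norm f)\<^sup>2 \<le> cmod (integral\<^sup>L lebesgue (\<lambda>x. f x * (cnj (f x) - g x))) + cmod (integral\<^sup>L lebesgue (\<lambda>x. f x * g x))"
    unfolding norm_of_real by simp
  also have "\<dots> \<le> L2_norm f * L2_norm (\<lambda>x. cnj (f x) - g x) + c * L2_norm g"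
    by (intro add_mono L2_Cauchy_Schwarz(3)[OF f d] pair g(1))
  also have "\<dots> \<le> L2_norm f * e + c * (L2_norm f + e)"
  proof (intro add_mono mult_left_mono c)
    show "L2_norm g \<le> L2_norm f + e"
      using L2_norm_diff_ge[OF L2_cnj[OF f] gL2] g(2) by simp
  qed (use g(2) in auto)
  finally show "(L2_norm f)\<^sup>2 \<le> L2_norm f * e + c * (L2_norm f + e)" .
qed

text \<open>Each inequality is obtained by testing against the Gaussian span. The multiplication
  formula moves the transform onto the test function, whose norm changes by exactly
  \<open>gauss_const\<close>; for the reverse inequality every test function is itself the transform
  of one.\<close>

theorem plancherel_integrable:
  fixes s :: "real ^ 'n \<Rightarrow> complex"
  assumes s1: "integrable lebesgue s" and s2: "s \<in> L2_space" and sh: "fourier_integral s \<in> L2_space"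
  shows "L2_norm (fourier_integral s) = gauss_const TYPE('n) * L2_norm s"
proof (rule antisym)
  let ?k = "gauss_const TYPE('n)"
  have k: "?k > 0" by (rule gauss_const_pos)
  show "L2_norm (fourier_integral s) \<le> ?k * L2_norm s"
  proof (rule L2_norm_le_by_gauss_pairing[OF sh])
    fix g :: "real ^ 'n \<Rightarrow> complex" assume g: "g \<in> gauss_span"
    have "integral\<^sup>L lebesgue (\<lambda>x. fourier_integral s x * g x) = integral\<^sup>L lebesgue (\<lambda>x. s x * fourier_integral g x)"
      by (rule fourier_multiplication_formula[OF s1 gauss_span_integrable[OF g]])
    also have "cmod \<dots> \<le> L2_norm s * L2_norm (fourier_integral g)"
      by (rule L2_Cauchy_Schwarz(3)[OF s2 gauss_span_L2[OF gauss_span_fourier[OF g]]])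
    finally show "cmod (integral\<^sup>L lebesgue (\<lambda>x. fourier_integral s x * g x)) \<le> ?k * L2_norm s * L2_norm g"
      by (simp add: fourier_gauss_span_norm[OF g] mult_ac)
  qed (use k in simp)
  have "L2_norm s \<le> L2_norm (fourier_integral s) / ?k"
  proof (rule L2_norm_le_by_gauss_pairing[OF s2])
    fix h :: "real ^ 'n \<Rightarrow> complex" assume "h \<in> gauss_span"
    then obtain g where g: "g \<in> gauss_span" "fourier_integral g = h" by (rule gauss_span_fourier_surj)
    have "integral\<^sup>L lebesgue (\<lambda>x. s x * h x) = integral\<^sup>L lebesgue (\<lambda>x. fourier_integral s x * g x)"
      unfolding g(2)[symmetric] by (rule fourier_multiplication_formula[OF s1 gauss_span_integrable[OF g(1)], symmetric])
    also have "cmod \<dots> \<le> L2_norm (fourier_integral s) * L2_norm g"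
      by (rule L2_Cauchy_Schwarz(3)[OF sh gauss_span_L2[OF g(1)]])
    finally show "cmod (integral\<^sup>L lebesgue (\<lambda>x. s x * h x)) \<le> L2_norm (fourier_integral s) / ?k * L2_norm h"
      using fourier_gauss_span_norm[OF g(1)] k g(2) by simp
  qed (use k in simp)
  then show "?k * L2_norm s \<le> L2_norm (fourier_integral s)"
    using k by (simp add: field_simps)
qed

section \<open>The Fourier transform of square integrable functions\<close>

lemma fourier_L2_spaces:
  assumes "fourier_L2 f F"
  shows "f \<in> L2_space" "F \<in> L2_space"
  using assms by (auto simp: fourier_L2_def L2_tendsto_def)

theorem plancherel:
  fixes f :: "real ^ 'n \<Rightarrow> complex"
  assumes "fourier_L2 f F"
  shows "L2_norm F = gauss_const TYPE('n) * L2_norm f"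
proof -
  obtain s :: "nat \<Rightarrow> real ^ 'n \<Rightarrow> complex" where s: "\<And>n. integrable lebesgue (s n)" "L2_tendsto s f sequentially"
    "L2_tendsto (\<lambda>n. fourier_integral (s n)) F sequentially" using assms by (auto simp: fourier_L2_def)
  have eq: "L2_norm (fourier_integral (s n)) = gauss_const TYPE('n) * L2_norm (s n)" for n
    by (rule plancherel_integrable) (use s in \<open>auto simp: L2_tendsto_def\<close>)
  have "(\<lambda>n. gauss_const TYPE('n) * L2_norm (s n)) \<longlonglongrightarrow> gauss_const TYPE('n) * L2_norm f"
    by (intro tendsto_mult_left L2_tendsto_norm s)
  moreover have "(\<lambda>n. gauss_const TYPE('n) * L2_norm (s n)) \<longlonglongrightarrow> L2_norm F"
    using L2_tendsto_norm[OF s(3)] by (simp only: eq)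
  ultimately show ?thesis by (metis LIMSEQ_unique)
qed

lemma fourier_L2_add:
  assumes "fourier_L2 f F" "fourier_L2 g G"
  shows "fourier_L2 (\<lambda>x. f x + g x) (\<lambda>x. F x + G x)"
proof -
  obtain s where s: "\<And>n. integrable lebesgue (s n)" "L2_tendsto s f sequentially"
    "L2_tendsto (\<lambda>n. fourier_integral (s n)) F sequentially" using assms(1) by (auto simp: fourier_L2_def)
  obtain t where t: "\<And>n. integrable lebesgue (t n)" "L2_tendsto t g sequentially"
    "L2_tendsto (\<lambda>n. fourier_integral (t n)) G sequentially" using assms(2) by (auto simp: fourier_L2_def)
  have "(\<lambda>n. fourier_integral (\<lambda>x. s n x + t n x)) = (\<lambda>n \<omega>. fourier_integral (s n) \<omega> + fourier_integral (t n) \<omega>)"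
    by (intro ext fourier_integral_add s t)
  then have "L2_tendsto (\<lambda>n. fourier_integral (\<lambda>x. s n x + t n x)) (\<lambda>x. F x + G x) sequentially"
    by (simp only: L2_tendsto_add[OF s(3) t(3)])
  with L2_tendsto_add[OF s(2) t(2)] s(1) t(1) show ?thesis
    unfolding fourier_L2_def by (intro exI[of _ "\<lambda>n x. s n x + t n x"]) auto
qed

lemma fourier_L2_scale:
  assumes "fourier_L2 f F"
  shows "fourier_L2 (\<lambda>x. c * f x) (\<lambda>x. c * F x)"
proof -
  obtain s where s: "\<And>n. integrable lebesgue (s n)" "L2_tendsto s f sequentially"
    "L2_tendsto (\<lambda>n. fourier_integral (s n)) F sequentially" using assms(1) by (auto simp: fourier_L2_def)
  have "(\<lambda>n. fourier_integral (\<lambda>x. c * s n x)) = (\<lambda>n \<omega>. c * fourier_integral (s n) \<omega>)"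
    by (intro ext fourier_integral_scale)
  then have "L2_tendsto (\<lambda>n. fourier_integral (\<lambda>x. c * s n x)) (\<lambda>x. c * F x) sequentially"
    by (simp only: L2_tendsto_scale[OF s(3)])
  with L2_tendsto_scale[OF s(2)] s(1) show ?thesis
    unfolding fourier_L2_def by (intro exI[of _ "\<lambda>n x. c * s n x"]) auto
qed

lemma fourier_L2_diff:
  assumes "fourier_L2 f F" "fourier_L2 g G"
  shows "fourier_L2 (\<lambda>x. f x - g x) (\<lambda>x. F x - G x)"
  using fourier_L2_add[OF assms(1) fourier_L2_scale[OF assms(2), of "-1"]] by simp

lemma fourier_L2_zero: "fourier_L2 (\<lambda>x::real^'n. 0) (\<lambda>x. 0)"
proof -
  have "fourier_integral (\<lambda>x::real^'n. 0) = (\<lambda>x. 0)" by (simp add: fun_eq_iff fourier_integral_def)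
  then show ?thesis unfolding fourier_L2_def
    by (intro exI[of _ "\<lambda>n x. 0"]) (auto simp: L2_tendsto_def L2_zero)
qed

lemma fourier_L2_sum:
  "(\<And>i. i \<in> I \<Longrightarrow> fourier_L2 (f i) (F i)) \<Longrightarrow> fourier_L2 (\<lambda>x. \<Sum>i\<in>I. f i x) (\<lambda>x. \<Sum>i\<in>I. F i x)"
  by (induction I rule: infinite_finite_induct) (auto intro: fourier_L2_zero fourier_L2_add)

text \<open>Plancherel's identity for the difference gives both directions at once: the transform is
  well defined up to null sets, and it is injective.\<close>

lemma fourier_L2_inj:
  fixes f g :: "real ^ 'n \<Rightarrow> complex"
  assumes f: "fourier_L2 f F" and g: "fourier_L2 g G"
  shows "(AE x in lebesgue. f x = g x) \<longleftrightarrow> (AE x in lebesgue. F x = G x)"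
proof -
  have k: "gauss_const TYPE('n) > 0" by (rule gauss_const_pos)
  note S = fourier_L2_spaces[OF f] fourier_L2_spaces[OF g]
  have n: "L2_dist F G = gauss_const TYPE('n) * L2_dist f g"
    by (rule plancherel[OF fourier_L2_diff[OF f g]])
  have eq: "(AE x in lebesgue. p x = q x) \<longleftrightarrow> L2_dist p q = 0"
    if "p \<in> L2_space" "q \<in> L2_space" for p q :: "real ^ 'n \<Rightarrow> complex"
  proof
    assume *: "AE x in lebesgue. p x = q x"
    have "L2_norm (\<lambda>x::real^'n. 0) = L2_dist p q"
    proof (rule L2_norm_cong_AE)
      show "(\<lambda>x. p x - q x) \<in> borel_measurable lebesgue" by (rule L2_measurable[OF L2_diff[OF that]])
    qed (use * in auto)
    then show "L2_dist p q = 0" by simp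
  next
    assume "L2_dist p q = 0"
    from L2_norm_eq_0[OF L2_diff[OF that] this] show "AE x in lebesgue. p x = q x" by simp
  qed
  show ?thesis using n k S by (simp add: eq)
qed

lemma L2_space_gauss_sequence:
  fixes f :: "real ^ 'n \<Rightarrow> complex"
  assumes f: "f \<in> L2_space"
  shows "\<exists>s :: nat \<Rightarrow> real ^ 'n \<Rightarrow> complex. (\<forall>n. s n \<in> gauss_span) \<and> L2_tendsto s f sequentially"
proof -
  have "\<exists>g\<in>gauss_span. L2_dist g f < e" if "e > 0" for e
    using gauss_span_dense[OF f that] L2_norm_minus_commute[of f] by (metis (no_types))
  from L2_tendsto_sequence[OF f _ this] show ?thesis
    using gauss_span_L2 by (metis range_subsetD subsetI)
qed

text \<open>Sequences whose mutual distances agree up to a constant factor are Cauchy together. The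
  lemma carries convergence from functions to transforms and, with the reciprocal factor,
  back.\<close>

lemma L2_tendsto_similar:
  fixes f :: "real ^ 'n \<Rightarrow> complex"
  assumes lim: "L2_tendsto s f sequentially" and t: "\<And>n. t n \<in> L2_space" and k: "k > 0"
    and d: "\<And>m n. L2_dist (t m) (t n) = k * L2_dist (s m) (s n)"
  shows "\<exists>g. L2_tendsto t g sequentially"
proof (rule L2_complete[OF t])
  fix e :: real assume "e > 0"
  have S: "s n \<in> L2_space" "f \<in> L2_space" for n using lim by (auto simp: L2_tendsto_def)
  have "(\<lambda>n. L2_dist (s n) f) \<longlonglongrightarrow> 0" using lim by (simp add: L2_tendsto_def)
  then have "\<forall>\<^sub>F n in sequentially. L2_dist (s n) f < e / (2 * k)"
    using \<open>e > 0\<close> k by (intro order_tendstoD(2)) auto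
  then obtain N where N: "\<And>n. n \<ge> N \<Longrightarrow> L2_dist (s n) f < e / (2 * k)"
    by (auto simp: eventually_sequentially)
  have "L2_dist (t m) (t n) < e" if "m \<ge> N" "n \<ge> N" for m n
  proof -
    have "L2_dist (s m) (s n) < e / (2 * k) + e / (2 * k)"
      using L2_norm_triangle3[OF S(1) S(2) S(1), of m n] N[OF that(1)] N[OF that(2)]
        L2_norm_minus_commute[of f "s n"] by linarith
    then show ?thesis unfolding d using k by (simp add: field_simps)
  qed
  then show "\<exists>N. \<forall>m\<ge>N. \<forall>n\<ge>N. L2_dist (t m) (t n) < e" by (intro exI[of _ N] allI impI)
qed

theorem fourier_L2_exists:
  fixes f :: "real ^ 'n \<Rightarrow> complex"
  assumes f: "f \<in> L2_space"
  shows "\<exists>F. fourier_L2 f F"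
proof -
  obtain s :: "nat \<Rightarrow> real ^ 'n \<Rightarrow> complex" where s: "\<And>n. s n \<in> gauss_span" "L2_tendsto s f sequentially"
    using L2_space_gauss_sequence[OF f] by auto
  have "\<exists>F. L2_tendsto (\<lambda>n. fourier_integral (s n)) F sequentially"
    by (rule L2_tendsto_similar[OF s(2) _ gauss_const_pos fourier_gauss_span_norm_diff])
       (intro gauss_span_L2 gauss_span_fourier s)+
  with s show ?thesis unfolding fourier_L2_def using gauss_span_integrable by blast
qed

theorem fourier_L2_surj:
  fixes F :: "real ^ 'n \<Rightarrow> complex"
  assumes F: "F \<in> L2_space"
  shows "\<exists>f. fourier_L2 f F"
proof -
  obtain S :: "nat \<Rightarrow> real ^ 'n \<Rightarrow> complex" where S: "\<And>n. S n \<in> gauss_span" "L2_tendsto S F sequentially"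
    using L2_space_gauss_sequence[OF F] by auto
  let ?k = "gauss_const TYPE('n)"
  have k: "?k > 0" by (rule gauss_const_pos)
  have "\<forall>n. \<exists>g. g \<in> gauss_span \<and> fourier_integral g = S n"
    using gauss_span_fourier_surj[OF S(1)] by metis
  from choice[OF this] obtain s where s: "\<And>n. s n \<in> gauss_span" "\<And>n. fourier_integral (s n) = S n" by auto
  have d: "L2_dist (s m) (s n) = 1 / ?k * L2_dist (S m) (S n)" for m n
    using fourier_gauss_span_norm_diff[OF s(1) s(1), of m n] k unfolding s(2) by simp
  obtain f where f: "L2_tendsto s f sequentially"
    using L2_tendsto_similar[OF S(2) gauss_span_L2[OF s(1)] _ d] k by auto
  show ?thesis unfolding fourier_L2_def
    by (intro exI[of _ f] exI[of _ s] conjI allI gauss_span_integrable s(1) f) (simp add: s(2) S(2))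
qed

lemma cis_inner_measurable: "(\<lambda>x::real^'n. cis (- (t \<bullet> x))) \<in> borel_measurable lebesgue"
proof -
  have "(\<lambda>x::real^'n. cis (- (t \<bullet> x))) \<in> borel_measurable borel"
    by (auto intro!: borel_measurable_continuous_onI continuous_intros)
  then show ?thesis by (simp add: measurable_completion)
qed

lemma fourier_integral_shift:
  assumes "integrable lebesgue s"
  shows "fourier_integral (\<lambda>x. s (x - t)) \<omega> = cis (- (t \<bullet> \<omega>)) * fourier_integral s \<omega>"
proof -
  have i: "integrable lebesgue (\<lambda>x. s (x - t))"
    using integrable_lebesgue_shift[OF assms, of "- t"] by simp
  have m: "(\<lambda>x. s (x - t) * cis (- (x \<bullet> \<omega>))) \<in> borel_measurable lebesgue"
    using fourier_integrable[OF i] by auto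
  have "fourier_integral (\<lambda>x. s (x - t)) \<omega> = integral\<^sup>L lebesgue (\<lambda>x. s (x + t - t) * cis (- ((x + t) \<bullet> \<omega>)))"
    unfolding fourier_integral_cis by (rule integral_lebesgue_shift[OF m, symmetric])
  also have "\<dots> = integral\<^sup>L lebesgue (\<lambda>x. cis (- (t \<bullet> \<omega>)) * (s x * cis (- (x \<bullet> \<omega>))))"
    by (rule Bochner_Integration.integral_cong) (auto simp: inner_add_left cis_mult algebra_simps)
  also have "\<dots> = cis (- (t \<bullet> \<omega>)) * fourier_integral s \<omega>"
    by (simp add: fourier_integral_cis)
  finally show ?thesis .
qed

lemma fourier_L2_shift:
  assumes "fourier_L2 f F"
  shows "fourier_L2 (\<lambda>x. f (x - t)) (\<lambda>\<omega>. cis (- (t \<bullet> \<omega>)) * F \<omega>)"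
proof -
  obtain s where s: "\<And>n. integrable lebesgue (s n)" "L2_tendsto s f sequentially"
    "L2_tendsto (\<lambda>n. fourier_integral (s n)) F sequentially" using assms(1) by (auto simp: fourier_L2_def)
  have "(\<lambda>n. fourier_integral (\<lambda>x. s n (x - t))) = (\<lambda>n \<omega>. cis (- (t \<bullet> \<omega>)) * fourier_integral (s n) \<omega>)"
    by (intro ext fourier_integral_shift s)
  moreover have "L2_tendsto (\<lambda>n \<omega>. cis (- (t \<bullet> \<omega>)) * fourier_integral (s n) \<omega>) (\<lambda>\<omega>. cis (- (t \<bullet> \<omega>)) * F \<omega>) sequentially"
    by (rule L2_tendsto_mult[OF s(3) cis_inner_measurable, where C=1]) simp
  ultimately have "L2_tendsto (\<lambda>n. fourier_integral (\<lambda>x. s n (x - t))) (\<lambda>\<omega>. cis (- (t \<bullet> \<omega>)) * F \<omega>) sequentially"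
    by simp
  moreover have "L2_tendsto (\<lambda>n x. s n (x - t)) (\<lambda>x. f (x - t)) sequentially"
    using L2_tendsto_shift[OF s(2), of "- t"] by simp
  moreover have "integrable lebesgue (\<lambda>x. s n (x - t))" for n
    using integrable_lebesgue_shift[OF s(1), of n "- t"] by simp
  ultimately show ?thesis unfolding fourier_L2_def by (intro exI[of _ "\<lambda>n x. s n (x - t)"] conjI allI)
qed

text \<open>By Plancherel the distances from partial sums to limits on the two sides have a fixed
  positive ratio, so expansions may be computed on the Fourier side with the same
  coefficients.\<close>

lemma fourier_L2_has_sum_iff:
  fixes f :: "real ^ 'n \<Rightarrow> complex"
  assumes u: "\<And>k. fourier_L2 (u k) (U k)" and f: "fourier_L2 f F"
  shows "L2_has_sum (\<lambda>k x. c k * u k x) f \<longleftrightarrow> L2_has_sum (\<lambda>k x. c k * U k x) F"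
proof -
  have k: "gauss_const TYPE('n) > 0" by (rule gauss_const_pos)
  have FS: "fourier_L2 (\<lambda>x. \<Sum>k\<in>K. c k * u k x) (\<lambda>x. \<Sum>k\<in>K. c k * U k x)" for K
    by (intro fourier_L2_sum fourier_L2_scale u)
  have "((\<lambda>K. gauss_const TYPE('n) * L2_norm (\<lambda>x. (\<Sum>k\<in>K. c k * u k x) - f x)) \<longlongrightarrow> 0) (finite_subsets_at_top UNIV)
    \<longleftrightarrow> ((\<lambda>K. L2_norm (\<lambda>x. (\<Sum>k\<in>K. c k * u k x) - f x)) \<longlongrightarrow> 0) (finite_subsets_at_top UNIV)"
    using tendsto_mult_left_iff[of "gauss_const TYPE('n)" _ 0] k by simp
  then show ?thesis
    unfolding L2_has_sum_def L2_tendsto_def plancherel[OF fourier_L2_diff[OF FS f]]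
    using fourier_L2_spaces[OF FS] fourier_L2_spaces[OF f] by blast
qed

section \<open>Linear substitutions and unfolding over the integer lattice\<close>

lemma nn_integral_lborel_shift:
  fixes t :: "'a::euclidean_space"
  assumes [measurable]: "f \<in> borel_measurable borel"
  shows "(\<integral>\<^sup>+x. f (x + t) \<partial>lborel) = (\<integral>\<^sup>+x. f x \<partial>lborel)"
proof -
  have "f \<in> borel_measurable lebesgue" using assms by (simp add: measurable_completion)
  from nn_integral_lebesgue_shift[OF this, of t] show ?thesis by (simp add: nn_integral_completion)
qed

lemma nn_integral_lborel_reflect:
  fixes t :: "'a::euclidean_space"
  assumes [measurable]: "f \<in> borel_measurable borel"
  shows "(\<integral>\<^sup>+x. f (t - x) \<partial>lborel) = (\<integral>\<^sup>+x. f x \<partial>lborel)"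
proof -
  have T: "(\<lambda>x. t + (\<Sum>j\<in>Basis. (-1 * (x \<bullet> j)) *\<^sub>R j)) = (\<lambda>x::'a. t - x)"
    by (simp add: euclidean_representation sum_negf)
  have m: "(\<lambda>x. t - x) \<in> lborel \<rightarrow>\<^sub>M borel" by measurable
  have "lborel = density (distr lborel borel (\<lambda>x. t - x)) (\<lambda>_. (\<Prod>j\<in>(Basis::'a set). \<bar>-1::real\<bar>))"
    using lborel_affine_euclidean[of "\<lambda>_. -1" t] unfolding T by simp
  then have "lborel = distr lborel borel (\<lambda>x. t - x)" by (simp add: density_1)
  then have "(\<integral>\<^sup>+x. f x \<partial>lborel) = (\<integral>\<^sup>+x. f x \<partial>distr lborel borel (\<lambda>x. t - x))" by simp
  also have "\<dots> = (\<integral>\<^sup>+x. f (t - x) \<partial>lborel)" by (rule nn_integral_distr[OF m]) measurable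
  finally show ?thesis by simp
qed

text \<open>
  Uniqueness of translation invariant measures, applied to the image of Lebesgue measure under
  \<open>T\<close>, avoids determinants (the library's linear change of variables needs a well-ordered index type).
\<close>

lemma nn_integral_lborel_linear:
  fixes T :: "'a::euclidean_space \<Rightarrow> 'a"
  assumes T: "linear T" and S: "linear S" and TS: "\<And>x. T (S x) = x" and ST: "\<And>x. S (T x) = x"
  obtains c :: real where "c > 0"
    "\<And>f. f \<in> borel_measurable borel \<Longrightarrow> (\<integral>\<^sup>+x. f (T x) \<partial>lborel) = ennreal c * (\<integral>\<^sup>+x. f x \<partial>lborel)"
proof -
  have Tc: "continuous_on UNIV T"
    using T by (auto intro: linear_continuous_on linear_conv_bounded_linear[THEN iffD1])
  have Tm[measurable]: "T \<in> borel \<rightarrow>\<^sub>M borel" using Tc by (rule borel_measurable_continuous_onI)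
  define g :: "'a \<Rightarrow> ennreal" where "g = indicator (box 0 One)"
  have gm[measurable]: "g \<in> borel_measurable borel" by (simp add: g_def)
  have g1: "(\<integral>\<^sup>+x. g x \<partial>lborel) = 1" by (simp add: g_def emeasure_lborel_box_eq)
  define C where "C = (\<integral>\<^sup>+x. g (T x) \<partial>lborel)"
  have eq: "(\<integral>\<^sup>+x. f (T x) \<partial>lborel) = C * (\<integral>\<^sup>+x. f x \<partial>lborel)" if fm[measurable]: "f \<in> borel_measurable borel" for f
  proof -
    \<comment> \<open>A factor 1 is inserted, the integral over \<open>y\<close> of
      \<open>g (y + T x)\<close>. After exchanging the integrals, the shift of \<open>x\<close> by
      \<open>S (- y)\<close> moves the dependence on \<open>y\<close> from \<open>g\<close> to
      \<open>f\<close>.\<close>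
    have "(\<integral>\<^sup>+x. f (T x) \<partial>lborel) = (\<integral>\<^sup>+x. f (T x) * (\<integral>\<^sup>+y. g (y + T x) \<partial>lborel) \<partial>lborel)"
      using g1 by (simp add: nn_integral_lborel_shift)
    also have "\<dots> = (\<integral>\<^sup>+x. \<integral>\<^sup>+y. f (T x) * g (y + T x) \<partial>lborel \<partial>lborel)"
      by (simp add: nn_integral_cmult)
    also have "\<dots> = (\<integral>\<^sup>+y. \<integral>\<^sup>+x. f (T x) * g (y + T x) \<partial>lborel \<partial>lborel)"
      by (rule lborel_pair.Fubini') measurable
    also have "\<dots> = (\<integral>\<^sup>+y. \<integral>\<^sup>+x. f (T x - y) * g (T x) \<partial>lborel \<partial>lborel)"
    proof (rule nn_integral_cong)
      fix y
      have "(\<integral>\<^sup>+x. f (T x) * g (y + T x) \<partial>lborel) = (\<integral>\<^sup>+x. f (T (x + S (- y))) * g (y + T (x + S (- y))) \<partial>lborel)"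
        by (rule nn_integral_lborel_shift[symmetric]) measurable
      then show "(\<integral>\<^sup>+x. f (T x) * g (y + T x) \<partial>lborel) = (\<integral>\<^sup>+x. f (T x - y) * g (T x) \<partial>lborel)"
        by (simp add: linear_add[OF T] TS)
    qed
    also have "\<dots> = (\<integral>\<^sup>+x. \<integral>\<^sup>+y. f (T x - y) * g (T x) \<partial>lborel \<partial>lborel)"
      by (rule lborel_pair.Fubini') measurable
    also have "\<dots> = (\<integral>\<^sup>+x. (\<integral>\<^sup>+y. f y \<partial>lborel) * g (T x) \<partial>lborel)"
      by (simp add: nn_integral_multc nn_integral_lborel_reflect)
    also have "\<dots> = C * (\<integral>\<^sup>+x. f x \<partial>lborel)"
      by (simp add: nn_integral_cmult C_def mult.commute)
    finally show ?thesis .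
  qed
  \<comment> \<open>\<open>C\<close> is the measure of a preimage that is bounded, hence of finite
    measure, and open and nonempty, hence of positive measure.\<close>
  have CT: "C = emeasure lborel (T -` box 0 One)"
  proof -
    have s: "T -` box 0 One \<in> sets lborel"
      using measurable_sets[OF Tm, of "box 0 One"] by simp
    have "g (T x) = indicator (T -` box 0 One) x" for x by (simp add: g_def indicator_def)
    then show ?thesis using s by (simp add: C_def)
  qed
  have "T -` box 0 One = S ` box 0 One"
  proof safe
    fix x assume "T x \<in> box 0 One"
    then have "S (T x) \<in> S ` box 0 One" by (rule imageI)
    then show "x \<in> S ` box 0 One" by (simp only: ST)
  qed (simp add: TS)
  moreover have "bounded (S ` box 0 One)"
    by (rule bounded_linear_image[OF bounded_box]) (use S in \<open>simp add: linear_conv_bounded_linear\<close>)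
  ultimately have "C < \<infinity>" unfolding CT using emeasure_bounded_finite by metis
  moreover have "C \<noteq> 0"
  proof
    assume "C = 0"
    have o: "open (T -` box 0 One)" by (rule open_vimage[OF open_box Tc])
    moreover have "S ((1/2) *\<^sub>R One) \<in> T -` box 0 One" by (simp add: TS mem_box)
    ultimately have "\<not> negligible (T -` box 0 One)" by (intro open_not_negligible) auto
    moreover have "T -` box 0 One \<in> null_sets lborel"
      using \<open>C = 0\<close> borel_open[OF o] unfolding CT by (intro null_setsI) auto
    ultimately show False using negligible_iff_null_sets null_sets_completionI by blast
  qed
  ultimately obtain c where c: "C = ennreal c" "c > 0"
    by (cases C) (auto simp: less_le)
  show ?thesis using eq c by (intro that[of c]) auto
qed

text \<open>The substitution formula for indicators shows that preimages of Borel null sets are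
  null, which extends measurability and almost everywhere statements to the completion.\<close>

lemma nn_integral_lebesgue_linear:
  fixes T :: "'a::euclidean_space \<Rightarrow> 'a"
  assumes T: "linear T" and S: "linear S" and TS: "\<And>x. T (S x) = x" and ST: "\<And>x. S (T x) = x"
  shows "T \<in> lebesgue \<rightarrow>\<^sub>M lebesgue"
    "\<And>P. AE x in lebesgue. P x \<Longrightarrow> AE x in lebesgue. P (T x)"
    "\<exists>c::real. c > 0 \<and> (\<forall>f\<in>borel_measurable lebesgue.
        (\<integral>\<^sup>+x. f (T x) \<partial>lebesgue) = ennreal c * (\<integral>\<^sup>+x. f x \<partial>lebesgue))"
proof -
  obtain c :: real where c: "c > 0"
    "\<And>f. f \<in> borel_measurable borel \<Longrightarrow> (\<integral>\<^sup>+x. f (T x) \<partial>lborel) = ennreal c * (\<integral>\<^sup>+x. f x \<partial>lborel)"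
    by (rule nn_integral_lborel_linear[OF assms]) auto
  have "continuous_on UNIV T"
    using T by (auto intro: linear_continuous_on linear_conv_bounded_linear[THEN iffD1])
  then have Tm[measurable]: "T \<in> borel \<rightarrow>\<^sub>M borel" by (rule borel_measurable_continuous_onI)
  have null: "T -` A \<in> null_sets lborel" if A: "A \<in> null_sets lborel" for A
  proof -
    have As: "A \<in> sets borel" using A by auto
    then have s: "T -` A \<in> sets borel" using measurable_sets[OF Tm As] by simp
    have "emeasure lborel (T -` A) = (\<integral>\<^sup>+x. indicator A (T x) \<partial>lborel)"
      using s by (simp add: nn_integral_indicator[symmetric] indicator_def del: nn_integral_indicator)
    also have "\<dots> = ennreal c * emeasure lborel A" using As by (subst c(2)) auto
    also have "\<dots> = 0" using A by auto
    finally show ?thesis using s by (intro null_setsI) auto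
  qed
  show TL: "T \<in> lebesgue \<rightarrow>\<^sub>M lebesgue"
  proof (rule completion.measurable_completion2)
    show m: "T \<in> lebesgue \<rightarrow>\<^sub>M lborel" using Tm by (simp add: measurable_completion)
    show "null_sets lborel \<subseteq> null_sets (distr lebesgue lborel T)"
    proof
      fix A :: "'a set" assume A: "A \<in> null_sets lborel"
      then have "T -` A \<in> null_sets lebesgue" using null by (intro null_sets_completionI)
      then show "A \<in> null_sets (distr lebesgue lborel T)"
        using null_setsD2[OF A] m by (simp add: null_sets_distr_iff)
    qed
  qed
  show AE: "AE x in lebesgue. P (T x)" if "AE x in lebesgue. P x" for P
  proof -
    from that obtain N where N: "N \<in> null_sets lborel" "{x. \<not> P x} \<subseteq> N"
      unfolding AE_completion_iff by (auto simp: eventually_ae_filter)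
    have "T -` N \<in> null_sets lebesgue" using null[OF N(1)] by (rule null_sets_completionI)
    then show ?thesis by (rule AE_I') (use N(2) in auto)
  qed
  show "\<exists>c::real. c > 0 \<and> (\<forall>f\<in>borel_measurable lebesgue.
        (\<integral>\<^sup>+x. f (T x) \<partial>lebesgue) = ennreal c * (\<integral>\<^sup>+x. f x \<partial>lebesgue))"
  proof (intro exI[of _ c] conjI ballI c(1))
    fix f :: "'a \<Rightarrow> ennreal" assume f: "f \<in> borel_measurable lebesgue"
    then obtain g where g: "g \<in> borel_measurable lborel" "AE x in lborel. f x = g x"
      using completion_ex_borel_measurable by blast
    have ae: "AE x in lebesgue. f x = g x" using g(2) by (rule AE_completion)
    have "(\<integral>\<^sup>+x. f (T x) \<partial>lebesgue) = (\<integral>\<^sup>+x. g (T x) \<partial>lebesgue)"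
      by (rule nn_integral_cong_AE) (rule AE[OF ae])
    also have "\<dots> = ennreal c * (\<integral>\<^sup>+x. g x \<partial>lebesgue)"
      using g(1) by (simp add: nn_integral_completion c(2))
    also have "(\<integral>\<^sup>+x. g x \<partial>lebesgue) = (\<integral>\<^sup>+x. f x \<partial>lebesgue)"
      by (rule nn_integral_cong_AE) (use ae in auto)
    finally show "(\<integral>\<^sup>+x. f (T x) \<partial>lebesgue) = ennreal c * (\<integral>\<^sup>+x. f x \<partial>lebesgue)" .
  qed
qed

lemma L2_linear:
  fixes T :: "real ^ 'n \<Rightarrow> real ^ 'n"
  assumes T: "linear T" "linear S" "\<And>x. T (S x) = x" "\<And>x. S (T x) = x"
  obtains c where "c > 0" "\<And>f. f \<in> L2_space \<Longrightarrow> (\<lambda>x. f (T x)) \<in> L2_space \<and> L2_norm (\<lambda>x. f (T x)) = c * L2_norm f"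
proof -
  obtain c :: real where c: "c > 0" "\<And>f. f \<in> borel_measurable lebesgue \<Longrightarrow>
      (\<integral>\<^sup>+x. f (T x) \<partial>lebesgue) = ennreal c * (\<integral>\<^sup>+x. f x \<partial>lebesgue)"
    using nn_integral_lebesgue_linear(3)[OF T] by auto
  have "(\<lambda>x. f (T x)) \<in> L2_space \<and> L2_norm (\<lambda>x. f (T x)) = sqrt c * L2_norm f" if f: "f \<in> L2_space" for f
  proof -
    have fm[measurable]: "f \<in> borel_measurable lebesgue" using f by (rule L2_measurable)
    have m: "(\<lambda>x. ennreal ((cmod (f x))\<^sup>2)) \<in> borel_measurable lebesgue" by measurable
    have eq: "(\<integral>\<^sup>+x. ennreal ((cmod (f (T x)))\<^sup>2) \<partial>lebesgue) = ennreal (c * (L2_norm f)\<^sup>2)"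
      using c(2)[OF m] c(1) L2_norm_sq_ennreal[OF f] by (simp add: ennreal_mult)
    have fT: "(\<lambda>x. f (T x)) \<in> L2_space"
      unfolding L2_space_iff
      using measurable_compose[OF nn_integral_lebesgue_linear(1)[OF T] fm] eq by simp
    have "ennreal ((L2_norm (\<lambda>x. f (T x)))\<^sup>2) = ennreal (c * (L2_norm f)\<^sup>2)"
      using L2_norm_sq_ennreal[OF fT] eq by simp
    then have "(L2_norm (\<lambda>x. f (T x)))\<^sup>2 = (sqrt c * L2_norm f)\<^sup>2"
      using c(1) by (subst (asm) ennreal_inj) (auto simp: power_mult_distrib)
    then have "L2_norm (\<lambda>x. f (T x)) = sqrt c * L2_norm f"
      by (rule power2_eq_imp_eq) (use c(1) in auto)
    with fT show ?thesis by simp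
  qed
  then show ?thesis using c(1) by (intro that[of "sqrt c"]) auto
qed

lemma L2_has_sum_linear:
  fixes T :: "real ^ 'n \<Rightarrow> real ^ 'n"
  assumes T: "linear T" "linear S" "\<And>x. T (S x) = x" "\<And>x. S (T x) = x"
    and u: "\<And>k. u k \<in> L2_space" and f: "f \<in> L2_space"
  shows "L2_has_sum (\<lambda>k x. u k (T x)) (\<lambda>x. f (T x)) \<longleftrightarrow> L2_has_sum u f"
proof -
  obtain c where c: "c > 0" "\<And>f. f \<in> L2_space \<Longrightarrow> (\<lambda>x. f (T x)) \<in> L2_space \<and> L2_norm (\<lambda>x. f (T x)) = c * L2_norm f"
    by (rule L2_linear[OF T]) auto
  have s: "(\<lambda>x. \<Sum>k\<in>K. u k x) \<in> L2_space" for K by (intro L2_sum u)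
  have n: "L2_norm (\<lambda>x. (\<Sum>k\<in>K. u k (T x)) - f (T x)) = c * L2_norm (\<lambda>x. (\<Sum>k\<in>K. u k x) - f x)" for K
    using c(2)[OF L2_diff[OF s f]] by simp
  have s': "(\<lambda>x. \<Sum>k\<in>K. u k (T x)) \<in> L2_space" for K using c(2)[OF s] by simp
  show ?thesis
    unfolding L2_has_sum_def L2_tendsto_def n
    using c(2)[OF f] s s' f tendsto_mult_left_iff[of c _ 0] c(1) by simp
qed

text \<open>The cell is half open so that its integer translates cover every point exactly
  once.\<close>

definition unit_cell :: "(real ^ 'n) set" where
  "unit_cell = {x. \<forall>i. 0 \<le> x $ i \<and> x $ i < 1}"

lemma unit_cell_borel [measurable]: "(unit_cell :: (real^'n) set) \<in> sets borel"
proof -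
  have "unit_cell = (\<Inter>i. {x :: real^'n. 0 \<le> x $ i} \<inter> {x. x $ i < 1})" by (auto simp: unit_cell_def)
  also have "\<dots> \<in> sets borel"
    by (intro sets.countable_INT'' sets.Int) (auto intro!: borel_closed borel_open closed_Collect_le open_Collect_less continuous_intros)
  finally show ?thesis .
qed

lemma unit_cell_lebesgue [measurable]: "(unit_cell :: (real^'n) set) \<in> sets lebesgue"
  using unit_cell_borel by (simp add: sets_completionI_sets)

lemma add_real_vec_unit_cell_iff: "x + real_vec k \<in> unit_cell \<longleftrightarrow> k = (\<chi> i. - \<lfloor>x $ i\<rfloor>)"
proof
  assume *: "x + real_vec k \<in> unit_cell"
  have "k $ i = - \<lfloor>x $ i\<rfloor>" for i
  proof -
    have "0 \<le> x $ i + real_of_int (k $ i)" "x $ i + real_of_int (k $ i) < 1"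
      using * by (auto simp: unit_cell_def real_vec_def)
    then have "\<lfloor>x $ i\<rfloor> = - k $ i" by (intro floor_unique) auto
    then show ?thesis by simp
  qed
  then show "k = (\<chi> i. - \<lfloor>x $ i\<rfloor>)" by (simp add: vec_eq_iff)
next
  assume "k = (\<chi> i. - \<lfloor>x $ i\<rfloor>)"
  then show "x + real_vec k \<in> unit_cell"
    by (auto simp: unit_cell_def real_vec_def) linarith
qed

text \<open>The indicators of the integer translates of the cell add up to 1. This sum is inserted,
  exchanged with the integral, and each term is translated back; nonnegativity justifies the
  exchanges.\<close>

lemma nn_integral_unfold:
  fixes h :: "real ^ 'n \<Rightarrow> ennreal"
  assumes h[measurable]: "h \<in> borel_measurable lebesgue"
  shows "(\<integral>\<^sup>+x. h x \<partial>lebesgue)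
    = (\<integral>\<^sup>+x. indicator unit_cell x * (\<integral>\<^sup>+k. h (x + real_vec k) \<partial>count_space UNIV) \<partial>lebesgue)"
proof -
  have one: "(\<integral>\<^sup>+k. indicator unit_cell (x + real_vec k) \<partial>count_space UNIV) = (1::ennreal)" for x :: "real^'n"
  proof -
    have "indicator unit_cell (x + real_vec k) = (indicator {(\<chi> i. - \<lfloor>x $ i\<rfloor>)} k :: ennreal)" for k
      using add_real_vec_unit_cell_iff[of x k] by (simp add: indicator_def)
    then show ?thesis by (simp add: one_ennreal_def)
  qed
  have sh[measurable]: "(\<lambda>x. h (x + t)) \<in> borel_measurable lebesgue"
    "(\<lambda>x. indicator unit_cell (x + t) :: ennreal) \<in> borel_measurable lebesgue" for t
    by (intro lebesgue_shift_measurable h) (intro lebesgue_shift_measurable borel_measurable_indicator unit_cell_lebesgue)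
  have "(\<integral>\<^sup>+x. h x \<partial>lebesgue) = (\<integral>\<^sup>+x. h x * (\<integral>\<^sup>+k. indicator unit_cell (x + real_vec k) \<partial>count_space UNIV) \<partial>lebesgue)"
    by (simp add: one)
  also have "\<dots> = (\<integral>\<^sup>+x. \<integral>\<^sup>+k. h x * indicator unit_cell (x + real_vec k) \<partial>count_space UNIV \<partial>lebesgue)"
    by (subst nn_integral_cmult) auto
  also have "\<dots> = (\<integral>\<^sup>+k. \<integral>\<^sup>+x. h x * indicator unit_cell (x + real_vec k) \<partial>lebesgue \<partial>count_space UNIV)"
    by (rule nn_integral_count_space_nn_integral) auto
  also have "\<dots> = (\<integral>\<^sup>+k. \<integral>\<^sup>+x. h (x + real_vec (- k)) * indicator unit_cell x \<partial>lebesgue \<partial>count_space UNIV)"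
  proof (rule nn_integral_cong)
    fix k :: "int^'n"
    have m: "(\<lambda>x. h x * indicator unit_cell (x + real_vec k)) \<in> borel_measurable lebesgue" by measurable
    show "(\<integral>\<^sup>+x. h x * indicator unit_cell (x + real_vec k) \<partial>lebesgue)
        = (\<integral>\<^sup>+x. h (x + real_vec (- k)) * indicator unit_cell x \<partial>lebesgue)"
      using nn_integral_lebesgue_shift[OF m, of "real_vec (- k)"] by simp
  qed
  also have "\<dots> = (\<integral>\<^sup>+k. \<integral>\<^sup>+x. h (x + real_vec k) * indicator unit_cell x \<partial>lebesgue \<partial>count_space UNIV)"
    by (rule nn_integral_bij_count_space[of uminus UNIV UNIV "\<lambda>k. \<integral>\<^sup>+x. h (x + real_vec k) * indicator unit_cell x \<partial>lebesgue"])
       (rule bij_uminus)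
  also have "\<dots> = (\<integral>\<^sup>+x. \<integral>\<^sup>+k. h (x + real_vec k) * indicator unit_cell x \<partial>count_space UNIV \<partial>lebesgue)"
    by (rule nn_integral_count_space_nn_integral[symmetric]) auto
  also have "\<dots> = (\<integral>\<^sup>+x. indicator unit_cell x * (\<integral>\<^sup>+k. h (x + real_vec k) \<partial>count_space UNIV) \<partial>lebesgue)"
    by (subst nn_integral_multc) (auto simp: mult.commute)
  finally show ?thesis .
qed

section \<open>Fourier series on the unit cell\<close>

definition L2_inner :: "(real ^ 'n \<Rightarrow> complex) \<Rightarrow> (real ^ 'n \<Rightarrow> complex) \<Rightarrow> complex" where
  "L2_inner f g = integral\<^sup>L lebesgue (\<lambda>x. f x * cnj (g x))"

lemma L2_inner_integrable:
  "f \<in> L2_space \<Longrightarrow> g \<in> L2_space \<Longrightarrow> integrable lebesgue (\<lambda>x. f x * cnj (g x))"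
  by (rule L2_Cauchy_Schwarz(1)[OF _ L2_cnj])

lemma L2_inner_diff:
  "f \<in> L2_space \<Longrightarrow> g \<in> L2_space \<Longrightarrow> h \<in> L2_space \<Longrightarrow>
     L2_inner (\<lambda>x. f x - g x) h = L2_inner f h - L2_inner g h"
  by (simp add: L2_inner_def left_diff_distrib L2_inner_integrable)

lemma L2_inner_scale: "L2_inner (\<lambda>x. c * f x) g = c * L2_inner f g"
  by (simp add: L2_inner_def mult.assoc)

lemma L2_inner_zero: "L2_inner (\<lambda>x. 0) g = 0"
  by (simp add: L2_inner_def)

lemma L2_inner_add:
  "f \<in> L2_space \<Longrightarrow> g \<in> L2_space \<Longrightarrow> h \<in> L2_space \<Longrightarrow>
     L2_inner (\<lambda>x. f x + g x) h = L2_inner f h + L2_inner g h"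
  by (simp add: L2_inner_def distrib_right L2_inner_integrable)

lemma L2_inner_sum:
  assumes "\<And>i. i \<in> I \<Longrightarrow> f i \<in> L2_space" "g \<in> L2_space"
  shows "L2_inner (\<lambda>x. \<Sum>i\<in>I. f i x) g = (\<Sum>i\<in>I. L2_inner (f i) g)"
  using assms
  by (induction I rule: infinite_finite_induct) (auto simp: L2_inner_zero L2_inner_add L2_sum)

lemma L2_inner_commute: "L2_inner g f = cnj (L2_inner f g)"
  unfolding L2_inner_def by (simp add: Bochner_Integration.integral_cnj[symmetric] mult.commute)

lemma L2_norm_sq_inner: "f \<in> L2_space \<Longrightarrow> complex_of_real ((L2_norm f)\<^sup>2) = L2_inner f f"
  by (simp add: L2_inner_def integral_mult_cnj)

section \<open>Orthonormal systems\<close>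

lemma L2_norm_sq_diff:
  assumes f: "f \<in> L2_space" and u: "u \<in> L2_space"
  shows "(L2_norm (\<lambda>x. f x - a * u x))\<^sup>2 = (L2_norm f)\<^sup>2 - 2 * Re (cnj a * L2_inner f u) + (cmod a)\<^sup>2 * (L2_norm u)\<^sup>2"
proof -
  have au: "(\<lambda>x. a * u x) \<in> L2_space" by (rule L2_scale[OF u])
  have d: "(\<lambda>x. f x - a * u x) \<in> L2_space" by (rule L2_diff[OF f au])
  have r: "L2_inner h (\<lambda>x. f x - a * u x) = L2_inner h f - cnj a * L2_inner h u" if "h \<in> L2_space" for h
    using that by (subst (1 2 3) L2_inner_commute) (simp add: L2_inner_diff[OF f au that] L2_inner_scale)
  have "complex_of_real ((L2_norm (\<lambda>x. f x - a * u x))\<^sup>2)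
     = L2_inner f f - cnj a * L2_inner f u - a * (L2_inner u f - cnj a * L2_inner u u)"
    unfolding L2_norm_sq_inner[OF d] r[OF d] L2_inner_diff[OF f au f] L2_inner_diff[OF f au u] L2_inner_scale
    by (simp add: algebra_simps)
  also have "\<dots> = complex_of_real ((L2_norm f)\<^sup>2) - (cnj a * L2_inner f u + cnj (cnj a * L2_inner f u))
      + complex_of_real ((cmod a)\<^sup>2) * complex_of_real ((L2_norm u)\<^sup>2)"
    unfolding L2_norm_sq_inner[OF f] L2_norm_sq_inner[OF u] complex_norm_square L2_inner_commute[of u f]
    by (simp add: algebra_simps)
  also have "cnj a * L2_inner f u + cnj (cnj a * L2_inner f u) = complex_of_real (2 * Re (cnj a * L2_inner f u))"
    by (rule complex_add_cnj)
  finally have "complex_of_real ((L2_norm (\<lambda>x. f x - a * u x))\<^sup>2)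
     = complex_of_real ((L2_norm f)\<^sup>2 - 2 * Re (cnj a * L2_inner f u) + (cmod a)\<^sup>2 * (L2_norm u)\<^sup>2)"
    by (simp only: of_real_add of_real_diff of_real_mult)
  then show ?thesis by (simp only: of_real_eq_iff)
qed

text \<open>Completing the square, one vector at a time. With \<open>d\<close> the inner products it
  gives Bessel's inequality, for general \<open>d\<close> best approximation, and for
  \<open>f = 0\<close> the norm of a finite combination.\<close>

lemma orthonormal_identity:
  fixes u :: "'k \<Rightarrow> real ^ 'n \<Rightarrow> complex"
  assumes u: "\<And>k. u k \<in> L2_space" and on: "\<And>k l. L2_inner (u k) (u l) = (if k = l then 1 else 0)"
    and f: "f \<in> L2_space" and K: "finite K"
  shows "(L2_norm (\<lambda>x. f x - (\<Sum>k\<in>K. d k * u k x)))\<^sup>2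
     = (L2_norm f)\<^sup>2 - (\<Sum>k\<in>K. (cmod (L2_inner f (u k)))\<^sup>2) + (\<Sum>k\<in>K. (cmod (L2_inner f (u k) - d k))\<^sup>2)"
  using K
proof (induction K rule: finite_induct)
  case (insert j K)
  define g where "g x = f x - (\<Sum>k\<in>K. d k * u k x)" for x
  have S: "(\<lambda>x. \<Sum>k\<in>K. d k * u k x) \<in> L2_space" by (intro L2_sum L2_scale u)
  have g: "g \<in> L2_space" unfolding g_def by (intro L2_diff f S)
  have "L2_inner g (u j) = L2_inner f (u j) - (\<Sum>k\<in>K. d k * L2_inner (u k) (u j))"
    unfolding g_def by (subst L2_inner_diff[OF f S u], subst L2_inner_sum) (auto simp: L2_scale u L2_inner_scale)
  also have "(\<Sum>k\<in>K. d k * L2_inner (u k) (u j)) = 0"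
    using insert(2) by (intro sum.neutral) (auto simp: on)
  finally have ip: "L2_inner g (u j) = L2_inner f (u j)" by simp
  have uj: "(L2_norm (u j))\<^sup>2 = 1"
  proof -
    have "complex_of_real ((L2_norm (u j))\<^sup>2) = 1"
      using L2_norm_sq_inner[OF u[of j]] on[of j j] by (simp del: of_real_power)
    then show ?thesis by (simp only: of_real_eq_1_iff)
  qed
  have eq: "f x - (\<Sum>k\<in>insert j K. d k * u k x) = g x - d j * u j x" for x
    using insert(1,2) by (simp add: g_def)
  have al: "(cmod (a - b))\<^sup>2 = (cmod a)\<^sup>2 - 2 * Re (cnj b * a) + (cmod b)\<^sup>2" for a b
    unfolding cmod_power2 by (simp add: power2_eq_square algebra_simps)
  have "(L2_norm (\<lambda>x. f x - (\<Sum>k\<in>insert j K. d k * u k x)))\<^sup>2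
      = (L2_norm g)\<^sup>2 - 2 * Re (cnj (d j) * L2_inner f (u j)) + (cmod (d j))\<^sup>2"
    unfolding eq L2_norm_sq_diff[OF g u] ip uj by simp
  also have "(L2_norm g)\<^sup>2 = (L2_norm f)\<^sup>2 - (\<Sum>k\<in>K. (cmod (L2_inner f (u k)))\<^sup>2) + (\<Sum>k\<in>K. (cmod (L2_inner f (u k) - d k))\<^sup>2)"
    using insert.IH unfolding g_def .
  finally show ?case
    using insert(1,2) al[of "L2_inner f (u j)" "d j"] by simp
qed simp

lemma orthonormal_sum_norm:
  fixes u :: "'k \<Rightarrow> real ^ 'n \<Rightarrow> complex"
  assumes u: "\<And>k. u k \<in> L2_space" and on: "\<And>k l. L2_inner (u k) (u l) = (if k = l then 1 else 0)"
    and K: "finite K"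
  shows "(L2_norm (\<lambda>x. \<Sum>k\<in>K. d k * u k x))\<^sup>2 = (\<Sum>k\<in>K. (cmod (d k))\<^sup>2)"
  using orthonormal_identity[OF u on L2_zero K, of d] L2_norm_minus_commute[of "\<lambda>x. 0" "\<lambda>x. \<Sum>k\<in>K. d k * u k x"]
  by (simp add: L2_inner_zero)

text \<open>By best approximation, once \<open>K\<close> contains the index set of a good
  approximation, the sum over \<open>K\<close> with the inner products as coefficients is at least
  as good; hence density yields convergence along the net of finite sets.\<close>

lemma orthonormal_complete:
  fixes u :: "'k \<Rightarrow> real ^ 'n \<Rightarrow> complex"
  assumes u: "\<And>k. u k \<in> L2_space" and on: "\<And>k l. L2_inner (u k) (u l) = (if k = l then 1 else 0)"
    and f: "f \<in> L2_space"
    and dense: "\<And>e. e > 0 \<Longrightarrow> \<exists>K d. finite K \<and> L2_norm (\<lambda>x. f x - (\<Sum>k\<in>K. d k * u k x)) < e"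
  shows "(\<lambda>k. L2_inner f (u k)) \<in> ell2" "L2_has_sum (\<lambda>k x. L2_inner f (u k) * u k x) f"
proof -
  define c where "c k = L2_inner f (u k)" for k
  have id: "(L2_norm (\<lambda>x. f x - (\<Sum>k\<in>K. d k * u k x)))\<^sup>2
     = (L2_norm f)\<^sup>2 - (\<Sum>k\<in>K. (cmod (c k))\<^sup>2) + (\<Sum>k\<in>K. (cmod (c k - d k))\<^sup>2)" if "finite K" for K d
    unfolding c_def by (rule orthonormal_identity[OF u on f that])
  have bessel: "(\<Sum>k\<in>K. (cmod (c k))\<^sup>2) \<le> (L2_norm f)\<^sup>2" if "finite K" for K
    using id[OF that, of c] zero_le_power2[of "L2_norm (\<lambda>x. f x - (\<Sum>k\<in>K. c k * u k x))"] by simp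
  have "(\<lambda>k. (cmod (c k))\<^sup>2) summable_on UNIV"
  proof (rule nonneg_bdd_above_summable_on)
    show "bdd_above (sum (\<lambda>k. (cmod (c k))\<^sup>2) ` {F. F \<subseteq> UNIV \<and> finite F})"
      by (rule bdd_aboveI2[where M="(L2_norm f)\<^sup>2"]) (use bessel in auto)
  qed simp
  then show "(\<lambda>k. L2_inner f (u k)) \<in> ell2" by (simp add: ell2_def c_def)
  have S: "(\<lambda>x. \<Sum>k\<in>K. c k * u k x) \<in> L2_space" for K by (intro L2_sum L2_scale u)
  have "((\<lambda>K. L2_norm (\<lambda>x. (\<Sum>k\<in>K. c k * u k x) - f x)) \<longlongrightarrow> 0) (finite_subsets_at_top UNIV)"
  proof (rule tendstoI)
    fix e :: real assume "e > 0"
    from dense[OF this] obtain K0 d where K0: "finite K0" "L2_norm (\<lambda>x. f x - (\<Sum>k\<in>K0. d k * u k x)) < e" by blast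
    have "L2_norm (\<lambda>x. (\<Sum>k\<in>K. c k * u k x) - f x) < e" if K: "finite K" "K0 \<subseteq> K" for K
    proof -
      \<comment> \<open>The competing coefficients are extended by 0 so that both sums run over the
        larger set \<open>K\<close>.\<close>
      define d' where "d' k = (if k \<in> K0 then d k else 0)" for k
      have eq: "(\<Sum>k\<in>K. d' k * u k x) = (\<Sum>k\<in>K0. d k * u k x)" for x
        using K by (intro sum.mono_neutral_cong_right) (auto simp: d'_def)
      have "(L2_norm (\<lambda>x. f x - (\<Sum>k\<in>K. c k * u k x)))\<^sup>2 \<le> (L2_norm (\<lambda>x. f x - (\<Sum>k\<in>K. d' k * u k x)))\<^sup>2"
        unfolding id[OF K(1)] by (simp add: sum_nonneg)
      then have "L2_norm (\<lambda>x. f x - (\<Sum>k\<in>K. c k * u k x)) \<le> L2_norm (\<lambda>x. f x - (\<Sum>k\<in>K0. d k * u k x))"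
        unfolding eq by (rule power2_le_imp_le) simp
      with K0(2) show ?thesis using L2_norm_minus_commute[of f "\<lambda>x. \<Sum>k\<in>K. c k * u k x"] by simp
    qed
    then show "\<forall>\<^sub>F K in finite_subsets_at_top UNIV. dist (L2_norm (\<lambda>x. (\<Sum>k\<in>K. c k * u k x) - f x)) 0 < e"
      unfolding eventually_finite_subsets_at_top using K0(1) by (intro exI[of _ K0]) auto
  qed
  with S f show "L2_has_sum (\<lambda>k x. L2_inner f (u k) * u k x) f"
    by (simp add: L2_has_sum_def L2_tendsto_def c_def)
qed

section \<open>Completeness of the characters on the unit cell\<close>

lemma integral_cis_unit_interval:
  fixes n :: int
  shows "has_bochner_integral lborel (\<lambda>t. indicator {0..<1} t * cis (2 * pi * n * t)) (if n = 0 then 1 else 0)"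
proof -
  have "has_bochner_integral lborel (\<lambda>t. indicator {0..1::real} t *\<^sub>R cis (2 * pi * n * t)) (if n = 0 then 1 else 0)"
  proof (cases "n = 0")
    case True
    have "has_bochner_integral lborel (\<lambda>t. indicator {0..1::real} t *\<^sub>R (1::complex)) (measure lborel {0..1::real} *\<^sub>R 1)"
      by (rule has_bochner_integral_indicator) auto
    with True show ?thesis by simp
  next
    case False
    define w where "w = \<i> * complex_of_real (2 * pi * n)"
    have w: "w \<noteq> 0" using False by (simp add: w_def)
    have cw: "cis (2 * pi * n * t) = exp (t *\<^sub>R w)" for t :: real
      by (simp add: cis_conv_exp w_def scaleR_conv_of_real mult_ac)
    define F where "F t = exp (t *\<^sub>R w) * inverse w" for t :: real
    have "has_bochner_integral lborel (\<lambda>t. indicator {0..1::real} t *\<^sub>R cis (2 * pi * n * t)) (F 1 - F 0)"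
    proof (rule has_bochner_integral_FTC_Icc)
      fix x :: real
      have "(F has_vector_derivative exp (x *\<^sub>R w) * w * inverse w) (at x within {0..1})"
        unfolding F_def[abs_def] by (intro has_vector_derivative_mult_left exp_scaleR_has_vector_derivative_right)
      then show "(F has_vector_derivative cis (2 * pi * n * x)) (at x within {0..1})"
        unfolding cw using w by (simp add: mult.assoc)
    qed (auto intro!: continuous_intros)
    moreover have "cis (2 * pi * n) = 1" by (rule cis_multiple_2pi) simp
    ultimately show ?thesis using False cw[of 1] by (simp add: F_def)
  qed
  \<comment> \<open>The fundamental theorem of calculus was applied on the closed interval; the
    half-open one, which matches \<open>unit_cell\<close>, differs from it by a single
    point.\<close>
  then show ?thesis
  proof (rule has_bochner_integral_cong_AE[THEN iffD1, rotated -1])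
    have "AE t in lborel. t \<noteq> (1::real)" by (rule AE_lborel_singleton)
    then show "AE t in lborel. indicator {0..1::real} t *\<^sub>R cis (2 * pi * n * t) = indicator {0..<1} t * cis (2 * pi * n * t)"
      by eventually_elim (auto simp: indicator_def)
    have [measurable]: "(\<lambda>t. cis (2 * pi * n * t)) \<in> borel_measurable borel"
      by (auto intro!: borel_measurable_continuous_onI continuous_intros)
    show "(\<lambda>t. indicator {0..1::real} t *\<^sub>R cis (2 * pi * n * t)) \<in> borel_measurable lborel"
      "(\<lambda>t. indicator {0..<1::real} t * cis (2 * pi * n * t)) \<in> borel_measurable lborel" by measurable
  qed
qed

text \<open>Cutting off to the cell embeds the square integrable functions on the torus into those
  on R^n, so that the theory developed there applies unchanged.\<close>

definition on_cell :: "(real ^ 'n \<Rightarrow> complex) \<Rightarrow> real ^ 'n \<Rightarrow> complex" where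
  "on_cell f x = indicator unit_cell x * f x"

text \<open>The sign matches the one in the Fourier transform of a translation by \<open>k\<close>.\<close>

abbreviation cell_char :: "int ^ 'n \<Rightarrow> real ^ 'n \<Rightarrow> complex" where
  "cell_char k \<equiv> on_cell (trig_char (- k))"

lemma on_cell_measurable: "f \<in> borel_measurable lebesgue \<Longrightarrow> on_cell f \<in> borel_measurable lebesgue"
  unfolding on_cell_def[abs_def] by measurable

lemma integral_trig_char_cell:
  "integral\<^sup>L lebesgue (on_cell (trig_char k)) = (if k = 0 then 1 else 0)"
proof -
  have hb: "has_bochner_integral lborel (\<lambda>t. indicator {0..<1} t * cis (2 * pi * (k $ i) * t)) (if k $ i = 0 then 1 else 0)" for i
    by (rule integral_cis_unit_interval)
  have "on_cell (trig_char k) x = (\<Prod>i\<in>UNIV. indicator {0..<1} (x $ i) * cis (2 * pi * (k $ i) * x $ i))" for x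
  proof -
    have 1: "(indicator unit_cell x :: complex) = (\<Prod>i\<in>UNIV. indicator {0..<1} (x $ i))"
    proof (cases "x \<in> unit_cell")
      case False
      then obtain i where "\<not> (0 \<le> x $ i \<and> x $ i < 1)" by (auto simp: unit_cell_def)
      then have "indicator {0..<1} (x $ i) = (0::complex)" by (auto simp: indicator_def)
      then have "(\<Prod>i\<in>UNIV. indicator {0..<1} (x $ i)) = (0::complex)" by (intro prod_zero) auto
      with False show ?thesis by simp
    qed (simp add: unit_cell_def)
    have "2 * pi * (real_vec k \<bullet> x) = (\<Sum>i\<in>UNIV. 2 * pi * (k $ i) * x $ i)"
      by (simp add: inner_vec_def real_vec_def sum_distrib_left mult.assoc)
    then have "trig_char k x = (\<Prod>i\<in>UNIV. cis (2 * pi * (k $ i) * x $ i))"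
      unfolding trig_char_def by (simp add: cis_sum)
    with 1 show ?thesis by (simp add: on_cell_def prod.distrib)
  qed
  then have "integral\<^sup>L lebesgue (on_cell (trig_char k))
     = integral\<^sup>L lebesgue (\<lambda>x. \<Prod>i\<in>UNIV. indicator {0..<1} (x $ i) * cis (2 * pi * (k $ i) * x $ i))"
    by (intro Bochner_Integration.integral_cong) auto
  also have "\<dots> = (\<Prod>i\<in>UNIV. if k $ i = 0 then 1 else 0)"
    using integral_prod_vec(2)[of "\<lambda>i t. indicator {0..<1} t * cis (2 * pi * (k $ i) * t)", OF integrable.intros[OF hb]]
    unfolding has_bochner_integral_integral_eq[OF hb] .
  also have "\<dots> = (if k = 0 then 1 else 0)"
    by (auto simp: vec_eq_iff intro!: prod_zero)
  finally show ?thesis .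
qed

lemma unit_cell_lmeasurable: "(unit_cell :: (real^'n) set) \<in> lmeasurable"
proof (rule bounded_set_imp_lmeasurable)
  have "unit_cell \<subseteq> cbox 0 (1 :: real^'n)" by (auto simp: unit_cell_def mem_box_cart less_imp_le)
  then show "bounded (unit_cell :: (real^'n) set)" using bounded_cbox bounded_subset by blast
qed (rule unit_cell_lebesgue)

lemma on_cell_bounded_L2:
  fixes f :: "real ^ 'n \<Rightarrow> complex"
  assumes "f \<in> borel_measurable lebesgue" "\<And>x. cmod (f x) \<le> C"
  shows "on_cell f \<in> L2_space" "L2_norm (on_cell f) \<le> C * L2_norm (\<lambda>x::real^'n. complex_of_real (1 * indicator unit_cell x))"
proof -
  have 1: "(\<lambda>x::real^'n. complex_of_real (1 * indicator unit_cell x)) \<in> L2_space"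
    by (rule L2_indicator[OF unit_cell_lmeasurable])
  have "on_cell f = (\<lambda>x. f x * complex_of_real (1 * indicator unit_cell x))"
    by (auto simp: on_cell_def indicator_def)
  then show "on_cell f \<in> L2_space" "L2_norm (on_cell f) \<le> C * L2_norm (\<lambda>x::real^'n. complex_of_real (1 * indicator unit_cell x))"
    using L2_mult_bounded[OF 1 assms] by auto
qed

lemma trig_char_lebesgue: "trig_char k \<in> borel_measurable lebesgue"
  by (simp add: measurable_completion)

lemma on_cell_trig_L2: "on_cell (trig_char k) \<in> L2_space"
  by (rule on_cell_bounded_L2[where C=1]) (simp_all add: trig_char_lebesgue)

lemma on_cell_trig_orthonormal:
  "L2_inner (cell_char k) (cell_char l) = (if k = l then 1 else 0)"
proof -
  have "cell_char k x * cnj (cell_char l x) = on_cell (trig_char (l - k)) x" for x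
    using trig_char_add[of "- k" l x] by (simp add: on_cell_def indicator_def cnj_trig_char)
  then show ?thesis by (auto simp: L2_inner_def integral_trig_char_cell)
qed

lemma on_cell_sum: "(\<Sum>k\<in>K. c k * on_cell (f k) x) = on_cell (\<lambda>x. \<Sum>k\<in>K. c k * f k x) x"
  by (simp add: on_cell_def sum_distrib_left mult_ac)

text \<open>Three reductions: the half-open cell is replaced by the open cube, up to a null set;
  then a continuous function vanishing off that cube is chosen; then a uniformly close trigonometric
  polynomial. A uniform error on the cell costs at most \<open>I\<close> times that error in
  norm.\<close>

lemma on_cell_trig_dense:
  fixes m :: "real ^ 'n \<Rightarrow> complex"
  assumes m: "on_cell m \<in> L2_space" and e: "e > 0"
  shows "\<exists>K d. finite K \<and> L2_norm (\<lambda>x. on_cell m x - (\<Sum>k\<in>K. d k * cell_char k x)) < e"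
proof -
  have mm: "on_cell m \<in> borel_measurable lebesgue" by (rule L2_measurable[OF m])
  define f where "f x = indicator (box 0 1) x * on_cell m x" for x
  have [measurable]: "box 0 (1::real^'n) \<in> sets lebesgue" by simp
  have fm: "f \<in> borel_measurable lebesgue" unfolding f_def[abs_def] using mm by measurable
  have bs: "x \<in> box 0 1 \<Longrightarrow> x \<in> unit_cell" for x :: "real^'n" by (auto simp: unit_cell_def mem_box_cart less_imp_le)
  have "negligible (cbox 0 1 - box 0 (1::real^'n))" by (rule negligible_frontier_interval)
  then have "AE x in lebesgue. x \<notin> cbox 0 1 - box 0 (1::real^'n)"
    unfolding negligible_iff_null_sets by (rule AE_not_in)
  then have ae: "AE x in lebesgue. on_cell m x = f x"
    by eventually_elim (auto simp: f_def on_cell_def unit_cell_def mem_box_cart indicator_def less_imp_le)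
  have f: "f \<in> L2_space" by (rule L2_AE_cong(1)[OF m fm ae])
  have f0: "x \<notin> box 0 1 \<Longrightarrow> f x = 0" for x by (simp add: f_def)
  obtain g where g: "continuous_on UNIV g" "\<And>x. x \<notin> box 0 1 \<Longrightarrow> g x = 0" "g \<in> L2_space" "L2_dist f g < e/2"
    using L2_approx_continuous[OF f f0, where e="e/2"] e by auto
  define I where "I = L2_norm (\<lambda>x::real^'n. complex_of_real (1 * indicator unit_cell x))"
  have I: "I \<ge> 0" by (simp add: I_def)
  \<comment> \<open>\<open>I\<close> is the norm of the indicator of the cell, so this choice keeps
    the uniform error below \<open>e/2\<close> in norm; adding 1 makes the denominator positive
    without computing \<open>I\<close>.\<close>
  define \<delta> where "\<delta> = e / (2 * (I + 1))"
  have \<delta>: "\<delta> > 0" using e I by (simp add: \<delta>_def)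
  from trig_poly_dense_continuous[OF g(1,2) \<delta>]
  obtain p where p: "p \<in> trig_poly" "\<And>x. x \<in> cbox 0 1 \<Longrightarrow> cmod (g x - p x) < \<delta>" by blast
  have pc: "continuous_on UNIV p" by (rule continuous_on_trig_poly[OF p(1)])
  \<comment> \<open>Off the cell \<open>p\<close> need not be close to \<open>g\<close>, so the
    difference is set to 0 there in order to be bounded by \<delta> everywhere.\<close>
  define q where "q x = (if x \<in> unit_cell then g x - p x else 0)" for x
  have qm: "q \<in> borel_measurable lebesgue"
  proof -
    have [measurable]: "g \<in> borel_measurable borel" "p \<in> borel_measurable borel"
      using g(1) pc by (auto intro: borel_measurable_continuous_onI)
    have "q \<in> borel_measurable borel" unfolding q_def[abs_def] by measurable
    then show ?thesis by (simp add: measurable_completion)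
  qed
  have uc: "x \<in> unit_cell \<Longrightarrow> x \<in> cbox 0 1" for x :: "real^'n" by (auto simp: unit_cell_def mem_box_cart less_imp_le)
  have qb: "cmod (q x) \<le> \<delta>" for x using p(2)[OF uc, of x] \<delta> by (simp add: q_def less_imp_le)
  have "L2_norm (on_cell q) \<le> \<delta> * I" unfolding I_def by (rule on_cell_bounded_L2(2)[OF qm qb])
  also have "\<delta> * I < e/2" using e I by (simp add: \<delta>_def field_simps)
  finally have qn: "L2_norm (on_cell q) < e/2" .
  have q2: "on_cell q \<in> L2_space" by (rule on_cell_bounded_L2(1)[OF qm qb])
  have gp: "on_cell q x = g x - on_cell p x" for x
    using g(2)[of x] bs[of x] by (auto simp: on_cell_def q_def indicator_def)
  have pL2: "on_cell p \<in> L2_space" using L2_diff[OF g(3) q2] by (simp add: gp)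
  have "L2_dist (on_cell m) (on_cell p) = L2_dist f (on_cell p)"
  proof (rule L2_norm_cong_AE)
    show "(\<lambda>x. on_cell m x - on_cell p x) \<in> borel_measurable lebesgue" "(\<lambda>x. f x - on_cell p x) \<in> borel_measurable lebesgue"
      by (rule L2_measurable, rule L2_diff, rule m f, rule pL2)+
  qed (use ae in auto)
  also have "\<dots> < e"
    using L2_norm_triangle3[OF f g(3) pL2] g(4) qn unfolding gp[abs_def] by linarith
  finally have fin: "L2_dist (on_cell m) (on_cell p) < e" .
  obtain K c where K: "finite K" "p = (\<lambda>x. \<Sum>k\<in>K. c k * trig_char k x)"
    using trig_poly_finite_sum[OF p(1)] by blast
  \<comment> \<open>Reindexing by negation matches the sign convention of
    \<open>cell_char\<close>.\<close>
  have pe: "p x = (\<Sum>k\<in>uminus ` K. c (- k) * trig_char (- k) x)" for x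
    unfolding K(2) by (subst sum.reindex) (auto simp: inj_on_def)
  have "on_cell p x = (\<Sum>k\<in>uminus ` K. c (- k) * cell_char k x)" for x
    unfolding on_cell_sum by (simp only: on_cell_def pe)
  with fin K(1) show ?thesis
    by (intro exI[of _ "uminus ` K"] exI[of _ "\<lambda>k. c (- k)"]) simp
qed

theorem fourier_series:
  fixes m :: "real ^ 'n \<Rightarrow> complex"
  assumes m: "on_cell m \<in> L2_space"
  obtains c where "c \<in> ell2" "L2_has_sum (\<lambda>k x. c k * cell_char k x) (on_cell m)"
  using orthonormal_complete[OF on_cell_trig_L2 on_cell_trig_orthonormal m on_cell_trig_dense[OF m]] that by blast

section \<open>Periodic multiples of a Riesz generator\<close>

text \<open>An integral over a counting measure with values in \<open>ennreal\<close>, rather than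
  an infinite sum of reals: it is meaningful without summability and fits
  \<open>nn_integral_unfold\<close> directly.\<close>

definition periodization :: "(real ^ 'n \<Rightarrow> complex) \<Rightarrow> real ^ 'n \<Rightarrow> ennreal" where
  "periodization f x = (\<integral>\<^sup>+k. ennreal ((cmod (f (x + real_vec k)))\<^sup>2) \<partial>count_space UNIV)"

definition AE_periodic :: "(real ^ 'n \<Rightarrow> complex) \<Rightarrow> bool" where
  "AE_periodic m \<longleftrightarrow> (\<forall>k. AE x in lebesgue. m (x + real_vec k) = m x)"

lemma AE_periodic_all: "AE_periodic m \<Longrightarrow> AE x in lebesgue. \<forall>k. m (x + real_vec k) = m x"
  unfolding AE_periodic_def AE_all_countable by blast

text \<open>After unfolding over the lattice, the modulus of \<open>m\<close> is the same in all
  terms and factors out of the sum. The norm of the product over R^n becomes a weighted norm of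
  \<open>m\<close> over one cell, with the periodization of \<Phi> as the weight.\<close>

lemma unfold_periodic_mult:
  fixes m \<Phi> :: "real ^ 'n \<Rightarrow> complex"
  assumes m[measurable]: "m \<in> borel_measurable lebesgue" and \<Phi>[measurable]: "\<Phi> \<in> borel_measurable lebesgue"
    and per: "AE_periodic m"
  shows "(\<integral>\<^sup>+x. ennreal ((cmod (m x * \<Phi> x))\<^sup>2) \<partial>lebesgue)
    = (\<integral>\<^sup>+x. ennreal ((cmod (on_cell m x))\<^sup>2) * periodization \<Phi> x \<partial>lebesgue)"
proof -
  have "(\<integral>\<^sup>+x. ennreal ((cmod (m x * \<Phi> x))\<^sup>2) \<partial>lebesgue)
    = (\<integral>\<^sup>+x. indicator unit_cell x * (\<integral>\<^sup>+k. ennreal ((cmod (m (x + real_vec k) * \<Phi> (x + real_vec k)))\<^sup>2) \<partial>count_space UNIV) \<partial>lebesgue)"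
    by (rule nn_integral_unfold) measurable
  also have "\<dots> = (\<integral>\<^sup>+x. ennreal ((cmod (on_cell m x))\<^sup>2) * periodization \<Phi> x \<partial>lebesgue)"
  proof (rule nn_integral_cong_AE)
    show "AE x in lebesgue. indicator unit_cell x * (\<integral>\<^sup>+k. ennreal ((cmod (m (x + real_vec k) * \<Phi> (x + real_vec k)))\<^sup>2) \<partial>count_space UNIV)
       = ennreal ((cmod (on_cell m x))\<^sup>2) * periodization \<Phi> x"
      using AE_periodic_all[OF per]
    proof eventually_elim
      case (elim x)
      have "(\<integral>\<^sup>+k. ennreal ((cmod (m (x + real_vec k) * \<Phi> (x + real_vec k)))\<^sup>2) \<partial>count_space UNIV)
         = (\<integral>\<^sup>+k. ennreal ((cmod (m x))\<^sup>2) * ennreal ((cmod (\<Phi> (x + real_vec k)))\<^sup>2) \<partial>count_space UNIV)"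
        using elim by (simp add: norm_mult power_mult_distrib ennreal_mult)
      also have "\<dots> = ennreal ((cmod (m x))\<^sup>2) * periodization \<Phi> x"
        unfolding periodization_def by (rule nn_integral_cmult) auto
      finally show ?case by (simp add: on_cell_def indicator_def)
    qed
  qed
  finally show ?thesis .
qed

lemma trig_sum_periodic:
  fixes c :: "int ^ 'n \<Rightarrow> complex"
  defines "p \<equiv> \<lambda>K x. \<Sum>k\<in>K. c k * trig_char (- k) x"
  shows "p K \<in> borel_measurable lebesgue" "AE_periodic (p K)" "on_cell (p K) \<in> L2_space"
proof -
  have [measurable]: "trig_char k \<in> borel_measurable lebesgue" for k by (rule trig_char_lebesgue)
  show "p K \<in> borel_measurable lebesgue" unfolding p_def by measurable
  show "AE_periodic (p K)" unfolding AE_periodic_def p_def by (simp add: trig_char_periodic)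
  have "on_cell (p K) = (\<lambda>x. \<Sum>k\<in>K. c k * cell_char k x)"
    unfolding p_def by (rule ext) (rule on_cell_sum[symmetric])
  then show "on_cell (p K) \<in> L2_space" by (auto intro!: L2_sum L2_scale on_cell_trig_L2)
qed

text \<open>Boundedness of the periodization away from 0 and infinity is the classical condition for
  the modulations of \<Phi> by characters to form a Riesz sequence. No sign of \<open>B\<close> is
  assumed, so the upper bounds below are stated with its absolute value.\<close>

locale riesz_generator =
  fixes \<Phi> :: "real ^ 'n \<Rightarrow> complex" and A B :: real
  assumes \<Phi>_measurable: "\<Phi> \<in> borel_measurable lebesgue"
    and A_pos: "0 < A"
    and bounds: "AE x in lebesgue. ennreal A \<le> periodization \<Phi> x \<and> periodization \<Phi> x \<le> ennreal B"
begin

text \<open>The lower bound on the periodization makes the passage from products back to their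
  periodic factors bounded; this is where square summable coefficients come from.\<close>

lemma on_cell_L2_of_product:
  assumes m[measurable]: "m \<in> borel_measurable lebesgue" and per: "AE_periodic m"
    and L2: "(\<lambda>x. m x * \<Phi> x) \<in> L2_space"
  shows "on_cell m \<in> L2_space" "A * (L2_norm (on_cell m))\<^sup>2 \<le> (L2_norm (\<lambda>x. m x * \<Phi> x))\<^sup>2"
proof -
  have mc: "on_cell m \<in> borel_measurable lebesgue" by (rule on_cell_measurable[OF m])
  have "ennreal A * (\<integral>\<^sup>+x. ennreal ((cmod (on_cell m x))\<^sup>2) \<partial>lebesgue) = (\<integral>\<^sup>+x. ennreal ((cmod (on_cell m x))\<^sup>2) * ennreal A \<partial>lebesgue)"
    using mc by (subst nn_integral_multc) (auto simp: mult.commute)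
  also have "\<dots> \<le> (\<integral>\<^sup>+x. ennreal ((cmod (on_cell m x))\<^sup>2) * periodization \<Phi> x \<partial>lebesgue)"
  proof (rule nn_integral_mono_AE)
    show "AE x in lebesgue. ennreal ((cmod (on_cell m x))\<^sup>2) * ennreal A \<le> ennreal ((cmod (on_cell m x))\<^sup>2) * periodization \<Phi> x"
      using bounds by eventually_elim (auto intro: mult_left_mono)
  qed
  also have "\<dots> = ennreal ((L2_norm (\<lambda>x. m x * \<Phi> x))\<^sup>2)"
    unfolding L2_norm_sq_ennreal[OF L2] unfold_periodic_mult[OF m \<Phi>_measurable per] ..
  finally have le: "ennreal A * (\<integral>\<^sup>+x. ennreal ((cmod (on_cell m x))\<^sup>2) \<partial>lebesgue) \<le> ennreal ((L2_norm (\<lambda>x. m x * \<Phi> x))\<^sup>2)" .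
  then have "ennreal A * (\<integral>\<^sup>+x. ennreal ((cmod (on_cell m x))\<^sup>2) \<partial>lebesgue) < \<infinity>"
    by (rule le_less_trans) simp
  then have "(\<integral>\<^sup>+x. ennreal ((cmod (on_cell m x))\<^sup>2) \<partial>lebesgue) < \<infinity>"
    using A_pos by (auto simp: ennreal_mult_less_top)
  then show L: "on_cell m \<in> L2_space" using mc by (simp add: L2_space_iff)
  have "ennreal (A * (L2_norm (on_cell m))\<^sup>2) \<le> ennreal ((L2_norm (\<lambda>x. m x * \<Phi> x))\<^sup>2)"
    using le A_pos unfolding L2_norm_sq_ennreal[OF L, symmetric] by (simp add: ennreal_mult)
  then show "A * (L2_norm (on_cell m))\<^sup>2 \<le> (L2_norm (\<lambda>x. m x * \<Phi> x))\<^sup>2"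
    by (subst (asm) ennreal_le_iff) auto
qed

lemma product_L2_of_on_cell:
  assumes m[measurable]: "m \<in> borel_measurable lebesgue" and per: "AE_periodic m"
    and L2: "on_cell m \<in> L2_space"
  shows "(\<lambda>x. m x * \<Phi> x) \<in> L2_space" "(L2_norm (\<lambda>x. m x * \<Phi> x))\<^sup>2 \<le> \<bar>B\<bar> * (L2_norm (on_cell m))\<^sup>2"
proof -
  have mc: "on_cell m \<in> borel_measurable lebesgue" by (rule on_cell_measurable[OF m])
  have "(\<integral>\<^sup>+x. ennreal ((cmod (m x * \<Phi> x))\<^sup>2) \<partial>lebesgue) \<le> (\<integral>\<^sup>+x. ennreal ((cmod (on_cell m x))\<^sup>2) * ennreal \<bar>B\<bar> \<partial>lebesgue)"
    unfolding unfold_periodic_mult[OF m \<Phi>_measurable per]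
  proof (rule nn_integral_mono_AE)
    show "AE x in lebesgue. ennreal ((cmod (on_cell m x))\<^sup>2) * periodization \<Phi> x \<le> ennreal ((cmod (on_cell m x))\<^sup>2) * ennreal \<bar>B\<bar>"
      using bounds
    proof eventually_elim
      case (elim x)
      have "ennreal B \<le> ennreal \<bar>B\<bar>" by (rule ennreal_leI) simp
      with elim have "periodization \<Phi> x \<le> ennreal \<bar>B\<bar>" by (meson order_trans)
      then show ?case by (rule mult_left_mono) simp
    qed
  qed
  also have "\<dots> = ennreal (\<bar>B\<bar> * (L2_norm (on_cell m))\<^sup>2)"
    using mc by (subst nn_integral_multc) (auto simp: L2_norm_sq_ennreal[OF L2, symmetric] ennreal_mult mult.commute)
  finally have le: "(\<integral>\<^sup>+x. ennreal ((cmod (m x * \<Phi> x))\<^sup>2) \<partial>lebesgue) \<le> ennreal (\<bar>B\<bar> * (L2_norm (on_cell m))\<^sup>2)" .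
  have "(\<lambda>x. m x * \<Phi> x) \<in> borel_measurable lebesgue" using m \<Phi>_measurable by measurable
  moreover have "(\<integral>\<^sup>+x. ennreal ((cmod (m x * \<Phi> x))\<^sup>2) \<partial>lebesgue) < \<infinity>" using le by (rule le_less_trans) simp
  ultimately show L: "(\<lambda>x. m x * \<Phi> x) \<in> L2_space" by (simp add: L2_space_iff)
  have "ennreal ((L2_norm (\<lambda>x. m x * \<Phi> x))\<^sup>2) \<le> ennreal (\<bar>B\<bar> * (L2_norm (on_cell m))\<^sup>2)"
    using le unfolding L2_norm_sq_ennreal[OF L] .
  then show "(L2_norm (\<lambda>x. m x * \<Phi> x))\<^sup>2 \<le> \<bar>B\<bar> * (L2_norm (on_cell m))\<^sup>2"
    by (subst (asm) ennreal_le_iff) auto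
qed

text \<open>A finite combination is \<Phi> times a trigonometric polynomial, and the norm of that
  polynomial over the cell is the coefficient norm by orthonormality. The two previous lemmas
  compare the two norms.\<close>

lemma finite_riesz_bounds:
  assumes K: "finite K"
  shows "(\<lambda>x. \<Sum>k\<in>K. c k * (trig_char (- k) x * \<Phi> x)) \<in> L2_space"
    "A * (\<Sum>k\<in>K. (cmod (c k))\<^sup>2) \<le> (L2_norm (\<lambda>x. \<Sum>k\<in>K. c k * (trig_char (- k) x * \<Phi> x)))\<^sup>2"
    "(L2_norm (\<lambda>x. \<Sum>k\<in>K. c k * (trig_char (- k) x * \<Phi> x)))\<^sup>2 \<le> \<bar>B\<bar> * (\<Sum>k\<in>K. (cmod (c k))\<^sup>2)"
proof -
  define p where "p x = (\<Sum>k\<in>K. c k * trig_char (- k) x)" for x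
  have p: "p \<in> borel_measurable lebesgue" "AE_periodic p" "on_cell p \<in> L2_space"
    unfolding p_def[abs_def] by (rule trig_sum_periodic)+
  have eq: "(\<lambda>x. \<Sum>k\<in>K. c k * (trig_char (- k) x * \<Phi> x)) = (\<lambda>x. p x * \<Phi> x)"
    by (simp add: p_def sum_distrib_right mult.assoc)
  have "on_cell p = (\<lambda>x. \<Sum>k\<in>K. c k * cell_char k x)"
    unfolding p_def[abs_def] by (rule ext) (rule on_cell_sum[symmetric])
  then have n: "(L2_norm (on_cell p))\<^sup>2 = (\<Sum>k\<in>K. (cmod (c k))\<^sup>2)"
    using orthonormal_sum_norm[OF on_cell_trig_L2 on_cell_trig_orthonormal K, of c] by simp
  show L: "(\<lambda>x. \<Sum>k\<in>K. c k * (trig_char (- k) x * \<Phi> x)) \<in> L2_space"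
    unfolding eq by (rule product_L2_of_on_cell(1)[OF p])
  show "A * (\<Sum>k\<in>K. (cmod (c k))\<^sup>2) \<le> (L2_norm (\<lambda>x. \<Sum>k\<in>K. c k * (trig_char (- k) x * \<Phi> x)))\<^sup>2"
    using on_cell_L2_of_product(2)[OF p(1,2)] L unfolding eq n by simp
  show "(L2_norm (\<lambda>x. \<Sum>k\<in>K. c k * (trig_char (- k) x * \<Phi> x)))\<^sup>2 \<le> \<bar>B\<bar> * (\<Sum>k\<in>K. (cmod (c k))\<^sup>2)"
    using product_L2_of_on_cell(2)[OF p] unfolding eq n .
qed

text \<open>The Fourier series of \<open>m\<close> converges in norm over the cell. Multiplication
  by \<Phi> is bounded from there to R^n, with factor \<open>sqrt \<bar>B\<bar>\<close>, so the
  series of products converges with the same coefficients.\<close>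

lemma periodic_mult_has_sum:
  assumes m: "m \<in> borel_measurable lebesgue" and per: "AE_periodic m"
    and L2: "(\<lambda>x. m x * \<Phi> x) \<in> L2_space"
  obtains c where "c \<in> ell2" "L2_has_sum (\<lambda>k x. c k * (trig_char (- k) x * \<Phi> x)) (\<lambda>x. m x * \<Phi> x)"
proof -
  have mL: "on_cell m \<in> L2_space" by (rule on_cell_L2_of_product(1)[OF m per L2])
  then obtain c where c: "c \<in> ell2" "L2_has_sum (\<lambda>k x. c k * cell_char k x) (on_cell m)"
    by (rule fourier_series)
  define p where "p K x = (\<Sum>k\<in>K. c k * trig_char (- k) x)" for K x
  have p: "p K \<in> borel_measurable lebesgue" "AE_periodic (p K)" "on_cell (p K) \<in> L2_space" for K
    unfolding p_def[abs_def] by (rule trig_sum_periodic)+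
  have eq: "(\<Sum>k\<in>K. c k * (trig_char (- k) x * \<Phi> x)) = p K x * \<Phi> x" for K x
    by (simp add: p_def sum_distrib_right mult.assoc)
  have oc: "(\<Sum>k\<in>K. c k * cell_char k x) = on_cell (p K) x" for K x
    unfolding p_def[abs_def] by (rule on_cell_sum)
  have pL: "(\<lambda>x. p K x * \<Phi> x) \<in> L2_space" for K by (rule product_L2_of_on_cell(1)[OF p])
  have r: "(L2_norm (\<lambda>x. p K x * \<Phi> x - m x * \<Phi> x))\<^sup>2 \<le> \<bar>B\<bar> * (L2_dist (on_cell (p K)) (on_cell m))\<^sup>2" for K
  proof -
    define q where "q x = p K x - m x" for x
    have qc: "on_cell q = (\<lambda>x. on_cell (p K) x - on_cell m x)"
      by (auto simp: on_cell_def q_def right_diff_distrib)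
    have "q \<in> borel_measurable lebesgue" unfolding q_def[abs_def] using p(1)[of K] m by measurable
    moreover have "AE_periodic q" unfolding AE_periodic_def
    proof
      fix k
      have "AE x in lebesgue. p K (x + real_vec k) = p K x" "AE x in lebesgue. m (x + real_vec k) = m x"
        using p(2)[of K] per by (auto simp: AE_periodic_def)
      then show "AE x in lebesgue. q (x + real_vec k) = q x" unfolding q_def by eventually_elim simp
    qed
    moreover have "on_cell q \<in> L2_space" unfolding qc by (rule L2_diff[OF p(3) mL])
    ultimately have "(L2_norm (\<lambda>x. q x * \<Phi> x))\<^sup>2 \<le> \<bar>B\<bar> * (L2_norm (on_cell q))\<^sup>2" by (rule product_L2_of_on_cell(2))
    then show ?thesis unfolding qc by (simp add: q_def left_diff_distrib)
  qed
  have "((\<lambda>K. L2_norm (\<lambda>x. p K x * \<Phi> x - m x * \<Phi> x)) \<longlongrightarrow> 0) (finite_subsets_at_top UNIV)"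
  proof (rule Lim_null_comparison)
    have "((\<lambda>K. L2_dist (on_cell (p K)) (on_cell m)) \<longlongrightarrow> 0) (finite_subsets_at_top UNIV)"
      using c(2) by (simp add: L2_has_sum_def L2_tendsto_def oc)
    then show "((\<lambda>K. sqrt \<bar>B\<bar> * L2_dist (on_cell (p K)) (on_cell m)) \<longlongrightarrow> 0) (finite_subsets_at_top UNIV)"
      by (rule tendsto_mult_right_zero)
    have "L2_norm (\<lambda>x. p K x * \<Phi> x - m x * \<Phi> x) \<le> sqrt \<bar>B\<bar> * L2_dist (on_cell (p K)) (on_cell m)" for K
      by (rule power2_le_imp_le) (use r[of K] in \<open>simp_all add: power_mult_distrib\<close>)
    then show "\<forall>\<^sub>F K in finite_subsets_at_top UNIV. norm (L2_norm (\<lambda>x. p K x * \<Phi> x - m x * \<Phi> x))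
        \<le> sqrt \<bar>B\<bar> * L2_dist (on_cell (p K)) (on_cell m)" by simp
  qed
  then have "L2_has_sum (\<lambda>k x. c k * (trig_char (- k) x * \<Phi> x)) (\<lambda>x. m x * \<Phi> x)"
    using pL L2 by (simp add: L2_has_sum_def L2_tendsto_def eq)
  with c(1) show ?thesis by (rule that)
qed

end

text \<open>The indicator of a translated cell has periodization identically 1. Both bounds in
  \<open>riesz_generator\<close> may then be taken to be 1, which says that a periodic function has
  the same norm over every translate of the cell.\<close>

lemma on_cell_shift_norm:
  fixes m :: "real ^ 'n \<Rightarrow> complex"
  assumes m[measurable]: "m \<in> borel_measurable lebesgue" and per: "AE_periodic m" and L2: "on_cell m \<in> L2_space"
  shows "on_cell (\<lambda>x. m (x + t)) \<in> L2_space" "L2_norm (on_cell (\<lambda>x. m (x + t))) = L2_norm (on_cell m)"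
proof -
  define \<Phi> where "\<Phi> x = (indicator unit_cell (x - t) :: complex)" for x
  have "(\<lambda>x. indicator unit_cell (x + (- t)) :: complex) \<in> borel_measurable lebesgue"
    by (intro lebesgue_shift_measurable borel_measurable_indicator unit_cell_lebesgue)
  then have \<Phi>m: "\<Phi> \<in> borel_measurable lebesgue" by (simp add: \<Phi>_def[abs_def])
  have W: "periodization \<Phi> x = 1" for x
  proof -
    have "ennreal ((cmod (\<Phi> (x + real_vec k)))\<^sup>2) = indicator {(\<chi> i. - \<lfloor>(x - t) $ i\<rfloor>)} k" for k
      using add_real_vec_unit_cell_iff[of "x - t" k] by (simp add: \<Phi>_def indicator_def algebra_simps)
    then show ?thesis by (simp add: periodization_def one_ennreal_def)
  qed
  interpret riesz_generator \<Phi> 1 1 by unfold_locales (simp_all add: \<Phi>m W)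
  note R = product_L2_of_on_cell[OF m per L2]
  have eq: "on_cell (\<lambda>x. m (x + t)) = (\<lambda>x. m (x + t) * \<Phi> (x + t))"
    by (auto simp: on_cell_def \<Phi>_def)
  have "(L2_norm (\<lambda>x. m x * \<Phi> x))\<^sup>2 = (L2_norm (on_cell m))\<^sup>2"
    using R(2) on_cell_L2_of_product(2)[OF m per R(1)] by simp
  then have "L2_norm (\<lambda>x. m x * \<Phi> x) = L2_norm (on_cell m)"
    by (rule power2_eq_imp_eq) simp_all
  then show "on_cell (\<lambda>x. m (x + t)) \<in> L2_space" "L2_norm (on_cell (\<lambda>x. m (x + t))) = L2_norm (on_cell m)"
    unfolding eq using L2_shift[OF R(1), of t] by simp_all
qed

text \<open>
  A translation by \<open>t\<close> multiplies the Fourier coefficients by \<open>trig_char (- k) t\<close>, so a periodic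
  function that is invariant under it can only have frequencies with \<open>trig_char (- k) t = 1\<close>.
\<close>

lemma periodic_shift_invariant_const:
  fixes m :: "real ^ 'n \<Rightarrow> complex"
  assumes m: "m \<in> borel_measurable lebesgue" and per: "AE_periodic m" and L2: "on_cell m \<in> L2_space"
    and inv: "\<And>k. k \<noteq> 0 \<Longrightarrow> \<exists>t. trig_char (- k) t \<noteq> 1 \<and> (AE x in lebesgue. m (x + t) = m x)"
  shows "\<exists>c. AE x in lebesgue. m x = c"
proof -
  obtain c where c: "c \<in> ell2" "L2_has_sum (\<lambda>k x. c k * cell_char k x) (on_cell m)"
    using fourier_series[OF L2] by blast
  define p where "p K x = (\<Sum>k\<in>K. c k * trig_char (- k) x)" for K x
  have p: "p K \<in> borel_measurable lebesgue" "AE_periodic (p K)" "on_cell (p K) \<in> L2_space" for K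
    unfolding p_def[abs_def] by (rule trig_sum_periodic)+
  have oc: "(\<Sum>k\<in>K. c k * cell_char k x) = on_cell (p K) x" for K x
    unfolding p_def[abs_def] by (rule on_cell_sum)
  have lim: "((\<lambda>K. L2_dist (on_cell (p K)) (on_cell m)) \<longlongrightarrow> 0) (finite_subsets_at_top UNIV)"
    using c(2) by (simp add: L2_has_sum_def L2_tendsto_def oc)
  have c0: "c k = 0" if k: "k \<noteq> 0" for k
  proof -
    obtain t where t: "trig_char (- k) t \<noteq> 1" "AE x in lebesgue. m (x + t) = m x" using inv[OF k] by blast
    \<comment> \<open>These are the coefficients of the increment
      \<open>p K (x + t) - p K x\<close>.\<close>
    define d where "d l = c l * (trig_char (- l) t - 1)" for l
    \<comment> \<open>Since \<open>m\<close> has no increment under \<open>t\<close>, the increment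
      of \<open>p K\<close> is that of the error \<open>p K - m\<close>, so its norm over the cell
      is at most twice that of the error. The right side tends to 0 along the net, forcing
      \<open>d k = 0\<close>.\<close>
    have bound: "(cmod (d k))\<^sup>2 \<le> (2 * L2_dist (on_cell (p K)) (on_cell m))\<^sup>2" if K: "finite K" "k \<in> K" for K
    proof -
      define q where "q x = p K x - m x" for x
      have qc: "on_cell q = (\<lambda>x. on_cell (p K) x - on_cell m x)"
        by (auto simp: on_cell_def q_def right_diff_distrib)
      have qm: "q \<in> borel_measurable lebesgue" unfolding q_def[abs_def] using p(1)[of K] m by measurable
      have qp: "AE_periodic q" unfolding AE_periodic_def
      proof
        fix k
        have "AE x in lebesgue. p K (x + real_vec k) = p K x" "AE x in lebesgue. m (x + real_vec k) = m x"
          using p(2)[of K] per by (auto simp: AE_periodic_def)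
        then show "AE x in lebesgue. q (x + real_vec k) = q x" unfolding q_def by eventually_elim simp
      qed
      have qL: "on_cell q \<in> L2_space" unfolding qc by (rule L2_diff[OF p(3) L2])
      note sh = on_cell_shift_norm[OF qm qp qL, of t]
      have ps: "p K (x + t) - p K x = (\<Sum>l\<in>K. d l * trig_char (- l) x)" for x
        by (simp add: p_def d_def trig_char_shift sum_subtractf[symmetric] algebra_simps)
      have S: "(\<lambda>x. \<Sum>l\<in>K. d l * cell_char l x) \<in> L2_space"
        by (intro L2_sum L2_scale on_cell_trig_L2)
      have "L2_norm (\<lambda>x. \<Sum>l\<in>K. d l * cell_char l x)
          = L2_norm (\<lambda>x. on_cell (\<lambda>x. q (x + t)) x - on_cell q x)"
      proof (rule L2_norm_cong_AE)
        show "(\<lambda>x. \<Sum>l\<in>K. d l * cell_char l x) \<in> borel_measurable lebesgue"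
          by (rule L2_measurable[OF S])
        show "(\<lambda>x. on_cell (\<lambda>x. q (x + t)) x - on_cell q x) \<in> borel_measurable lebesgue"
          by (rule L2_measurable[OF L2_diff[OF sh(1) qL]])
        show "AE x in lebesgue. cmod (\<Sum>l\<in>K. d l * cell_char l x) = cmod (on_cell (\<lambda>x. q (x + t)) x - on_cell q x)"
          using t(2)
        proof eventually_elim
          case (elim x)
          have "(\<Sum>l\<in>K. d l * cell_char l x) = indicator unit_cell x * (p K (x + t) - p K x)"
            unfolding on_cell_sum unfolding ps by (simp add: on_cell_def)
          also have "\<dots> = on_cell (\<lambda>x. q (x + t)) x - on_cell q x"
            using elim by (simp add: on_cell_def q_def algebra_simps)
          finally show ?case by simp
        qed
      qed
      also have "\<dots> \<le> L2_norm (on_cell (\<lambda>x. q (x + t))) + L2_norm (on_cell q)"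
        using L2_norm_triangle3[OF sh(1) L2_zero qL] L2_norm_minus_commute[of "\<lambda>x. 0" "on_cell q"] by simp
      also have "\<dots> = 2 * L2_norm (on_cell q)" using sh(2) by simp
      finally have "(L2_norm (\<lambda>x. \<Sum>l\<in>K. d l * cell_char l x))\<^sup>2 \<le> (2 * L2_norm (on_cell q))\<^sup>2"
        by (rule power_mono) simp
      then have "(\<Sum>l\<in>K. (cmod (d l))\<^sup>2) \<le> (2 * L2_norm (on_cell q))\<^sup>2"
        unfolding orthonormal_sum_norm[OF on_cell_trig_L2 on_cell_trig_orthonormal K(1)] .
      moreover have "(cmod (d k))\<^sup>2 \<le> (\<Sum>l\<in>K. (cmod (d l))\<^sup>2)"
        using K by (intro member_le_sum) auto
      ultimately show ?thesis unfolding qc by linarith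
    qed
    have "((\<lambda>K. (2 * L2_dist (on_cell (p K)) (on_cell m))\<^sup>2) \<longlongrightarrow> (2 * 0)\<^sup>2) (finite_subsets_at_top UNIV)"
      by (intro tendsto_intros lim)
    moreover have "\<forall>\<^sub>F K in finite_subsets_at_top UNIV. (cmod (d k))\<^sup>2 \<le> (2 * L2_dist (on_cell (p K)) (on_cell m))\<^sup>2"
      unfolding eventually_finite_subsets_at_top by (intro exI[of _ "{k}"] conjI allI impI bound) auto
    ultimately have "(cmod (d k))\<^sup>2 \<le> (2 * 0)\<^sup>2"
      by (rule tendsto_lowerbound) simp
    then show "c k = 0" using t(1) by (simp add: d_def)
  qed
  have "L2_tendsto (\<lambda>K x. \<Sum>k\<in>K. c k * cell_char k x) (on_cell (\<lambda>x. c 0)) (finite_subsets_at_top UNIV)"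
    unfolding L2_tendsto_def
  proof (intro conjI allI)
    show "(\<lambda>x. \<Sum>k\<in>K. c k * cell_char k x) \<in> L2_space" for K
      by (intro L2_sum L2_scale on_cell_trig_L2)
    show "on_cell (\<lambda>x. c 0) \<in> L2_space" by (rule on_cell_bounded_L2(1)[where C="cmod (c 0)"]) auto
    have z: "(\<Sum>k\<in>K. c k * cell_char k x) - on_cell (\<lambda>x. c 0) x = 0" if "finite K" "{0} \<subseteq> K" for K x
    proof -
      have "(\<Sum>k\<in>K. c k * cell_char k x) = (\<Sum>k\<in>{0}. c k * cell_char k x)"
        using that c0 by (intro sum.mono_neutral_right) auto
      also have "\<dots> = c 0 * on_cell (trig_char 0) x" by simp
      also have "\<dots> = on_cell (\<lambda>x. c 0) x" unfolding on_cell_def by (simp add: mult.commute)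
      finally show ?thesis by simp
    qed
    show "((\<lambda>K. L2_norm (\<lambda>x. (\<Sum>k\<in>K. c k * cell_char k x) - on_cell (\<lambda>x. c 0) x)) \<longlongrightarrow> 0) (finite_subsets_at_top UNIV)"
    proof (rule tendsto_eventually)
      show "\<forall>\<^sub>F K in finite_subsets_at_top UNIV. L2_norm (\<lambda>x. (\<Sum>k\<in>K. c k * cell_char k x) - on_cell (\<lambda>x. c 0) x) = 0"
        unfolding eventually_finite_subsets_at_top by (intro exI[of _ "{0}"]) (simp add: z)
    qed
  qed
  from L2_tendsto_unique[OF this c(2)[unfolded L2_has_sum_def]]
  have "AE x in lebesgue. on_cell (\<lambda>x. c 0) x = on_cell m x" by simp
  \<comment> \<open>The equality is informative only on the cell; countably many integer
    translations and the periodicity of \<open>m\<close> spread it to the whole space.\<close>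
  then have "AE x in lebesgue. on_cell (\<lambda>x. c 0) (x + real_vec k) = on_cell m (x + real_vec k)" for k
    by (rule AE_lebesgue_shift)
  then have "AE x in lebesgue. \<forall>k. on_cell (\<lambda>x. c 0) (x + real_vec k) = on_cell m (x + real_vec k)"
    unfolding AE_all_countable by blast
  then have "AE x in lebesgue. m x = c 0"
    using AE_periodic_all[OF per]
  proof eventually_elim
    case (elim x)
    define k where "k = (\<chi> i. - \<lfloor>x $ i\<rfloor>)"
    have "x + real_vec k \<in> unit_cell" using add_real_vec_unit_cell_iff[of x k] by (simp add: k_def)
    with elim(1) have "m (x + real_vec k) = c 0" by (auto simp: on_cell_def dest: spec[of _ k])
    with elim(2) show ?case by simp
  qed
  then show ?thesis by blast
qed

lemma matrix_powi_0 [simp]: "matrix_powi A 0 = mat 1"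
  by (simp add: matrix_powi_def)

section \<open>Dilation matrices and dual lattices\<close>

lemma matrix_inv_mult:
  fixes A :: "real ^ 'n ^ 'n"
  assumes "invertible A"
  shows "matrix_inv A ** A = mat 1" "A ** matrix_inv A = mat 1"
  using someI_ex[OF assms[unfolded invertible_def]] unfolding matrix_inv_def by blast+

lemma matrix_powi_Suc:
  fixes A :: "real ^ 'n ^ 'n"
  assumes "invertible A"
  shows "matrix_powi A (j + 1) = A ** matrix_powi A j"
proof (cases "j \<ge> 0")
  case True
  then have "nat (j + 1) = Suc (nat j)" by simp
  with True show ?thesis by (simp add: matrix_powi_def)
next
  case False
  have "nat (- j) = Suc (nat (- (j + 1)))" using False by simp
  then have "matrix_powi A j = matrix_inv A ** ((((**) (matrix_inv A)) ^^ nat (- (j + 1))) (mat 1))"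
    using False by (simp add: matrix_powi_def)
  moreover have "(((**) (matrix_inv A)) ^^ nat (- (j + 1))) (mat 1) = matrix_powi A (j + 1)"
    using False by (cases "j = -1") (auto simp: matrix_powi_def)
  ultimately have "A ** matrix_powi A j = (A ** matrix_inv A) ** matrix_powi A (j + 1)"
    by (simp add: matrix_mul_assoc)
  then show ?thesis using matrix_inv_mult(2)[OF assms] by simp
qed

lemma matrix_powi_pred:
  fixes A :: "real ^ 'n ^ 'n"
  assumes "invertible A"
  shows "matrix_powi A (j - 1) = matrix_inv A ** matrix_powi A j"
proof -
  have "matrix_inv A ** matrix_powi A j = (matrix_inv A ** A) ** matrix_powi A (j - 1)"
    using matrix_powi_Suc[OF assms, of "j - 1"] by (simp add: matrix_mul_assoc)
  then show ?thesis using matrix_inv_mult(1)[OF assms] by simp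
qed

lemma matrix_powi_add:
  fixes A :: "real ^ 'n ^ 'n"
  assumes A: "invertible A"
  shows "matrix_powi A (i + j) = matrix_powi A i ** matrix_powi A j"
proof (induction i rule: int_induct[where k=0])
  case (step1 i)
  have "matrix_powi A (i + 1 + j) = A ** matrix_powi A (i + j)"
    using matrix_powi_Suc[OF A, of "i + j"] by (simp add: algebra_simps)
  with step1 show ?case by (simp add: matrix_powi_Suc[OF A] matrix_mul_assoc)
next
  case (step2 i)
  have "matrix_powi A (i - 1 + j) = matrix_inv A ** matrix_powi A (i + j)"
    using matrix_powi_pred[OF A, of "i + j"] by (simp add: algebra_simps)
  with step2 show ?case by (simp add: matrix_powi_pred[OF A] matrix_mul_assoc)
qed simp

lemma norm_matrix_powi:
  fixes A :: "real ^ 'n ^ 'n"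
  assumes A: "invertible A" and n: "\<And>x. norm (A *v x) = a * norm x" and a: "a > 0"
  shows "norm (matrix_powi A i *v x) = a powi i * norm x"
proof (induction i rule: int_induct[where k=0])
  case (step1 i)
  then show ?case
    using a by (simp add: matrix_powi_Suc[OF A] matrix_vector_mul_assoc[symmetric] n power_int_add_1')
next
  case (step2 i)
  have "a * norm (matrix_powi A (i - 1) *v x) = norm (matrix_powi A i *v x)"
    using matrix_powi_Suc[OF A, of "i - 1"] by (simp add: matrix_vector_mul_assoc[symmetric] n)
  also have "\<dots> = a powi i * norm x" by (rule step2)
  finally show ?case using a by (simp add: power_int_diff field_simps)
qed simp

lemma int_matrix_real_vec:
  assumes "int_matrix A"
  shows "\<exists>l. A *v real_vec k = real_vec l"
proof -
  have "(A *v real_vec k) $ i \<in> \<int>" for i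
    using assms by (auto simp: matrix_vector_mult_def real_vec_def int_matrix_def intro!: Ints_sum Ints_mult)
  then have "\<forall>i. \<exists>n. (A *v real_vec k) $ i = real_of_int n" by (auto elim!: Ints_cases)
  from choice[OF this] obtain l where "\<And>i. (A *v real_vec k) $ i = real_of_int (l i)" by auto
  then show ?thesis by (intro exI[of _ "\<chi> i. l i"]) (simp add: vec_eq_iff real_vec_def)
qed

text \<open>A multiple of an orthogonal matrix is represented by how it scales norms; the transpose
  is listed as well because it is the matrix that acts on frequencies.\<close>

locale similarity_matrix =
  fixes D :: "real ^ 'n ^ 'n" and a :: real
  assumes a: "a > 1" and norm_D: "\<And>x. norm (D *v x) = a * norm x"
    and norm_transpose: "\<And>x. norm (transpose D *v x) = a * norm x" and int_D: "int_matrix D"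
begin

definition DT :: "real ^ 'n ^ 'n" where
  "DT = transpose D"

lemma inner_DT: "(D *v x) \<bullet> y = x \<bullet> (DT *v y)"
  unfolding DT_def transpose_matrix_vector by (metis dot_lmul_matrix inner_commute)

lemma norm_DT: "norm (DT *v x) = a * norm x"
  using norm_transpose unfolding DT_def .

lemma invertible_D: "invertible D" and invertible_DT: "invertible DT"
proof -
  have inj: "invertible A" if "\<And>x. norm (A *v x) = a * norm x" for A :: "real ^ 'n ^ 'n"
  proof -
    have "x = 0" if "A *v x = 0" for x using that \<open>\<And>x. norm (A *v x) = a * norm x\<close>[of x] a by simp
    then have "\<exists>B. B ** A = mat 1"
      unfolding matrix_left_invertible_ker by blast
    then show ?thesis by (simp add: invertible_left_inverse)
  qed
  show "invertible D" "invertible DT" by (rule inj, rule norm_D norm_DT)+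
qed

text \<open>The image of Z^n is 2 pi times the dual of the lattice spanned by the columns of the
  \<open>j\<close>-th power of \<open>D\<close>, that is the period lattice on the Fourier side at
  level \<open>j\<close>.\<close>

definition dual_map :: "int \<Rightarrow> real ^ 'n \<Rightarrow> real ^ 'n" where
  "dual_map j \<theta> = (2 * pi) *\<^sub>R (matrix_powi DT (- j) *v \<theta>)"

definition dual_map_inv :: "int \<Rightarrow> real ^ 'n \<Rightarrow> real ^ 'n" where
  "dual_map_inv j \<omega> = (1 / (2 * pi)) *\<^sub>R (matrix_powi DT j *v \<omega>)"

lemma dual_map_inverse [simp]: "dual_map j (dual_map_inv j x) = x" "dual_map_inv j (dual_map j x) = x"
  using matrix_powi_add[OF invertible_DT, of "- j" j, symmetric] matrix_powi_add[OF invertible_DT, of j "- j", symmetric]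
  by (simp_all add: dual_map_def dual_map_inv_def matrix_vector_mul_assoc matrix_vector_mult_scaleR)

lemma linear_dual_map: "linear (dual_map j)" "linear (dual_map_inv j)"
  unfolding dual_map_def[abs_def] dual_map_inv_def[abs_def]
  by (auto intro!: linearI simp: matrix_vector_right_distrib scaleR_add_right matrix_vector_mult_scaleR)

lemma dual_map_add: "dual_map j (x + y) = dual_map j x + dual_map j y"
  by (rule linear_add[OF linear_dual_map(1)])

lemma dual_map_lattice: "(2 * pi) *\<^sub>R lattice_point (transpose D) (- j) k = dual_map j (real_vec k)"
  by (simp add: dual_map_def lattice_point_def DT_def)

text \<open>\<open>matrix_powi DT (- j)\<close> is the inverse of the adjoint of
  \<open>matrix_powi D j\<close>. Consequently the phase of a translation by a lattice point becomes
  a character of the torus in the variable \<theta>.\<close>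

lemma matrix_powi_dual_map: "(matrix_powi D j *v y) \<bullet> dual_map j x = 2 * pi * (y \<bullet> x)"
proof -
  have "(matrix_powi D j *v y) \<bullet> (matrix_powi DT (- j) *v x) = y \<bullet> x" for x y
  proof (induction j arbitrary: y x rule: int_induct[where k=0])
    case (step1 j)
    have "(matrix_powi D (j + 1) *v y) \<bullet> (matrix_powi DT (- (j + 1)) *v x)
       = (matrix_powi D j *v y) \<bullet> (DT *v (matrix_powi DT (- (j + 1)) *v x))"
      by (simp add: matrix_powi_Suc[OF invertible_D] matrix_vector_mul_assoc[symmetric] inner_DT)
    also have "DT *v (matrix_powi DT (- (j + 1)) *v x) = matrix_powi DT (- j) *v x"
      using matrix_powi_Suc[OF invertible_DT, of "- (j + 1)"] by (simp add: matrix_vector_mul_assoc)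
    finally show ?case using step1 by simp
  next
    case (step2 j)
    have "matrix_powi DT (- (j - 1)) = DT ** matrix_powi DT (- j)"
      using matrix_powi_Suc[OF invertible_DT, of "- j"] by (simp add: algebra_simps)
    then have "(matrix_powi D (j - 1) *v y) \<bullet> (matrix_powi DT (- (j - 1)) *v x)
       = (D *v (matrix_powi D (j - 1) *v y)) \<bullet> (matrix_powi DT (- j) *v x)"
      by (simp add: matrix_vector_mul_assoc[symmetric] inner_DT)
    also have "D *v (matrix_powi D (j - 1) *v y) = matrix_powi D j *v y"
      using matrix_powi_Suc[OF invertible_D, of "j - 1"] by (simp add: matrix_vector_mul_assoc)
    finally show ?case using step2 by simp
  qed simp
  then show ?thesis by (simp add: dual_map_def)
qed

lemma lattice_dual_map: "lattice_point D j k \<bullet> dual_map j \<theta> = 2 * pi * (real_vec k \<bullet> \<theta>)"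
  by (simp add: lattice_point_def matrix_powi_dual_map)


lemma norm_dual_map: "norm (dual_map j x) = 2 * pi * a powi (- j) * norm x"
  using norm_matrix_powi[OF invertible_DT norm_DT, of "- j" x] a by (simp add: dual_map_def)

text \<open>\<open>dual_map j\<close> is \<open>dual_map (j + 1)\<close> composed with the transpose
  of \<open>D\<close>, an integer matrix, which maps Z^n into itself.\<close>

lemma dual_lattice_mono:
  assumes "i \<le> j"
  shows "\<exists>l. dual_map i (real_vec k) = dual_map j (real_vec l)"
  using assms
proof (induction j rule: int_ge_induct)
  case (step j)
  then obtain l where l: "dual_map i (real_vec k) = dual_map j (real_vec l)" by blast
  have "int_matrix DT" using int_D by (simp add: int_matrix_def transpose_def DT_def)
  then obtain l' where l': "DT *v real_vec l = real_vec l'" using int_matrix_real_vec by blast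
  have "matrix_powi DT (- j) = matrix_powi DT (- (j + 1)) ** DT"
    using matrix_powi_add[OF invertible_DT, of "- (j + 1)" 1] matrix_powi_Suc[OF invertible_DT, of 0] by simp
  then have "dual_map j (real_vec l) = dual_map (j + 1) (real_vec l')"
    by (simp add: dual_map_def matrix_vector_mul_assoc[symmetric] l')
  with l show ?case by auto
qed blast

text \<open>An eigenvalue may be complex, so an eigenvector is split into real and imaginary parts.
  Comparing the norms of their images shows that every eigenvalue has modulus exactly
  \<open>a\<close>.\<close>

lemma expansive_D: "expansive D"
  unfolding expansive_def
proof (intro allI impI)
  fix z assume "is_eigenvalue D z"
  then obtain v :: "complex ^ 'n" where v: "v \<noteq> 0" "(\<chi> i j. complex_of_real (D $ i $ j)) *v v = z *s v"
    by (auto simp: is_eigenvalue_def)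
  define x where "x = (\<chi> i. Re (v $ i))"
  define y where "y = (\<chi> i. Im (v $ i))"
  have comp: "(\<Sum>j\<in>UNIV. complex_of_real (D $ i $ j) * v $ j) = z * v $ i" for i
    using v(2) by (simp add: vec_eq_iff matrix_vector_mult_def)
  have re: "D *v x = Re z *\<^sub>R x - Im z *\<^sub>R y"
    using arg_cong[OF comp, of Re] by (simp add: vec_eq_iff matrix_vector_mult_def x_def y_def)
  have im: "D *v y = Im z *\<^sub>R x + Re z *\<^sub>R y"
    using arg_cong[OF comp, of Im] by (simp add: vec_eq_iff matrix_vector_mult_def x_def y_def)
  have "a\<^sup>2 * ((norm x)\<^sup>2 + (norm y)\<^sup>2) = (norm (D *v x))\<^sup>2 + (norm (D *v y))\<^sup>2"
    by (simp add: norm_D power_mult_distrib distrib_left)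
  \<comment> \<open>The mixed terms of the two squared norms cancel.\<close>
  also have "\<dots> = (cmod z)\<^sup>2 * ((norm x)\<^sup>2 + (norm y)\<^sup>2)"
    unfolding re im cmod_power2 power2_norm_eq_inner
    by (simp add: inner_diff_left inner_diff_right inner_add_left inner_add_right inner_commute power2_eq_square algebra_simps)
  finally have "a\<^sup>2 * ((norm x)\<^sup>2 + (norm y)\<^sup>2) = (cmod z)\<^sup>2 * ((norm x)\<^sup>2 + (norm y)\<^sup>2)" .
  moreover have "(norm x)\<^sup>2 + (norm y)\<^sup>2 \<noteq> 0"
  proof
    assume "(norm x)\<^sup>2 + (norm y)\<^sup>2 = 0"
    then have "x = 0" "y = 0" by (simp_all add: sum_power2_eq_zero_iff)
    then have "v = 0" by (simp add: x_def y_def vec_eq_iff complex_eq_iff)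
    with v(1) show False by simp
  qed
  ultimately have "a\<^sup>2 = (cmod z)\<^sup>2" unfolding mult_cancel_right by blast
  then have "a = cmod z" by (rule power2_eq_imp_eq) (use a in auto)
  then show "1 < cmod z" using a by simp
qed

end

lemma similarity_matrix_scaled_orthogonal:
  fixes R :: "real ^ 'n ^ 'n"
  assumes "a > 1" "orthogonal_matrix R" "int_matrix (a *\<^sub>R R)"
  shows "similarity_matrix (a *\<^sub>R R) a"
proof
  have n: "norm (Q *v x) = norm x" if "orthogonal_matrix Q" for Q :: "real ^ 'n ^ 'n" and x
    using that orthogonal_transformation_matrix[of "(*v) Q"] orthogonal_transformation_norm[of "(*v) Q" x] by simp
  have t: "transpose (a *\<^sub>R R) = a *\<^sub>R transpose R" by (simp add: transpose_def vec_eq_iff)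
  show "norm ((a *\<^sub>R R) *v x) = a * norm x" "norm (transpose (a *\<^sub>R R) *v x) = a * norm x" for x
    unfolding t using assms n[of R x] n[of "transpose R" x]
    by (simp_all add: scaleR_matrix_vector_assoc[symmetric] orthogonal_matrix_transpose)
qed (use assms in auto)

section \<open>Spline spaces on the Fourier side\<close>

text \<open>L2 convergence gives almost everywhere convergence along a subsequence, and the relation
  passes to the pointwise limit at \<open>x\<close> and at \<open>x + t\<close>. The filter may be
  the net of finite sets, so a sequence from the range of \<open>s\<close> is extracted
  first.\<close>

lemma L2_limit_translation_relation:
  fixes F :: "real ^ 'n \<Rightarrow> complex"
  assumes lim: "L2_tendsto s F \<F>" and ne: "\<F> \<noteq> bot"
    and rel: "\<And>i. AE x in lebesgue. s i (x + t) * u (x + t) = s i x * u x"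
  shows "AE x in lebesgue. F (x + t) * u (x + t) = F x * u x"
proof -
  have S: "s i \<in> L2_space" "F \<in> L2_space" for i using lim by (auto simp: L2_tendsto_def)
  have approx: "\<exists>g\<in>range s. L2_dist g F < e" if "e > 0" for e
  proof -
    have "((\<lambda>i. L2_dist (s i) F) \<longlongrightarrow> 0) \<F>" using lim by (simp add: L2_tendsto_def)
    from eventually_happens'[OF ne order_tendstoD(2)[OF this that]] show ?thesis by blast
  qed
  have sub: "range s \<subseteq> L2_space" using S by auto
  obtain \<sigma> where \<sigma>: "range \<sigma> \<subseteq> range s" "L2_tendsto \<sigma> F sequentially"
    by (rule L2_tendsto_sequence[OF S(2) sub approx])
  then have "\<forall>n. \<exists>i. \<sigma> n = s i" by auto
  from choice[OF this] obtain \<iota> where "\<And>n. \<sigma> n = s (\<iota> n)" by blast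
  then have "(\<lambda>n. L2_dist (s (\<iota> n)) F) \<longlonglongrightarrow> 0"
    using \<sigma>(2) by (simp add: L2_tendsto_def)
  then obtain r where r: "AE x in lebesgue. (\<lambda>n. s (\<iota> (r n)) x - F x) \<longlonglongrightarrow> 0"
    using L2_AE_subseq[of "\<lambda>n x. s (\<iota> n) x - F x", OF L2_diff[OF S]] by blast
  have r': "AE x in lebesgue. (\<lambda>n. s (\<iota> (r n)) (x + t) - F (x + t)) \<longlonglongrightarrow> 0"
    by (rule AE_lebesgue_shift[OF r])
  have all: "AE x in lebesgue. \<forall>n. s (\<iota> (r n)) (x + t) * u (x + t) = s (\<iota> (r n)) x * u x"
    unfolding AE_all_countable by (intro allI rel)
  from r r' all show ?thesis
  proof eventually_elim
    case (elim x)
    have "(\<lambda>n. s (\<iota> (r n)) x * u x) \<longlonglongrightarrow> F x * u x"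
      using elim(1) by (intro tendsto_mult_right) (rule LIM_zero_cancel)
    moreover have "(\<lambda>n. s (\<iota> (r n)) x * u x) \<longlonglongrightarrow> F (x + t) * u (x + t)"
      using tendsto_mult_right[OF LIM_zero_cancel[OF elim(2)], of "u (x + t)"] elim(3) by simp
    ultimately show ?case by (rule LIMSEQ_unique[symmetric])
  qed
qed

locale spline_setting = similarity_matrix D a for D :: "real ^ 'n ^ 'n" and a +
  fixes Lhat :: "real ^ 'n \<Rightarrow> complex"
  assumes Lhat_measurable: "Lhat \<in> borel_measurable lebesgue"
    and Lhat_nonzero: "AE \<omega> in lebesgue. Lhat \<omega> \<noteq> 0"
begin

text \<open>Each lattice vector has its own exceptional null set, so that limits can be taken one
  translation at a time.\<close>

definition spline_spectrum :: "int \<Rightarrow> (real ^ 'n \<Rightarrow> complex) \<Rightarrow> bool" where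
  "spline_spectrum j F \<longleftrightarrow> (\<forall>k. AE \<omega> in lebesgue.
     F (\<omega> + dual_map j (real_vec k)) * Lhat (\<omega> + dual_map j (real_vec k)) = F \<omega> * Lhat \<omega>)"

lemma spline_spectrum_antimono:
  assumes "i \<le> j" "spline_spectrum j F"
  shows "spline_spectrum i F"
  unfolding spline_spectrum_def
proof
  fix k
  obtain l where "dual_map i (real_vec k) = dual_map j (real_vec l)"
    using dual_lattice_mono[OF assms(1)] by blast
  then show "AE \<omega> in lebesgue.
     F (\<omega> + dual_map i (real_vec k)) * Lhat (\<omega> + dual_map i (real_vec k)) = F \<omega> * Lhat \<omega>"
    using assms(2) by (simp add: spline_spectrum_def)
qed

lemma spline_spectrum_add:
  assumes "spline_spectrum j F" "spline_spectrum j G"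
  shows "spline_spectrum j (\<lambda>\<omega>. F \<omega> + G \<omega>)"
  unfolding spline_spectrum_def
proof
  fix k
  show "AE \<omega> in lebesgue. (F (\<omega> + dual_map j (real_vec k)) + G (\<omega> + dual_map j (real_vec k))) * Lhat (\<omega> + dual_map j (real_vec k))
      = (F \<omega> + G \<omega>) * Lhat \<omega>"
    using assms(1)[unfolded spline_spectrum_def, THEN spec, of k] assms(2)[unfolded spline_spectrum_def, THEN spec, of k]
    by eventually_elim (simp add: distrib_right)
qed

lemma spline_spectrum_mult:
  assumes "spline_spectrum j F" "\<And>\<omega> k. h (\<omega> + dual_map j (real_vec k)) = h \<omega>"
  shows "spline_spectrum j (\<lambda>\<omega>. h \<omega> * F \<omega>)"
  unfolding spline_spectrum_def
proof
  fix k
  show "AE \<omega> in lebesgue. h (\<omega> + dual_map j (real_vec k)) * F (\<omega> + dual_map j (real_vec k)) * Lhat (\<omega> + dual_map j (real_vec k))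
      = h \<omega> * F \<omega> * Lhat \<omega>"
    using assms(1)[unfolded spline_spectrum_def, THEN spec, of k]
    by eventually_elim (simp add: assms(2) mult.assoc)
qed

lemma spline_spectrum_zero: "spline_spectrum j (\<lambda>\<omega>. 0)"
  by (simp add: spline_spectrum_def)

lemma spline_spectrum_scale: "spline_spectrum j F \<Longrightarrow> spline_spectrum j (\<lambda>\<omega>. c * F \<omega>)"
  by (erule spline_spectrum_mult) simp

lemma spline_spectrum_sum:
  "(\<And>i. i \<in> I \<Longrightarrow> spline_spectrum j (F i)) \<Longrightarrow> spline_spectrum j (\<lambda>\<omega>. \<Sum>i\<in>I. F i \<omega>)"
  by (induction I rule: infinite_finite_induct) (auto intro: spline_spectrum_zero spline_spectrum_add)

lemma spline_spectrum_limit: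
  assumes "L2_tendsto s F \<F>" "\<F> \<noteq> bot" "\<And>i. spline_spectrum j (s i)"
  shows "spline_spectrum j F"
  unfolding spline_spectrum_def
  by (intro allI L2_limit_translation_relation[OF assms(1,2)]) (use assms(3) in \<open>simp add: spline_spectrum_def\<close>)

lemma lattice_point_uminus: "lattice_point D j (- k) = - lattice_point D j k"
  by (simp add: lattice_point_def vec_eq_iff matrix_vector_mult_def sum_negf)

lemma cis_lattice_periodic:
  "cis (- (lattice_point D j k \<bullet> (\<omega> + dual_map j (real_vec l)))) = cis (- (lattice_point D j k \<bullet> \<omega>))"
proof -
  have "cis (- (lattice_point D j k \<bullet> (\<omega> + dual_map j (real_vec l))))
      = cis (- (lattice_point D j k \<bullet> \<omega>)) * trig_char (- k) (real_vec l)"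
    by (simp add: inner_add_right lattice_dual_map trig_char_def cis_mult del: trig_char_real_vec)
  then show ?thesis by simp
qed

lemma spline_spectrum_modulate:
  "spline_spectrum j F \<Longrightarrow> spline_spectrum j (\<lambda>\<omega>. cis (- (lattice_point D j k \<bullet> \<omega>)) * F \<omega>)"
  by (erule spline_spectrum_mult) (rule cis_lattice_periodic)

lemma localization_symbol_periodic:
  "localization_symbol D j p (\<omega> + dual_map j (real_vec l)) = localization_symbol D j p \<omega>"
proof -
  have "exp (\<i> * complex_of_real ((\<omega> + dual_map j (real_vec l)) \<bullet> lattice_point D j k))
      = exp (\<i> * complex_of_real (\<omega> \<bullet> lattice_point D j k))" for k
    using arg_cong[OF cis_lattice_periodic[of j k \<omega> l], of cnj]
    by (simp add: cis_cnj cis_conv_exp[symmetric] inner_commute)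
  then show ?thesis unfolding localization_symbol_def by simp
qed

text \<open>Where \<open>Lhat\<close> is nonzero, its product with the B-spline symbol is the
  periodic localization symbol. This is used at both points, hence the shifted almost everywhere
  statement.\<close>

lemma spline_spectrum_bspline_symbol: "spline_spectrum j (bspline_symbol Lhat D j p)"
  unfolding spline_spectrum_def
proof
  fix k
  show "AE \<omega> in lebesgue. bspline_symbol Lhat D j p (\<omega> + dual_map j (real_vec k)) * Lhat (\<omega> + dual_map j (real_vec k))
      = bspline_symbol Lhat D j p \<omega> * Lhat \<omega>"
    using Lhat_nonzero AE_lebesgue_shift[OF Lhat_nonzero, of "dual_map j (real_vec k)"]
    by eventually_elim (simp add: bspline_symbol_def localization_symbol_periodic)
qed

lemma localization_symbol_bounded:
  assumes "(\<lambda>k. cmod (p k)) summable_on UNIV"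
  shows "cmod (localization_symbol D j p \<omega>) \<le> (\<Sum>\<^sub>\<infinity>k. cmod (p k))"
proof -
  have n: "cmod (p k * exp (\<i> * complex_of_real (\<omega> \<bullet> lattice_point D j k))) = cmod (p k)" for k
    by (simp add: norm_mult)
  show ?thesis
    unfolding localization_symbol_def
    using norm_infsum_bound[of "\<lambda>k. p k * exp (\<i> * complex_of_real (\<omega> \<bullet> lattice_point D j k))" UNIV] assms
    by (simp only: n)
qed

end

locale spline_level = spline_setting D a Lhat for D :: "real ^ 'n ^ 'n" and a Lhat +
  fixes j :: int and p :: "int ^ 'n \<Rightarrow> complex" and \<phi> :: "real ^ 'n \<Rightarrow> complex"
  assumes localizing: "localizing_sequence Lhat D j p"
    and fourier_\<phi>: "fourier_L2 \<phi> (bspline_symbol Lhat D j p)"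
begin

abbreviation "\<phi>hat \<equiv> bspline_symbol Lhat D j p"
abbreviation "\<Phi> \<theta> \<equiv> \<phi>hat (dual_map j \<theta>)"
abbreviation "translate k x \<equiv> \<phi> (x - lattice_point D j k)"
abbreviation "translate_hat k \<omega> \<equiv> cis (- (lattice_point D j k \<bullet> \<omega>)) * \<phi>hat \<omega>"

lemma dual_bij: "linear (dual_map j)" "linear (dual_map_inv j)"
    "\<And>x. dual_map j (dual_map_inv j x) = x" "\<And>x. dual_map_inv j (dual_map j x) = x"
  by (simp_all add: linear_dual_map)

text \<open>The localization bounds are pulled back to the variable \<theta>, where the lattice is
  Z^n. If the localization symbol vanished at a point satisfying the bounds, periodicity would make
  every term of the sum 0, against the positive lower bound.\<close>

lemma generator_bounds:
  obtains A B where "riesz_generator \<Phi> A B"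
    "AE \<omega> in lebesgue. localization_symbol D j p \<omega> \<noteq> 0"
proof -
  define u where "u \<omega> k = (cmod (\<phi>hat (\<omega> + dual_map j (real_vec k))))\<^sup>2" for \<omega> k
  obtain A B where A: "0 < A" and AB: "AE \<omega> in lebesgue. u \<omega> summable_on UNIV \<and> A \<le> (\<Sum>\<^sub>\<infinity>k. u \<omega> k) \<and> (\<Sum>\<^sub>\<infinity>k. u \<omega> k) \<le> B"
    using localizing unfolding localizing_sequence_def dual_map_lattice Let_def u_def[symmetric] by (auto simp: u_def[abs_def])
  have "riesz_generator \<Phi> A B"
  proof
    show "\<Phi> \<in> borel_measurable lebesgue"
      using measurable_compose[OF nn_integral_lebesgue_linear(1)[OF dual_bij] L2_measurable[OF fourier_L2_spaces(2)[OF fourier_\<phi>]]] .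
    show "AE \<theta> in lebesgue. ennreal A \<le> periodization \<Phi> \<theta> \<and> periodization \<Phi> \<theta> \<le> ennreal B"
      using nn_integral_lebesgue_linear(2)[OF dual_bij AB]
    proof eventually_elim
      case (elim \<theta>)
      \<comment> \<open>The bounds are stated with \<open>infsum\<close>, the periodization with a
        counting measure; \<open>infsetsum\<close> mediates between the two.\<close>
      have s: "Infinite_Set_Sum.abs_summable_on (u (dual_map j \<theta>)) UNIV"
        using elim summable_on_iff_abs_summable_on_real abs_summable_equivalent by blast
      have "periodization \<Phi> \<theta> = ennreal (infsetsum (u (dual_map j \<theta>)) UNIV)"
        unfolding periodization_def dual_map_add u_def[symmetric]
        by (rule nn_integral_conv_infsetsum[OF s]) (simp add: u_def)
      also have "infsetsum (u (dual_map j \<theta>)) UNIV = (\<Sum>\<^sub>\<infinity>k. u (dual_map j \<theta>) k)"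
        by (rule infsetsum_infsum[OF s])
      finally show ?case using elim by (simp add: ennreal_leI)
    qed
  qed (rule A)
  moreover have "AE \<omega> in lebesgue. localization_symbol D j p \<omega> \<noteq> 0"
    using AB
  proof eventually_elim
    case (elim \<omega>)
    show ?case
    proof
      assume "localization_symbol D j p \<omega> = 0"
      then have "u \<omega> k = 0" for k
        by (simp add: u_def bspline_symbol_def localization_symbol_periodic)
      then show False using elim A by simp
    qed
  qed
  ultimately show ?thesis by (rule that)
qed

lemma \<phi>hat_nonzero: "AE \<omega> in lebesgue. \<phi>hat \<omega> \<noteq> 0"
proof -
  have "AE \<omega> in lebesgue. localization_symbol D j p \<omega> \<noteq> 0" by (rule generator_bounds)
  with Lhat_nonzero show ?thesis by eventually_elim (simp add: bspline_symbol_def)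
qed

lemma fourier_translate:
  "fourier_L2 (translate k) (\<lambda>\<omega>. translate_hat k \<omega>)"
  by (rule fourier_L2_shift[OF fourier_\<phi>])

lemma translate_dual_map:
  "translate_hat k (dual_map j \<theta>) = trig_char (- k) \<theta> * \<Phi> \<theta>"
  by (simp add: lattice_dual_map trig_char_def)

text \<open>Wherever \<open>Lhat\<close> is nonzero, the quotient equals \<open>F * Lhat\<close>
  divided by the localization symbol, a ratio of periodic functions.\<close>

lemma quotient_periodic:
  assumes "spline_spectrum j F"
  shows "AE_periodic (\<lambda>\<theta>. F (dual_map j \<theta>) / \<Phi> \<theta>)"
  unfolding AE_periodic_def
proof
  fix k
  let ?t = "dual_map j (real_vec k)"
  have "AE \<omega> in lebesgue. F (\<omega> + ?t) / \<phi>hat (\<omega> + ?t) = F \<omega> / \<phi>hat \<omega>"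
    using assms[unfolded spline_spectrum_def, THEN spec, of k] Lhat_nonzero AE_lebesgue_shift[OF Lhat_nonzero, of ?t]
    by eventually_elim (simp add: bspline_symbol_def localization_symbol_periodic divide_inverse mult_ac)
  from nn_integral_lebesgue_linear(2)[OF dual_bij this]
  show "AE \<theta> in lebesgue. F (dual_map j (\<theta> + real_vec k)) / \<phi>hat (dual_map j (\<theta> + real_vec k)) = F (dual_map j \<theta>) / \<Phi> \<theta>"
    by (simp add: dual_map_add)
qed

lemma translates_has_sum_iff:
  assumes "fourier_L2 f F"
  shows "L2_has_sum (\<lambda>k x. c k * translate k x) f
    \<longleftrightarrow> L2_has_sum (\<lambda>k \<omega>. c k * translate_hat k \<omega>) F"
  using fourier_L2_has_sum_iff[where u="\<lambda>k x. translate k x", OF fourier_translate assms] .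

text \<open>From left to right the relation passes from partial sums to the limit. Conversely, the
  expansion of the periodic quotient on the unit cell supplies the coefficients; the change of
  variable and the transform carry it back to \<open>f\<close>.\<close>

theorem spline_space_iff:
  assumes f: "fourier_L2 f F"
  shows "f \<in> spline_space D j \<phi> \<longleftrightarrow> spline_spectrum j F"
proof
  assume "f \<in> spline_space D j \<phi>"
  then obtain c where "L2_has_sum (\<lambda>k x. c k * translate k x) f"
    by (auto simp: spline_space_def)
  then have "L2_has_sum (\<lambda>k \<omega>. c k * translate_hat k \<omega>) F"
    unfolding translates_has_sum_iff[OF f] .
  then have "L2_tendsto (\<lambda>K \<omega>. \<Sum>k\<in>K. c k * translate_hat k \<omega>) F (finite_subsets_at_top UNIV)"
    by (simp add: L2_has_sum_def)
  then show "spline_spectrum j F"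
    by (rule spline_spectrum_limit)
       (auto intro!: spline_spectrum_sum spline_spectrum_scale spline_spectrum_modulate spline_spectrum_bspline_symbol)
next
  assume spec: "spline_spectrum j F"
  obtain A B where "riesz_generator \<Phi> A B" by (rule generator_bounds)
  then interpret riesz_generator \<Phi> A B .
  define m where "m \<theta> = F (dual_map j \<theta>) / \<Phi> \<theta>" for \<theta>
  have F: "F \<in> L2_space" by (rule fourier_L2_spaces(2)[OF f])
  obtain c0 where c0: "\<And>f. f \<in> L2_space \<Longrightarrow> (\<lambda>x. f (dual_map j x)) \<in> L2_space \<and> L2_norm (\<lambda>x. f (dual_map j x)) = c0 * L2_norm f"
    by (rule L2_linear[OF dual_bij]) blast
  have FT: "(\<lambda>\<theta>. F (dual_map j \<theta>)) \<in> L2_space" using c0[OF F] by simp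
  have [measurable]: "(\<lambda>\<theta>. F (dual_map j \<theta>)) \<in> borel_measurable lebesgue" "\<Phi> \<in> borel_measurable lebesgue"
    using L2_measurable[OF FT] \<Phi>_measurable by auto
  have m: "m \<in> borel_measurable lebesgue" unfolding m_def[abs_def] by measurable
  have per: "AE_periodic m" unfolding m_def[abs_def] by (rule quotient_periodic[OF spec])
  have m\<Phi>: "AE \<theta> in lebesgue. F (dual_map j \<theta>) = m \<theta> * \<Phi> \<theta>"
    using nn_integral_lebesgue_linear(2)[OF dual_bij \<phi>hat_nonzero] by eventually_elim (simp add: m_def)
  have "(\<lambda>\<theta>. m \<theta> * \<Phi> \<theta>) \<in> borel_measurable lebesgue" using m by measurable
  then have L: "(\<lambda>\<theta>. m \<theta> * \<Phi> \<theta>) \<in> L2_space" by (rule L2_AE_cong(1)[OF FT _ m\<Phi>])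
  obtain c where c: "c \<in> ell2" "L2_has_sum (\<lambda>k \<theta>. c k * (trig_char (- k) \<theta> * \<Phi> \<theta>)) (\<lambda>\<theta>. m \<theta> * \<Phi> \<theta>)"
    by (rule periodic_mult_has_sum[OF m per L])
  \<comment> \<open>The product is known to equal the pulled back \<open>F\<close> only where \<Phi>
    is nonzero, so the limit of the expansion is replaced by an almost everywhere equal
    function.\<close>
  have m\<Phi>': "AE \<theta> in lebesgue. m \<theta> * \<Phi> \<theta> = F (dual_map j \<theta>)"
    using m\<Phi> by eventually_elim simp
  have "L2_has_sum (\<lambda>k \<theta>. c k * (trig_char (- k) \<theta> * \<Phi> \<theta>)) (\<lambda>\<theta>. F (dual_map j \<theta>))"
    using L2_tendsto_AE_cong[OF c(2)[unfolded L2_has_sum_def] m\<Phi>'] unfolding L2_has_sum_def by simp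
  then have 1: "L2_has_sum (\<lambda>k \<theta>. c k * translate_hat k (dual_map j \<theta>)) (\<lambda>\<theta>. F (dual_map j \<theta>))"
    unfolding translate_dual_map .
  have "(\<lambda>\<omega>. c k * translate_hat k \<omega>) \<in> L2_space" for k
    by (intro L2_scale fourier_L2_spaces(2)[OF fourier_translate])
  with 1 have "L2_has_sum (\<lambda>k \<omega>. c k * translate_hat k \<omega>) F"
    by (subst (asm) L2_has_sum_linear[OF dual_bij, where u="\<lambda>k \<omega>. c k * translate_hat k \<omega>"])
       (auto simp: F)
  then have "L2_has_sum (\<lambda>k x. c k * translate k x) f"
    unfolding translates_has_sum_iff[OF f] .
  with c(1) show "f \<in> spline_space D j \<phi>" by (auto simp: spline_space_def)
qed

lemma spline_space_L2: "spline_space D j \<phi> \<subseteq> L2_space"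
  by (auto simp: spline_space_def L2_has_sum_def L2_tendsto_def)

lemma spline_space_obtain:
  assumes "f \<in> spline_space D j \<phi>"
  obtains F where "fourier_L2 f F" "spline_spectrum j F"
proof -
  have "f \<in> L2_space" using assms spline_space_L2 by blast
  then obtain F where "fourier_L2 f F" using fourier_L2_exists by blast
  with assms spline_space_iff show ?thesis by (intro that) auto
qed

lemma spline_space_closed: "L2_closed_subspace (spline_space D j \<phi>)"
  unfolding L2_closed_subspace_def
proof (intro conjI ballI allI impI)
  show "spline_space D j \<phi> \<subseteq> L2_space" by (rule spline_space_L2)
  show "(\<lambda>x. 0) \<in> spline_space D j \<phi>"
    using spline_space_iff[OF fourier_L2_zero] spline_spectrum_zero by simp
  fix f assume f: "f \<in> spline_space D j \<phi>"
  then obtain F where F: "fourier_L2 f F" "spline_spectrum j F" by (rule spline_space_obtain)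
  show "(\<lambda>x. c * f x) \<in> spline_space D j \<phi>" for c
    using spline_space_iff[OF fourier_L2_scale[OF F(1)]] spline_spectrum_scale[OF F(2)] by simp
  fix g assume "g \<in> spline_space D j \<phi>"
  then obtain G where G: "fourier_L2 g G" "spline_spectrum j G" by (rule spline_space_obtain)
  show "(\<lambda>x. f x + g x) \<in> spline_space D j \<phi>"
    using spline_space_iff[OF fourier_L2_add[OF F(1) G(1)]] spline_spectrum_add[OF F(2) G(2)] by simp
next
  fix s :: "nat \<Rightarrow> real ^ 'n \<Rightarrow> complex" and f
  assume s: "\<forall>n. s n \<in> spline_space D j \<phi>" and lim: "L2_tendsto s f sequentially"
  have "\<exists>S. fourier_L2 (s n) S \<and> spline_spectrum j S" for n
    using spline_space_obtain[of "s n"] s by metis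
  then have "\<forall>n. \<exists>S. fourier_L2 (s n) S \<and> spline_spectrum j S" by blast
  from choice[OF this] obtain S where S: "\<And>n. fourier_L2 (s n) (S n)" "\<And>n. spline_spectrum j (S n)" by blast
  have "f \<in> L2_space" using lim by (simp add: L2_tendsto_def)
  then obtain F where F: "fourier_L2 f F" using fourier_L2_exists by blast
  have n: "L2_dist (S n) F = gauss_const TYPE('n) * L2_dist (s n) f" for n
    by (rule plancherel[OF fourier_L2_diff[OF S(1) F]])
  have "(\<lambda>n. gauss_const TYPE('n) * L2_dist (s n) f) \<longlonglongrightarrow> 0"
    using lim by (intro tendsto_mult_right_zero) (simp add: L2_tendsto_def)
  then have "L2_tendsto S F sequentially"
    using fourier_L2_spaces[OF S(1)] fourier_L2_spaces[OF F] by (simp add: L2_tendsto_def n)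
  then have "spline_spectrum j F" by (rule spline_spectrum_limit) (simp_all add: S(2))
  then show "f \<in> spline_space D j \<phi>" using spline_space_iff[OF F] by simp
qed

lemma spline_space_shift:
  assumes "f \<in> spline_space D j \<phi>"
  shows "(\<lambda>x. f (x - lattice_point D j k)) \<in> spline_space D j \<phi>"
proof -
  obtain F where F: "fourier_L2 f F" "spline_spectrum j F" by (rule spline_space_obtain[OF assms])
  show ?thesis
    using spline_space_iff[OF fourier_L2_shift[OF F(1)]] spline_spectrum_modulate[OF F(2)] by simp
qed

lemma spline_space_shift_iff:
  "f \<in> spline_space D j \<phi> \<longleftrightarrow> (\<lambda>x. f (x - lattice_point D j k)) \<in> spline_space D j \<phi>"
proof
  assume "(\<lambda>x. f (x - lattice_point D j k)) \<in> spline_space D j \<phi>"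
  from spline_space_shift[OF this, of "- k"] show "f \<in> spline_space D j \<phi>"
    by (simp add: lattice_point_uminus)
qed (rule spline_space_shift)

lemma generator_in_spline_space: "\<phi> \<in> spline_space D j \<phi>"
  using spline_space_iff[OF fourier_\<phi>] spline_spectrum_bspline_symbol by simp

lemma spline_riesz_basis: "riesz_basis (spline_space D j \<phi>) (\<lambda>k x. translate k x)"
proof -
  obtain A B where "riesz_generator \<Phi> A B" by (rule generator_bounds)
  then interpret riesz_generator \<Phi> A B .
  obtain c0 where c0: "c0 > 0" "\<And>f. f \<in> L2_space \<Longrightarrow> (\<lambda>x. f (dual_map j x)) \<in> L2_space \<and> L2_norm (\<lambda>x. f (dual_map j x)) = c0 * L2_norm f"
    by (rule L2_linear[OF dual_bij]) blast
  \<comment> \<open>Norms in the variable \<theta> and norms of the combinations of translates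
    differ by two factors: \<open>c0\<close> from the substitution and \<open>gauss_const\<close>
    from Plancherel.\<close>
  define \<kappa> where "\<kappa> = (c0 * gauss_const TYPE('n))\<^sup>2"
  have \<kappa>: "\<kappa> > 0" using c0(1) gauss_const_pos[where 'n='n] by (simp add: \<kappa>_def)
  define A' where "A' = A / \<kappa>"
  \<comment> \<open>Taking the maximum with \<open>A\<close> ensures \<open>A' \<le> B'\<close>, as
    no relation between \<open>A\<close> and \<open>B\<close> has been assumed.\<close>
  define B' where "B' = max A \<bar>B\<bar> / \<kappa>"
  have fin: "A' * (\<Sum>k\<in>K. (cmod (c k))\<^sup>2) \<le> (L2_norm (\<lambda>x. \<Sum>k\<in>K. c k * translate k x))\<^sup>2
      \<and> (L2_norm (\<lambda>x. \<Sum>k\<in>K. c k * translate k x))\<^sup>2 \<le> B' * (\<Sum>k\<in>K. (cmod (c k))\<^sup>2)"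
    if K: "finite K" for K c
  proof -
    let ?U = "\<lambda>\<omega>. \<Sum>k\<in>K. c k * translate_hat k \<omega>"
    have FS: "fourier_L2 (\<lambda>x. \<Sum>k\<in>K. c k * translate k x) ?U"
      by (intro fourier_L2_sum fourier_L2_scale fourier_translate)
    have "L2_norm (\<lambda>\<theta>. \<Sum>k\<in>K. c k * (trig_char (- k) \<theta> * \<Phi> \<theta>)) = c0 * L2_norm ?U"
      using c0(2)[OF fourier_L2_spaces(2)[OF FS]] unfolding translate_dual_map by simp
    also have "\<dots> = c0 * gauss_const TYPE('n) * L2_norm (\<lambda>x. \<Sum>k\<in>K. c k * translate k x)"
      using plancherel[OF FS] by simp
    finally have n: "(L2_norm (\<lambda>\<theta>. \<Sum>k\<in>K. c k * (trig_char (- k) \<theta> * \<Phi> \<theta>)))\<^sup>2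
        = \<kappa> * (L2_norm (\<lambda>x. \<Sum>k\<in>K. c k * translate k x))\<^sup>2"
      by (simp add: \<kappa>_def power_mult_distrib)
    note bd = finite_riesz_bounds(2,3)[OF K, of c, unfolded n]
    have "\<bar>B\<bar> * (\<Sum>k\<in>K. (cmod (c k))\<^sup>2) \<le> max A \<bar>B\<bar> * (\<Sum>k\<in>K. (cmod (c k))\<^sup>2)"
      by (intro mult_right_mono sum_nonneg) auto
    with bd(2) have "\<kappa> * (L2_norm (\<lambda>x. \<Sum>k\<in>K. c k * translate k x))\<^sup>2 \<le> max A \<bar>B\<bar> * (\<Sum>k\<in>K. (cmod (c k))\<^sup>2)"
      by linarith
    with bd(1) show ?thesis using \<kappa> unfolding A'_def B'_def by (simp add: field_simps)
  qed
  have "0 < A'" "A' \<le> B'" using A_pos \<kappa> by (auto simp: A'_def B'_def divide_right_mono)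
  moreover have "\<exists>f\<in>spline_space D j \<phi>. L2_has_sum (\<lambda>k x. c k * translate k x) f \<and>
       A' * (ell2_norm c)\<^sup>2 \<le> (L2_norm f)\<^sup>2 \<and> (L2_norm f)\<^sup>2 \<le> B' * (ell2_norm c)\<^sup>2" if c: "c \<in> ell2" for c
  proof -
    have "\<exists>f. L2_has_sum (\<lambda>k x. c k * translate k x) f"
    proof (rule L2_has_sum_exists[OF _ _ _ c, where u="\<lambda>k x. translate k x" and B=B'])
      show "(translate k) \<in> L2_space" for k by (rule fourier_L2_spaces(1)[OF fourier_translate])
      show "0 \<le> B'" using A_pos \<kappa> by (simp add: B'_def)
    qed (use fin in blast)
    then obtain f where f: "L2_has_sum (\<lambda>k x. c k * translate k x) f" ..
    moreover have "f \<in> spline_space D j \<phi>" using c f by (auto simp: spline_space_def)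
    ultimately show ?thesis
      using L2_has_sum_bounds[where u="\<lambda>k x. translate k x" and A=A' and B=B', OF fin c f] by blast
  qed
  ultimately have 3: "\<exists>A B. 0 < A \<and> A \<le> B \<and> (\<forall>c\<in>ell2. \<exists>f\<in>spline_space D j \<phi>.
      L2_has_sum (\<lambda>k x. c k * translate k x) f \<and>
       A * (ell2_norm c)\<^sup>2 \<le> (L2_norm f)\<^sup>2 \<and> (L2_norm f)\<^sup>2 \<le> B * (ell2_norm c)\<^sup>2)" by blast
  show ?thesis unfolding riesz_basis_def
  proof (intro conjI allI ballI)
    show "(translate k) \<in> spline_space D j \<phi>" for k
      by (rule spline_space_shift[OF generator_in_spline_space])
    show "\<exists>c\<in>ell2. L2_has_sum (\<lambda>k x. c k * translate k x) f" if "f \<in> spline_space D j \<phi>" for f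
      using that by (simp add: spline_space_def)
  qed (rule 3)
qed

end

text \<open>Reduction modulo Z^n to the cell around the origin instead of \<open>unit_cell\<close>:
  under dilation a cell with the origin in its interior exhausts the space, one with the origin at a
  corner does not.\<close>

definition centered :: "real ^ 'n \<Rightarrow> real ^ 'n" where
  "centered x = (\<chi> i. x $ i - of_int \<lfloor>x $ i + 1/2\<rfloor>)"

lemma centered_periodic: "centered (x + real_vec k) = centered x"
proof -
  have "\<lfloor>x $ i + of_int (k $ i) + 1/2\<rfloor> = \<lfloor>x $ i + 1/2\<rfloor> + k $ i" for i
    using floor_add_int[of "x $ i + 1/2" "k $ i"] by (simp add: algebra_simps)
  then show ?thesis by (simp add: centered_def real_vec_def vec_eq_iff)
qed

lemma centered_small: "norm x < 1/2 \<Longrightarrow> centered x = x"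
proof -
  assume n: "norm x < 1/2"
  have "\<lfloor>x $ i + 1/2\<rfloor> = 0" for i
    using component_le_norm_cart[of x i] n by (intro floor_unique) auto
  then show ?thesis by (simp add: centered_def vec_eq_iff)
qed

lemma centered_measurable [measurable]: "centered \<in> borel_measurable borel"
  by (subst borel_measurable_euclidean_space) (auto simp: Basis_vec_def inner_axis centered_def)

section \<open>Union and intersection of the spline spaces\<close>

context spline_level
begin

text \<open>At level \<open>j - n\<close> the inverse substitution divides norms by a multiple of
  \<open>a ^ n\<close>, so every point finally lies in the region where \<open>centered\<close> is
  the identity.\<close>

lemma dual_map_inv_eventually_small:
  "\<forall>\<^sub>F n in sequentially. norm (dual_map_inv (j - int n) \<omega>) < 1/2"
proof -
  obtain N where N: "2 * a powi j * norm \<omega> < a ^ N" using real_arch_pow[OF a] by blast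
  have "norm (dual_map_inv (j - int n) \<omega>) < 1/2" if n: "n \<ge> N" for n
  proof -
    have "norm \<omega> = 2 * pi * a powi (- (j - int n)) * norm (dual_map_inv (j - int n) \<omega>)"
      using norm_dual_map[of "j - int n" "dual_map_inv (j - int n) \<omega>"] by simp
    also have "a powi (- (j - int n)) = a ^ n / a powi j"
      using a by (simp add: power_int_diff)
    finally have eq: "norm \<omega> = 2 * pi * (a ^ n / a powi j) * norm (dual_map_inv (j - int n) \<omega>)" .
    have pj: "a powi j > 0" "a ^ n > 0" using a by auto
    have "norm (dual_map_inv (j - int n) \<omega>) = norm \<omega> * a powi j / (2 * pi * a ^ n)"
      unfolding eq using pj a by simp
    \<comment> \<open>The factor \<open>2 * pi\<close> is simply bounded below by 1.\<close>
    also have "\<dots> \<le> norm \<omega> * a powi j / (1 * a ^ n)"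
      using pj pi_gt3 by (intro divide_left_mono mult_right_mono mult_pos_pos) (auto simp: mult_nonneg_nonneg)
    also have "\<dots> < 1/2"
    proof -
      have "a ^ N \<le> a ^ n" by (rule power_increasing[OF n]) (use a in simp)
      from less_le_trans[OF N this] have "2 * (norm \<omega> * a powi j) < a ^ n" by (simp add: mult_ac)
      then show ?thesis using pj by (simp add: field_simps)
    qed
    finally show ?thesis .
  qed
  then show ?thesis by (auto simp: eventually_sequentially)
qed

text \<open>Two errors below \<open>e/2\<close> are made: the quotient of \<open>F\<close> by the
  symbol is truncated in modulus, and the truncated function is replaced by its periodic version.
  Dominated convergence treats both, with \<open>F\<close> and a multiple of the symbol as
  majorants.\<close>

lemma spline_spectra_dense:
  assumes F: "F \<in> L2_space" and e: "e > 0"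
  shows "\<exists>i G. G \<in> L2_space \<and> spline_spectrum i G \<and> L2_dist F G < e"
proof -
  have \<phi>2: "\<phi>hat \<in> L2_space" by (rule fourier_L2_spaces(2)[OF fourier_\<phi>])
  have [measurable]: "F \<in> borel_measurable lebesgue" "\<phi>hat \<in> borel_measurable lebesgue"
    by (intro L2_measurable F \<phi>2)+
  have "(\<lambda>\<omega>. F \<omega> / \<phi>hat \<omega>) \<in> borel_measurable lebesgue" by measurable
  \<comment> \<open>A Borel representative is taken because its truncations will be composed with
    the Borel map that reduces a point to the cell.\<close>
  then obtain H where H[measurable]: "H \<in> borel_measurable borel" and FH: "AE \<omega> in lebesgue. F \<omega> / \<phi>hat \<omega> = H \<omega>"
    by (rule lebesgue_borel_representative)
  have FH': "AE \<omega> in lebesgue. F \<omega> = H \<omega> * \<phi>hat \<omega>"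
    using FH \<phi>hat_nonzero by eventually_elim (auto simp: field_simps)
  define h where "h n \<omega> = (if cmod (H \<omega>) \<le> real n then H \<omega> else 0)" for n \<omega>
  have hm[measurable]: "h n \<in> borel_measurable borel" for n unfolding h_def[abs_def] by measurable
  have hm'[measurable]: "h n \<in> borel_measurable lebesgue" for n using hm by (simp add: measurable_completion)
  have hb: "cmod (h n \<omega>) \<le> real n" for n \<omega> by (simp add: h_def)
  have s1m: "(\<lambda>\<omega>. F \<omega> - h n \<omega> * \<phi>hat \<omega>) \<in> borel_measurable lebesgue" for n by measurable
  have s1l: "AE \<omega> in lebesgue. (\<lambda>n. F \<omega> - h n \<omega> * \<phi>hat \<omega>) \<longlonglongrightarrow> 0"
    using FH'
  proof eventually_elim
    case (elim \<omega>)
    obtain N where N: "cmod (H \<omega>) \<le> real N" using real_arch_simple by blast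
    have "F \<omega> - h n \<omega> * \<phi>hat \<omega> = 0" if "n \<ge> N" for n using elim N that by (simp add: h_def)
    then show ?case by (intro tendsto_eventually) (auto simp: eventually_sequentially)
  qed
  have s1b: "AE \<omega> in lebesgue. cmod (F \<omega> - h n \<omega> * \<phi>hat \<omega>) \<le> cmod (F \<omega>)" for n
    using FH' by eventually_elim (simp add: h_def)
  have e2: "e/2 > 0" using e by simp
  obtain N where N: "L2_norm (\<lambda>\<omega>. F \<omega> - h N \<omega> * \<phi>hat \<omega>) < e/2"
    by (rule L2_dominated_small[OF s1m F s1l s1b e2])
  \<comment> \<open>\<open>m n\<close> reads \<open>h N\<close> at the representative of the point
    in the centred cell of level \<open>j - n\<close>; it is periodic for that level and agrees with
    \<open>h N\<close> around the origin, on a region that grows with \<open>n\<close>.\<close>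
  define m where "m n \<omega> = h N (dual_map (j - int n) (centered (dual_map_inv (j - int n) \<omega>)))" for n \<omega>
  have lin: "linear T \<Longrightarrow> T \<in> borel_measurable borel" for T :: "real ^ 'n \<Rightarrow> real ^ 'n"
    by (intro borel_measurable_continuous_onI linear_continuous_on) (simp add: linear_conv_bounded_linear)
  have [measurable]: "dual_map i \<in> borel_measurable borel" "dual_map_inv i \<in> borel_measurable borel" for i
    by (intro lin linear_dual_map)+
  have "m n \<in> borel_measurable borel" for n unfolding m_def[abs_def] by measurable
  then have [measurable]: "m n \<in> borel_measurable lebesgue" for n by (simp add: measurable_completion)
  have mper: "m n (\<omega> + dual_map (j - int n) (real_vec k)) = m n \<omega>" for n \<omega> k
    by (simp add: m_def linear_add[OF linear_dual_map(2)] centered_periodic)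
  have mb: "cmod (m n \<omega>) \<le> real N" for n \<omega> by (simp add: m_def hb)
  \<comment> \<open>The symbol satisfies the relation at level \<open>j\<close>, hence also at the
    lower level \<open>j - n\<close>, whose lattice is contained in that of level
    \<open>j\<close>.\<close>
  have mspec: "spline_spectrum (j - int n) (\<lambda>\<omega>. m n \<omega> * \<phi>hat \<omega>)" for n
    by (rule spline_spectrum_mult[OF spline_spectrum_antimono[OF _ spline_spectrum_bspline_symbol] mper]) simp
  have mL2: "(\<lambda>\<omega>. m n \<omega> * \<phi>hat \<omega>) \<in> L2_space" "(\<lambda>\<omega>. h N \<omega> * \<phi>hat \<omega>) \<in> L2_space" for n
    by (rule L2_mult_bounded(1)[OF \<phi>2 _ mb] L2_mult_bounded(1)[OF \<phi>2 _ hb], measurable)+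
  have s2m: "(\<lambda>\<omega>. h N \<omega> * \<phi>hat \<omega> - m n \<omega> * \<phi>hat \<omega>) \<in> borel_measurable lebesgue" for n by measurable
  have s2l: "(\<lambda>n. h N \<omega> * \<phi>hat \<omega> - m n \<omega> * \<phi>hat \<omega>) \<longlonglongrightarrow> 0" for \<omega>
  proof (rule tendsto_eventually)
    show "\<forall>\<^sub>F n in sequentially. h N \<omega> * \<phi>hat \<omega> - m n \<omega> * \<phi>hat \<omega> = 0"
      using dual_map_inv_eventually_small[of \<omega>] by eventually_elim (simp add: m_def centered_small)
  qed
  have w: "(\<lambda>\<omega>. complex_of_real (2 * real N) * \<phi>hat \<omega>) \<in> L2_space" by (rule L2_scale[OF \<phi>2])
  have s2b: "cmod (h N \<omega> * \<phi>hat \<omega> - m n \<omega> * \<phi>hat \<omega>) \<le> cmod (complex_of_real (2 * real N) * \<phi>hat \<omega>)" for n \<omega>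
  proof -
    have "cmod (h N \<omega> * \<phi>hat \<omega> - m n \<omega> * \<phi>hat \<omega>) = cmod (h N \<omega> - m n \<omega>) * cmod (\<phi>hat \<omega>)"
      by (simp add: norm_mult left_diff_distrib[symmetric])
    also have "\<dots> \<le> (2 * real N) * cmod (\<phi>hat \<omega>)"
      using norm_triangle_ineq4[of "h N \<omega>" "m n \<omega>"] hb[of N \<omega>] mb[of n \<omega>] by (intro mult_right_mono) auto
    finally show ?thesis by (simp add: norm_mult)
  qed
  obtain n where n: "L2_norm (\<lambda>\<omega>. h N \<omega> * \<phi>hat \<omega> - m n \<omega> * \<phi>hat \<omega>) < e/2"
    by (rule L2_dominated_small[OF s2m w AE_I2[OF s2l] AE_I2[OF s2b] e2])
  have "L2_norm (\<lambda>\<omega>. F \<omega> - m n \<omega> * \<phi>hat \<omega>) < e"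
    using L2_norm_triangle3[OF F mL2(2) mL2(1)[of n]] N n by linarith
  with mspec mL2(1) show ?thesis by blast
qed

text \<open>
  As \<open>i\<close> grows the period lattices become dense, so a common spectrum has a constant product
  with \<open>Lhat\<close>.
\<close>

lemma all_spline_spectra_const:
  assumes F: "F \<in> L2_space" and all: "\<And>i. spline_spectrum i F"
  shows "\<exists>c. AE \<omega> in lebesgue. F \<omega> * Lhat \<omega> = c"
proof -
  obtain A B where "riesz_generator \<Phi> A B" by (rule generator_bounds)
  then interpret riesz_generator \<Phi> A B .
  note comp = measurable_compose[OF nn_integral_lebesgue_linear(1)[OF dual_bij]]
  have [measurable]: "(\<lambda>\<theta>. F (dual_map j \<theta>)) \<in> borel_measurable lebesgue" "(\<lambda>\<theta>. Lhat (dual_map j \<theta>)) \<in> borel_measurable lebesgue"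
     "\<Phi> \<in> borel_measurable lebesgue"
    using comp[OF L2_measurable[OF F]] comp[OF Lhat_measurable] \<Phi>_measurable by auto
  define m where "m \<theta> = F (dual_map j \<theta>) / \<Phi> \<theta>" for \<theta>
  define M where "M \<theta> = F (dual_map j \<theta>) * Lhat (dual_map j \<theta>)" for \<theta>
  have m: "m \<in> borel_measurable lebesgue" unfolding m_def[abs_def] by measurable
  have Mm: "M \<in> borel_measurable lebesgue" unfolding M_def[abs_def] by measurable
  have mper: "AE_periodic m" unfolding m_def[abs_def] by (rule quotient_periodic[OF all])
  have inv: "AE \<theta> in lebesgue. M (\<theta> + t) = M \<theta>" if t: "dual_map j t = dual_map i (real_vec n)" for t i n
    using nn_integral_lebesgue_linear(2)[OF dual_bij all[of i, unfolded spline_spectrum_def, THEN spec, of n]]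
    by (simp add: M_def dual_map_add t)
  have Mper: "AE_periodic M" unfolding AE_periodic_def by (intro allI inv) (rule refl)
  obtain c0 where c0: "\<And>f. f \<in> L2_space \<Longrightarrow> (\<lambda>x. f (dual_map j x)) \<in> L2_space \<and> L2_norm (\<lambda>x. f (dual_map j x)) = c0 * L2_norm f"
    by (rule L2_linear[OF dual_bij]) blast
  have FT: "(\<lambda>\<theta>. F (dual_map j \<theta>)) \<in> L2_space" using c0[OF F] by simp
  have nz: "AE \<theta> in lebesgue. \<Phi> \<theta> \<noteq> 0"
    by (rule nn_integral_lebesgue_linear(2)[OF dual_bij \<phi>hat_nonzero])
  have Fm: "AE \<theta> in lebesgue. F (dual_map j \<theta>) = m \<theta> * \<Phi> \<theta>"
    using nz by eventually_elim (simp add: m_def)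
  have "(\<lambda>\<theta>. m \<theta> * \<Phi> \<theta>) \<in> borel_measurable lebesgue" using m by measurable
  then have mL: "on_cell m \<in> L2_space"
    by (rule on_cell_L2_of_product(1)[OF m mper L2_AE_cong(1)[OF FT _ Fm]])
  \<comment> \<open>\<open>C\<close> bounds the localization symbol; as \<open>M\<close> is almost
    everywhere that symbol times \<open>m\<close>, square integrability over the cell passes from
    \<open>m\<close> to \<open>M\<close>.\<close>
  define C where "C = (\<Sum>\<^sub>\<infinity>k. cmod (p k))"
  have ps: "(\<lambda>k. cmod (p k)) summable_on UNIV" using localizing by (simp add: localizing_sequence_def)
  have C: "C \<ge> 0" by (simp add: C_def infsum_nonneg)
  have "AE \<theta> in lebesgue. cmod (on_cell M \<theta>) \<le> C * cmod (on_cell m \<theta>)"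
    using nz nn_integral_lebesgue_linear(2)[OF dual_bij Lhat_nonzero]
  proof eventually_elim
    case (elim \<theta>)
    have "M \<theta> = localization_symbol D j p (dual_map j \<theta>) * m \<theta>"
      using elim by (simp add: M_def m_def bspline_symbol_def field_simps)
    moreover have "cmod (localization_symbol D j p (dual_map j \<theta>)) \<le> C"
      unfolding C_def by (rule localization_symbol_bounded[OF ps])
    ultimately have "cmod (M \<theta>) \<le> C * cmod (m \<theta>)" by (simp add: norm_mult mult_right_mono)
    then show ?case by (simp add: on_cell_def norm_mult indicator_def)
  qed
  then have oM: "on_cell M \<in> L2_space"
    by (rule L2_mono(1)[OF mL on_cell_measurable[OF Mm] _ C])
  have "\<exists>c. AE \<theta> in lebesgue. M \<theta> = c"
  proof (rule periodic_shift_invariant_const[OF Mm Mper oM])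
    fix k :: "int ^ 'n" assume k: "k \<noteq> 0"
    \<comment> \<open>\<open>N\<close> is so large that \<open>w\<close>, the image of
      \<open>k\<close> under the (-N)-th power of \<open>D\<close>, has norm below 1. A nonzero
      coordinate of \<open>w\<close> is then not an integer, so on the dual lattice vector of level
      \<open>j + N\<close> in that direction the character of \<open>k\<close> differs from
      1.\<close>
    obtain N where N: "norm (real_vec k) < a ^ N" using real_arch_pow[OF a] by blast
    define i where "i = j + int N"
    define w where "w = matrix_powi D (- int N) *v real_vec k"
    have nw: "norm w = norm (real_vec k) / a ^ N"
      using norm_matrix_powi[OF invertible_D norm_D, of "- int N" "real_vec k"] a
      by (simp add: w_def power_int_minus divide_inverse mult.commute)
    have "norm w < 1" using nw N a by simp
    moreover have "w \<noteq> 0"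
    proof -
      have "real_vec k \<noteq> 0" using k real_vec_inject[of k 0] by simp
      then have "norm w > 0" using nw a by simp
      then show ?thesis by auto
    qed
    then obtain s where s: "w $ s \<noteq> 0" by (auto simp: vec_eq_iff)
    ultimately have ws: "\<bar>w $ s\<bar> < 1" using component_le_norm_cart[of w s] by linarith
    define t where "t = dual_map_inv j (dual_map i (real_vec (axis s 1)))"
    have t: "dual_map j t = dual_map i (real_vec (axis s 1))" by (simp add: t_def)
    have "2 * pi * (real_vec k \<bullet> t) = lattice_point D j k \<bullet> dual_map i (real_vec (axis s 1))"
      unfolding t[symmetric] lattice_dual_map ..
    also have "lattice_point D j k = matrix_powi D i *v w"
      using matrix_powi_add[OF invertible_D, of i "- int N"]
      by (simp add: i_def w_def lattice_point_def matrix_vector_mul_assoc)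
    also have "(matrix_powi D i *v w) \<bullet> dual_map i (real_vec (axis s 1)) = 2 * pi * w $ s"
      by (simp add: matrix_powi_dual_map real_vec_axis inner_axis)
    finally have kt: "trig_char (- k) t = cis (- (2 * pi * w $ s))" by (simp add: trig_char_def)
    have "trig_char (- k) t \<noteq> 1"
    proof
      assume "trig_char (- k) t = 1"
      then have "cos (2 * pi * w $ s) = 1" unfolding kt by (simp add: complex_eq_iff)
      then obtain z :: int where "2 * pi * w $ s = of_int z * 2 * pi" using cos_one_2pi_int by auto
      then have "w $ s = of_int z" by simp
      with ws s show False by simp
    qed
    then show "\<exists>t. trig_char (- k) t \<noteq> 1 \<and> (AE \<theta> in lebesgue. M (\<theta> + t) = M \<theta>)"
      using inv[OF t] by blast
  qed
  then obtain c where c: "AE \<theta> in lebesgue. M \<theta> = c" ..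
  have "AE \<omega> in lebesgue. M (dual_map_inv j \<omega>) = c"
    by (rule nn_integral_lebesgue_linear(2)[OF dual_bij(2,1,4,3) c])
  then show ?thesis by (intro exI[of _ c]) (simp add: M_def)
qed

end

section \<open>Verification of the multiresolution axioms\<close>

theorem proposition1:
  fixes L :: "(real ^ 'n \<Rightarrow> complex) \<Rightarrow> real ^ 'n \<Rightarrow> complex"
    and Lhat :: "real ^ 'n \<Rightarrow> complex"
    and D :: "real ^ 'n ^ 'n"
    and r :: real
    and \<phi> :: "int \<Rightarrow> real ^ 'n \<Rightarrow> complex"
  assumes "spline_admissible_pair L Lhat D r"
    and "\<And>j. generalized_bspline Lhat D j (\<phi> j)"
  shows "nonstationary_MRA D (\<lambda>j. spline_space D j (\<phi> j))"
proof -
  obtain a R where aR: "a > 1" "orthogonal_matrix R" "D = a *\<^sub>R R" and int: "int_matrix D"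
    and adm: "admissible_multiplier L Lhat"
    using assms(1) by (auto simp: spline_admissible_pair_def)
  obtain f g where fg: "AE \<omega> in lebesgue. Lhat \<omega> = f \<omega> / g \<omega>" "{\<omega>. f \<omega> * g \<omega> = 0} \<in> null_sets lebesgue"
    and Lm: "Lhat \<in> borel_measurable lebesgue"
    using adm by (auto simp: admissible_multiplier_def fourier_multiplier_def)
  \<comment> \<open>Outside the null set of zeros of \<open>f * g\<close>, numerator and denominator
    are both nonzero.\<close>
  have Lnz: "AE \<omega> in lebesgue. Lhat \<omega> \<noteq> 0"
    using fg(1) AE_not_in[OF fg(2)] by eventually_elim auto
  interpret similarity_matrix D a
    unfolding aR(3) by (rule similarity_matrix_scaled_orthogonal) (use aR int in auto)
  interpret spline_setting D a Lhat by unfold_locales (rule Lm Lnz)+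
  have "\<forall>j. \<exists>p. localizing_sequence Lhat D j p \<and> fourier_L2 (\<phi> j) (bspline_symbol Lhat D j p)"
    using assms(2) by (simp add: generalized_bspline_def)
  from choice[OF this] obtain p where p: "\<And>j. localizing_sequence Lhat D j (p j)"
    "\<And>j. fourier_L2 (\<phi> j) (bspline_symbol Lhat D j (p j))" by blast
  have level: "spline_level D a Lhat j (p j) (\<phi> j)" for j
    by unfold_locales (rule p)+
  show ?thesis
    unfolding nonstationary_MRA_def
  proof (intro conjI allI ballI impI int expansive_D)
    show "L2_closed_subspace (spline_space D j (\<phi> j))" for j
      by (rule spline_level.spline_space_closed[OF level])
    show "spline_space D (j + 1) (\<phi> (j + 1)) \<subseteq> spline_space D j (\<phi> j)" for j
    proof
      fix f assume "f \<in> spline_space D (j + 1) (\<phi> (j + 1))"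
      then obtain F where F: "fourier_L2 f F" "spline_spectrum (j + 1) F"
        by (rule spline_level.spline_space_obtain[OF level])
      have "spline_spectrum j F" by (rule spline_spectrum_antimono[OF _ F(2)]) simp
      then show "f \<in> spline_space D j (\<phi> j)"
        using spline_level.spline_space_iff[OF level F(1)] by simp
    qed
    show "f \<in> spline_space D j (\<phi> j) \<longleftrightarrow> (\<lambda>x. f (x - lattice_point D j k)) \<in> spline_space D j (\<phi> j)" for j k f
      by (rule spline_level.spline_space_shift_iff[OF level])
    show "\<exists>\<psi>\<in>spline_space D j (\<phi> j). riesz_basis (spline_space D j (\<phi> j)) (\<lambda>k x. \<psi> (x - lattice_point D j k))" for j
      by (intro bexI[of _ "\<phi> j"] spline_level.spline_riesz_basis[OF level] spline_level.generator_in_spline_space[OF level])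
  next
    fix f :: "real ^ 'n \<Rightarrow> complex" and \<epsilon> :: real
    assume f: "f \<in> L2_space" and \<epsilon>: "0 < \<epsilon>"
    let ?\<kappa> = "gauss_const TYPE('n)"
    have \<kappa>: "?\<kappa> > 0" by (rule gauss_const_pos)
    obtain F where F: "fourier_L2 f F" using fourier_L2_exists[OF f] by blast
    have "?\<kappa> * \<epsilon> > 0" using \<kappa> \<epsilon> by simp
    \<comment> \<open>The approximation starts from one fixed B-spline, here that of level 0, and
      itself yields the level \<open>i\<close>. The tolerance is scaled by the Plancherel
      factor.\<close>
    from spline_level.spline_spectra_dense[OF level[of 0] fourier_L2_spaces(2)[OF F] this]
    obtain i G where G: "G \<in> L2_space" "spline_spectrum i G" "L2_dist F G < ?\<kappa> * \<epsilon>" by blast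
    obtain g where g: "fourier_L2 g G" using fourier_L2_surj[OF G(1)] by blast
    have "?\<kappa> * L2_dist f g < ?\<kappa> * \<epsilon>"
      using G(3) plancherel[OF fourier_L2_diff[OF F g]] by simp
    then have "L2_dist f g < \<epsilon>" using \<kappa> by simp
    moreover have "g \<in> spline_space D i (\<phi> i)"
      using spline_level.spline_space_iff[OF level g] G(2) by simp
    ultimately show "\<exists>g\<in>(\<Union>j. spline_space D j (\<phi> j)). L2_dist f g < \<epsilon>" by blast
  next
    let ?I = "\<Inter>j. spline_space D j (\<phi> j)"
    have const: "\<exists>F c. fourier_L2 f F \<and> (AE \<omega> in lebesgue. F \<omega> * Lhat \<omega> = c)" if f: "f \<in> ?I" for f
    proof -
      have f0: "f \<in> spline_space D j (\<phi> j)" for j using f by blast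
      obtain F where F: "fourier_L2 f F" by (rule spline_level.spline_space_obtain[OF level f0[of 0]])
      have "spline_spectrum j F" for j using spline_level.spline_space_iff[OF level F] f0 by simp
      from spline_level.all_spline_spectra_const[OF level[of 0] fourier_L2_spaces(2)[OF F] this]
      show ?thesis using F by blast
    qed
    show "\<exists>g\<in>L2_space. \<forall>f\<in>?I. \<exists>c. AE x in lebesgue. f x = c * g x"
    \<comment> \<open>If the intersection is trivial, the zero function generates it. Otherwise any
      element that is not almost everywhere 0 does, since transforms whose products with
      \<open>Lhat\<close> are constant are proportional.\<close>
    proof (cases "\<forall>f\<in>?I. AE x in lebesgue. f x = 0")
      case True
      then show ?thesis by (intro bexI[OF _ L2_zero] ballI exI[of _ 0]) simp
    next
      case False
      then obtain g where g: "g \<in> ?I" "\<not> (AE x in lebesgue. g x = 0)" by blast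
      obtain G c where G: "fourier_L2 g G" "AE \<omega> in lebesgue. G \<omega> * Lhat \<omega> = c" using const[OF g(1)] by blast
      \<comment> \<open>A zero constant would make \<open>G\<close>, and hence \<open>g\<close>,
        vanish almost everywhere, because \<open>Lhat\<close> is nonzero almost everywhere.\<close>
      have c: "c \<noteq> 0"
      proof
        assume c: "c = 0"
        have "AE \<omega> in lebesgue. G \<omega> = 0" using G(2) Lnz by eventually_elim (simp add: c)
        then show False using fourier_L2_inj[OF G(1) fourier_L2_zero] g(2) by simp
      qed
      have "\<exists>b. AE x in lebesgue. f x = b * g x" if f: "f \<in> ?I" for f
      proof -
        obtain F d where F: "fourier_L2 f F" "AE \<omega> in lebesgue. F \<omega> * Lhat \<omega> = d" using const[OF f] by blast
        have "AE \<omega> in lebesgue. F \<omega> = d / c * G \<omega>"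
          using F(2) G(2) Lnz
        proof eventually_elim
          case (elim \<omega>)
          have "F \<omega> * Lhat \<omega> = d / c * G \<omega> * Lhat \<omega>" using elim(1,2) c by (simp add: mult.assoc)
          then show ?case unfolding mult_right_cancel[OF elim(3)] .
        qed
        then have "AE x in lebesgue. f x = d / c * g x"
          unfolding fourier_L2_inj[OF F(1) fourier_L2_scale[OF G(1)]] .
        then show ?thesis by blast
      qed
      moreover have "g \<in> L2_space" by (rule fourier_L2_spaces(1)[OF G(1)])
      ultimately show ?thesis by blast
    qed
  qed
qed

end
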